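(* Let $n \geq 3$ and let $(\mathcal{F}, \mathcal{G})$ be a flag of reduced holomorphic distributions on $\mathbb{P}^n$ (complex projective space) with $\dim(\mathcal{F}) = 1$, $\mathrm{codim}(\mathcal{G}) = 1$ and $\deg(\mathcal{G}) \geq 2$. Suppose that (i) if $n$ is even, then $\deg(\mathcal{F}) \neq \frac{n}{2}\deg(\mathcal{G})$; (ii) if $n$ is odd, then $\deg(\mathcal{F}) \neq \frac{n-1}{2}\deg(\mathcal{G}) - 1$; (iii) $\mathrm{Sing}(\mathcal{G})$ is isolated, i.e. consists of isolated points. Then $\deg(\mathcal{G}) \leq \deg(\mathcal{F}) - 1$.
   Context: A (singular) holomorphic distribution $\mathcal{D}$ of dimension $r$ on a connected complex manifold $M$ of dimension $n$ is a coherent subsheaf $\widetilde{\mathcal{D}}$ of rank $r$ of the tangent sheaf $\mathcal{O}(TM)$, called the tangent sheaf of $\mathcal{D}$; its codimension is $n-r$, and $\mathcal{N}_{\mathcal{D}} = \mathcal{O}(TM)/\widetilde{\mathcal{D}}$ is its normal sheaf. The singular set $\mathrm{Sing}(\mathcal{D})$ is the set of points $p$ where the stalk $(\mathcal{N}_{\mathcal{D}})_p$ is not a free $\mathcal{O}_p$-module. $\mathcal{D}$ is reduced if $\widetilde{\mathcal{D}}$ is full (saturated): whenever $U \subset M$ is open and $\sigma$ is a holomorphic section of $\mathcal{O}(TM)|_U$ with $\sigma_p \in \widetilde{\mathcal{D}}_p$ for all $p \in U \setminus \mathrm{Sing}(\mathcal{D})$, then $\sigma_p \in \widetilde{\mathcal{D}}_p$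 for all $p \in U$. A flag of distributions $(\mathcal{D}_{1}, \dots, \mathcal{D}_{m})$ on $M$ is a collection of distributions with $1 \leq \dim \mathcal{D}_1 < \cdots < \dim\mathcal{D}_m < n$ such that $\widetilde{\mathcal{D}}_{i}$ is a subsheaf of $\widetilde{\mathcal{D}}_{i+1}$ (inside $\mathcal{O}(TM)$) for each $i$. Degree: a codimension $q$ distribution $\mathcal{D}$ on $\mathbb{P}^n$ is given by a section $\omega \in H^0(\mathbb{P}^n, \Omega^{q}_{\mathbb{P}^n}\otimes\mathcal{L})$ (locally decomposable, with $\mathcal{L}$ a line bundle), whose annihilator is $\widetilde{\mathcal{D}}$; in the reduced case $\mathcal{L} = \det \mathcal{N}_{\mathcal{D}}$. For a general linear immersion $\mathrm{i}:\mathbb{P}^{q}\to\mathbb{P}^n$, $\deg(\mathcal{D})$ is the degree of the zero divisor of $\mathrm{i}^*\omega$ as a section of the line bundle $\Omega^q_{\mathbb{P}^q}\otimes \mathrm{i}^*\mathcal{L}$. Equivalently $\mathcal{L} = \mathcal{O}_{\mathbb{P}^n}(\deg(\mathcal{D}) + q + 1)$. Thus $\mathcal{G}$ is given by $\omega \in H^0(\mathbb{P}^n,\Omega^1_{\mathbb{P}^n}(\deg(\mathcal{G})+2))$, and $\mathcal{F}$ by $X \in H^0(\mathbb{P}^n, T\mathbb{P}^n(\deg(\mathcal{F})-1))$. *)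

theory Defs
  imports "HOL-Analysis.Analysis"
begin

section \<open>Complex projective space\<close>

text \<open>
  Points are classes of nonzero vectors of homogeneous coordinates, which are indexed by a
  finite type \<open>'i\<close>; the dimension is \<open>n\<close> when \<open>CARD('i) = n + 1\<close>. Since the quotient is partial,
  \<open>abs_proj 0\<close> is meaningless, and \<open>abs_proj z\<close> is only ever used for \<open>z \<noteq> 0\<close>.
\<close>

quotient_type 'i proj = "complex ^ 'i" / partial:
  "\<lambda>x y. x \<noteq> 0 \<and> y \<noteq> 0 \<and> (\<exists>c. y = c *s x)"
proof (rule part_equivpI)
  have "(axis undefined 1 :: complex ^ 'i) \<noteq> 0"
    by (simp add: axis_eq_0_iff)
  moreover have "\<exists>c. x = c *s x" for x :: "complex ^ 'i"
    by (rule exI[of _ 1]) simp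
  ultimately show "\<exists>x :: complex ^ 'i. x \<noteq> 0 \<and> x \<noteq> 0 \<and> (\<exists>c. x = c *s x)"
    by blast
  show "symp (\<lambda>x y :: complex ^ 'i. x \<noteq> 0 \<and> y \<noteq> 0 \<and> (\<exists>c. y = c *s x))"
  proof (rule sympI)
    fix x y :: "complex ^ 'i"
    assume a: "x \<noteq> 0 \<and> y \<noteq> 0 \<and> (\<exists>c. y = c *s x)"
    then obtain c where c: "y = c *s x" by blast
    with a have "c \<noteq> 0" by auto
    with c have "x = inverse c *s y" by (simp add: vector_smult_assoc)
    with a show "y \<noteq> 0 \<and> x \<noteq> 0 \<and> (\<exists>c. x = c *s y)" by blast
  qed
  show "transp (\<lambda>x y :: complex ^ 'i. x \<noteq> 0 \<and> y \<noteq> 0 \<and> (\<exists>c. y = c *s x))"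
    by (rule transpI) (metis vector_smult_assoc)
qed

text \<open>The preimage of a set under the projection from the punctured vector space.\<close>

definition punctured_cone :: "'i::finite proj set \<Rightarrow> (complex ^ 'i) set"
  where "punctured_cone U = {z. z \<noteq> 0 \<and> abs_proj z \<in> U}"

text \<open>The quotient topology.\<close>

instantiation proj :: (finite) topological_space
begin

definition open_proj :: "'a proj set \<Rightarrow> bool"
  where "open_proj U \<longleftrightarrow> open (punctured_cone U)"

instance
proof
  have "punctured_cone (UNIV :: 'a proj set) = - {0}" by (auto simp: punctured_cone_def)
  then show "open (UNIV :: 'a proj set)" by (simp add: open_proj_def open_Compl)
next
  fix S T :: "'a proj set"
  assume "open S" "open T"
  moreover have "punctured_cone (S \<inter> T) = punctured_cone S \<inter> punctured_cone T"
    by (auto simp: punctured_cone_def)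
  ultimately show "open (S \<inter> T)" by (simp add: open_proj_def open_Int)
next
  fix K :: "'a proj set set"
  assume "\<forall>S\<in>K. open S"
  moreover have "punctured_cone (\<Union>K) = (\<Union>S\<in>K. punctured_cone S)"
    by (auto simp: punctured_cone_def)
  ultimately show "open (\<Union>K)" by (auto simp: open_proj_def)
qed

end

definition holo_on :: "(complex ^ 'i::finite) set \<Rightarrow> (complex ^ 'i \<Rightarrow> complex) \<Rightarrow> bool"
  where "holo_on S f \<longleftrightarrow>
    (\<forall>z\<in>S. \<exists>f'. (f has_derivative f') (at z) \<and> (\<forall>c v. f' (c *s v) = c * f' v))"


section \<open>Structure sheaf and tangent sheaf\<close>

text \<open>
  Sections over an open set \<open>U\<close> are represented by total functions whose values outside \<open>U\<close> are
  irrelevant. Accordingly a stalk is represented by the set of its representatives, and two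
  representatives give the same germ at \<open>p\<close> iff they agree eventually in \<open>nhds p\<close>.
\<close>

definition structure_sheaf :: "'i::finite proj set \<Rightarrow> ('i proj \<Rightarrow> complex) set" (\<open>\<O>\<close>)
  where "\<O> U = {f. holo_on (punctured_cone U) (\<lambda>z. f (abs_proj z))}"

definition stalk :: "('i::finite proj set \<Rightarrow> 's set) \<Rightarrow> 'i proj \<Rightarrow> 's set"
  where "stalk S p = {s. \<exists>U. open U \<and> p \<in> U \<and> s \<in> S U}"

type_synonym 'i tangent = "('i proj \<Rightarrow> complex) \<Rightarrow> complex"
type_synonym 'i vfield = "'i proj \<Rightarrow> 'i tangent"

text \<open>
  Tangent vectors at \<open>p\<close> are the complex-linear derivations of the local ring at \<open>p\<close>. They are
  set to zero on functions that are not holomorphic near \<open>p\<close>, so that equality of tangent vectors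
  is equality of functions.
\<close>

definition tangent_space :: "'i::finite proj \<Rightarrow> 'i tangent set"
  where "tangent_space p = {\<delta>.
    (\<forall>f\<in>stalk \<O> p. \<forall>g\<in>stalk \<O> p. \<delta> (\<lambda>x. f x + g x) = \<delta> f + \<delta> g) \<and>
    (\<forall>c. \<forall>f\<in>stalk \<O> p. \<delta> (\<lambda>x. c * f x) = c * \<delta> f) \<and>
    (\<forall>f\<in>stalk \<O> p. \<forall>g\<in>stalk \<O> p. \<delta> (\<lambda>x. f x * g x) = f p * \<delta> g + g p * \<delta> f) \<and>
    (\<forall>f\<in>stalk \<O> p. \<forall>g\<in>stalk \<O> p. (\<forall>\<^sub>F x in nhds p. f x = g x) \<longrightarrow> \<delta> f = \<delta> g) \<and>
    (\<forall>f. f \<notin> stalk \<O> p \<longrightarrow> \<delta> f = 0)}"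

definition tangent_sheaf :: "'i::finite proj set \<Rightarrow> 'i vfield set" (\<open>\<T>\<close>)
  where "\<T> U = {v. (\<forall>p\<in>U. v p \<in> tangent_space p) \<and>
    (\<forall>V f. open V \<longrightarrow> V \<subseteq> U \<longrightarrow> f \<in> \<O> V \<longrightarrow> (\<lambda>p. v p f) \<in> \<O> V)}"

definition comb :: "nat \<Rightarrow> (nat \<Rightarrow> 'i::finite proj \<Rightarrow> complex) \<Rightarrow> (nat \<Rightarrow> 'i vfield) \<Rightarrow> 'i vfield"
  where "comb m a s = (\<lambda>x g. \<Sum>i<m. a i x * s i x g)"


section \<open>Coherent subsheaves of the tangent sheaf\<close>

text \<open>
  Restriction and gluing take this simple form because all local sections are sections of the
  tangent sheaf, represented by total functions. The values on non-open sets are irrelevant.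
\<close>

definition tangent_subsheaf :: "('i::finite proj set \<Rightarrow> 'i vfield set) \<Rightarrow> bool"
  where "tangent_subsheaf D \<longleftrightarrow> (\<forall>U. open U \<longrightarrow>
    D U \<subseteq> \<T> U \<and>
    (\<lambda>_ _. 0) \<in> D U \<and>
    (\<forall>v\<in>D U. \<forall>w\<in>D U. (\<lambda>x g. v x g + w x g) \<in> D U) \<and>
    (\<forall>f\<in>\<O> U. \<forall>v\<in>D U. (\<lambda>x g. f x * v x g) \<in> D U) \<and>
    (\<forall>v\<in>D U. \<forall>w. (\<forall>x\<in>U. w x = v x) \<longrightarrow> w \<in> D U) \<and>
    (\<forall>V. open V \<longrightarrow> V \<subseteq> U \<longrightarrow> D U \<subseteq> D V) \<and>
    (\<forall>v. (\<forall>p\<in>U. \<exists>V. open V \<and> p \<in> V \<and> V \<subseteq> U \<and> v \<in> D V) \<longrightarrow> v \<in> D U))"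

definition finite_type :: "('i::finite proj set \<Rightarrow> 'i vfield set) \<Rightarrow> bool"
  where "finite_type D \<longleftrightarrow> (\<forall>p. \<exists>U m s. open U \<and> p \<in> U \<and> (\<forall>i<m. s i \<in> D U) \<and>
    (\<forall>q\<in>U. \<forall>v\<in>stalk D q. \<exists>a. (\<forall>i<m. a i \<in> stalk \<O> q) \<and>
      (\<forall>\<^sub>F x in nhds q. v x = comb m a s x)))"

text \<open>For all local sections \<open>s 0, \<dots>, s (m - 1)\<close>, the sheaf of relations between them is of finite
  type: locally there are relations \<open>r 0, \<dots>, r (k - 1)\<close> that generate it at every point.\<close>

definition finite_type_relations :: "('i::finite proj set \<Rightarrow> 'i vfield set) \<Rightarrow> bool"
  where "finite_type_relations D \<longleftrightarrow>
    (\<forall>U m s. open U \<and> (\<forall>i<m. s i \<in> D U) \<longrightarrow>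
      (\<forall>p\<in>U. \<exists>V (k::nat) r. open V \<and> p \<in> V \<and> V \<subseteq> U \<and>
        (\<forall>j<k. (\<forall>i<m. r j i \<in> \<O> V) \<and> (\<forall>x\<in>V. comb m (r j) s x = (\<lambda>_. 0))) \<and>
        (\<forall>q\<in>V. \<forall>a. (\<forall>i<m. a i \<in> stalk \<O> q) \<and>
            (\<forall>\<^sub>F x in nhds q. comb m a s x = (\<lambda>_. 0)) \<longrightarrow>
          (\<exists>b. (\<forall>j<k. b j \<in> stalk \<O> q) \<and>
            (\<forall>i<m. \<forall>\<^sub>F x in nhds q. a i x = (\<Sum>j<k. b j x * r j i x))))))"

definition coherent :: "('i::finite proj set \<Rightarrow> 'i vfield set) \<Rightarrow> bool"
  where "coherent D \<longleftrightarrow> finite_type D \<and> finite_type_relations D"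

definition germs_independent :: "'i::finite proj \<Rightarrow> nat \<Rightarrow> (nat \<Rightarrow> 'i vfield) \<Rightarrow> bool"
  where "germs_independent p m s \<longleftrightarrow> (\<forall>a. (\<forall>i<m. a i \<in> stalk \<O> p) \<and>
      (\<forall>\<^sub>F x in nhds p. comb m a s x = (\<lambda>_. 0)) \<longrightarrow>
    (\<forall>i<m. \<forall>\<^sub>F x in nhds p. a i x = 0))"

text \<open>The rank of a module over the (integral) local ring at \<open>p\<close> is the maximal number of linearly
  independent elements.\<close>

definition has_rank :: "('i::finite proj set \<Rightarrow> 'i vfield set) \<Rightarrow> nat \<Rightarrow> bool"
  where "has_rank D r \<longleftrightarrow> (\<forall>p.
    (\<exists>s. (\<forall>i<r. s i \<in> stalk D p) \<and> germs_independent p r s) \<and>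
    (\<forall>m s. (\<forall>i<m. s i \<in> stalk D p) \<and> germs_independent p m s \<longrightarrow> m \<le> r))"


section \<open>Distributions\<close>

definition distribution :: "('i::finite proj set \<Rightarrow> 'i vfield set) \<Rightarrow> nat \<Rightarrow> bool"
  where "distribution D r \<longleftrightarrow> tangent_subsheaf D \<and> coherent D \<and> has_rank D r"

text \<open>The classes of the germs of \<open>s 0, \<dots>, s (k - 1)\<close> form a basis of the stalk of the quotient
  of the tangent sheaf by \<open>D\<close>. Finite bases suffice, as this stalk is finitely generated.\<close>

definition normal_stalk_free :: "('i::finite proj set \<Rightarrow> 'i vfield set) \<Rightarrow> 'i proj \<Rightarrow> bool"
  where "normal_stalk_free D p \<longleftrightarrow> (\<exists>k s. (\<forall>i<k. s i \<in> stalk \<T> p) \<and>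
    (\<forall>v\<in>stalk \<T> p. \<exists>a. (\<forall>i<k. a i \<in> stalk \<O> p) \<and>
      (\<lambda>x g. v x g - comb k a s x g) \<in> stalk D p) \<and>
    (\<forall>a. (\<forall>i<k. a i \<in> stalk \<O> p) \<and> comb k a s \<in> stalk D p \<longrightarrow>
      (\<forall>i<k. \<forall>\<^sub>F x in nhds p. a i x = 0)))"

definition Sing :: "('i::finite proj set \<Rightarrow> 'i vfield set) \<Rightarrow> 'i proj set"
  where "Sing D = {p. \<not> normal_stalk_free D p}"

definition reduced_distribution :: "('i::finite proj set \<Rightarrow> 'i vfield set) \<Rightarrow> bool"
  where "reduced_distribution D \<longleftrightarrow> (\<forall>U. open U \<longrightarrow> (\<forall>\<sigma>\<in>\<T> U.
    (\<forall>p\<in>U - Sing D. \<sigma> \<in> stalk D p) \<longrightarrow> (\<forall>p\<in>U. \<sigma> \<in> stalk D p)))"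

definition flag :: "('i::finite proj set \<Rightarrow> 'i vfield set) list \<Rightarrow> bool"
  where "flag Ds \<longleftrightarrow> (\<exists>r.
    (\<forall>i<length Ds. distribution (Ds ! i) (r i) \<and> 1 \<le> r i \<and> r i < CARD('i) - 1) \<and>
    (\<forall>i. Suc i < length Ds \<longrightarrow> r i < r (Suc i) \<and>
      (\<forall>U. open U \<longrightarrow> (Ds ! i) U \<subseteq> (Ds ! Suc i) U)))"


section \<open>Twisted forms and the degree\<close>

text \<open>
  Sections of \<open>O(k)\<close> over \<open>U\<close> are the holomorphic functions on \<open>punctured_cone U\<close> that are
  homogeneous of degree \<open>k\<close>. Hence a \<open>q\<close>-form with values in \<open>O(k)\<close> assigns to \<open>z\<close> in
  \<open>punctured_cone U\<close> an alternating multilinear form on the tangent space at \<open>abs_proj z\<close> (its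
  arguments are the lists of length \<open>q\<close>), homogeneous of degree \<open>k\<close> in \<open>z\<close>.
\<close>

type_synonym 'i form = "complex ^ 'i \<Rightarrow> 'i tangent list \<Rightarrow> complex"

definition tangent_lists :: "nat \<Rightarrow> 'i::finite proj \<Rightarrow> 'i tangent list set"
  where "tangent_lists q p = {vs. length vs = q \<and> set vs \<subseteq> tangent_space p}"

definition twisted_forms :: "nat \<Rightarrow> int \<Rightarrow> 'i::finite proj set \<Rightarrow> 'i form set"
  where "twisted_forms q k U = {\<omega>.
    (\<forall>z\<in>punctured_cone U. \<forall>vs\<in>tangent_lists q (abs_proj z).
      (\<forall>i<q. \<forall>u\<in>tangent_space (abs_proj z). \<forall>w\<in>tangent_space (abs_proj z). \<forall>a b.
        \<omega> z (vs[i := (\<lambda>g. a * u g + b * w g)]) = a * \<omega> z (vs[i := u]) + b * \<omega> z (vs[i := w])) \<and>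
      (\<forall>i j. i < j \<longrightarrow> j < q \<longrightarrow> vs ! i = vs ! j \<longrightarrow> \<omega> z vs = 0) \<and>
      (\<forall>c. c \<noteq> 0 \<longrightarrow> \<omega> (c *s z) vs = c powi k * \<omega> z vs)) \<and>
    (\<forall>V Xs. open V \<longrightarrow> V \<subseteq> U \<longrightarrow> length Xs = q \<longrightarrow> set Xs \<subseteq> \<T> V \<longrightarrow>
      holo_on (punctured_cone V) (\<lambda>z. \<omega> z (map (\<lambda>X. X (abs_proj z)) Xs)))}"

definition vanishes_at :: "nat \<Rightarrow> 'i::finite form \<Rightarrow> 'i proj \<Rightarrow> bool"
  where "vanishes_at q \<omega> p \<longleftrightarrow> (\<forall>z\<in>punctured_cone {p}. \<forall>vs\<in>tangent_lists q p. \<omega> z vs = 0)"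

text \<open>Near each point outside its zero set, \<open>\<omega>\<close> is a wedge product of \<open>q\<close> one-forms, the first of
  which carries the twist.\<close>

definition locally_decomposable :: "nat \<Rightarrow> int \<Rightarrow> 'i::finite form \<Rightarrow> bool"
  where "locally_decomposable q k \<omega> \<longleftrightarrow> (\<forall>p. \<not> vanishes_at q \<omega> p \<longrightarrow>
    (\<exists>U \<alpha>. open U \<and> p \<in> U \<and>
      (\<forall>j<q. \<alpha> j \<in> twisted_forms 1 (if j = 0 then k else 0) U) \<and>
      (\<forall>z\<in>punctured_cone U. \<forall>vs\<in>tangent_lists q (abs_proj z).
        \<omega> z vs = (\<Sum>\<pi> | \<pi> permutes {..<q}.
          of_int (sign \<pi>) * (\<Prod>j<q. \<alpha> j z [vs ! \<pi> j])))))"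

definition annihilator :: "nat \<Rightarrow> 'i::finite form \<Rightarrow> 'i proj set \<Rightarrow> 'i vfield set"
  where "annihilator q \<omega> U = {v \<in> \<T> U.
    \<forall>z\<in>punctured_cone U. \<forall>us\<in>tangent_lists (q - 1) (abs_proj z). \<omega> z (v (abs_proj z) # us) = 0}"

text \<open>
  The degree \<open>d\<close> of a reduced distribution \<open>D\<close> of codimension \<open>q\<close>: it is given by a global
  \<open>q\<close>-form with values in \<open>O(d + q + 1)\<close> whose annihilator is \<open>D\<close>. The last condition expresses
  that this line bundle is the determinant of the normal sheaf: outside \<open>Sing D\<close>, which has
  codimension at least two, \<open>\<omega>\<close> induces an isomorphism onto it from the \<open>q\<close>-th exterior power of
  the normal sheaf, which is locally free of rank \<open>q\<close> there. Without this condition \<open>\<omega>\<close> could be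
  multiplied by a homogeneous polynomial, which changes \<open>d\<close> but not the annihilator.
\<close>

definition has_degree :: "('i::finite proj set \<Rightarrow> 'i vfield set) \<Rightarrow> int \<Rightarrow> bool"
  where "has_degree D d \<longleftrightarrow> (\<exists>r q \<omega>. has_rank D r \<and> 1 \<le> q \<and> r + q = CARD('i) - 1 \<and>
    \<omega> \<in> twisted_forms q (d + int q + 1) UNIV \<and>
    locally_decomposable q (d + int q + 1) \<omega> \<and>
    (\<forall>U. open U \<longrightarrow> D U = annihilator q \<omega> U) \<and>
    (\<forall>p. p \<notin> Sing D \<longrightarrow> \<not> vanishes_at q \<omega> p))"

end

theory Submission
  imports Defs "HOL-Complex_Analysis.Cauchy_Integral_Formula"
begin

text \<open>
  On the cone, \<open>\<G>\<close> is given by forms \<open>A\<^sub>0, \<dots>, A\<^sub>n\<close> of degree \<open>deg \<G> + 1\<close> with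
  \<open>\<Sum> z\<^sub>i A\<^sub>i = 0\<close>, and \<open>\<F>\<close> by a bivector \<open>P\<close> with entries of degree \<open>deg \<F> + 1\<close> that is
  divisible by the radial field, \<open>z \<and> P = 0\<close>; since \<open>\<F>\<close> is contained in \<open>\<G>\<close>, its contraction
  with \<open>A\<close> vanishes. The zeros of \<open>A\<close> being isolated, all but one of the \<open>A\<^sub>i\<close>, in general
  coordinates, are \<open>n\<close> forms without a common zero on a hyperplane, hence a regular sequence, so
  that all relations between them are combinations of the trivial ones. If \<open>deg \<F> \<le> deg \<G>\<close>, then
  the degrees leave only constant coefficients: the entries of \<open>P\<close> are constant combinations of the
  \<open>A\<^sub>i\<close>. Then \<open>z \<and> P = 0\<close> yields linear relations between the \<open>A\<^sub>i\<close>, and these are multiples of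
  the radial one, which forces \<open>P = 0\<close>.
\<close>

section \<open>Homogeneous polynomials\<close>

text \<open>The obstacle is the Euler relation: since the sum of the z_i A_i is 0, the n + 1 forms
  A_i are no regular sequence, and the radial field is a relation between them that is not a
  combination of trivial ones. It is excluded by admitting only relations V with l . V = 0 for a
  fixed general vector l. Such a V is a relation between n combinations of the A_i, those that
  vanish where A is proportional to l. On a hyperplane that misses the zeros of A they have no
  common zero unless l is a value of A there, and these values have measure zero; this is what
  "general" means below. The contraction of the skew matrix P with l satisfies the constraint by
  itself. A linear relation Y is made to satisfy it by passing to (l . z) Y - (l . Y) z, of degree
  2; since deg \<G> \<ge> 2, this is still below the degree of the A_i. The coefficients that
  express a contraction of P in the A_i have degree deg \<F> - deg \<G>, which is where the negated
  conclusion enters. Two analytic facts lead to polynomials: homogeneous holomorphic functions on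
  the punctured cone are polynomial, and derivations of the local ring come from vectors on the
  cone. In the end P = 0 would make \<F> the whole tangent sheaf, which does not have rank
  one.\<close>

inductive hpoly :: "'i set \<Rightarrow> int \<Rightarrow> (complex ^ 'i::finite \<Rightarrow> complex) \<Rightarrow> bool" for J
  where
    hpoly_zero: "hpoly J d (\<lambda>_. 0)"
  | hpoly_const: "hpoly J 0 (\<lambda>_. c)"
  | hpoly_add: "hpoly J d f \<Longrightarrow> hpoly J d g \<Longrightarrow> hpoly J d (\<lambda>z. f z + g z)"
  | hpoly_coord: "i \<in> J \<Longrightarrow> hpoly J d f \<Longrightarrow> hpoly J (d + 1) (\<lambda>z. z $ i * f z)"

lemma hpoly_smult: "hpoly J d f \<Longrightarrow> hpoly J d (\<lambda>z. c * f z)"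
proof (induction rule: hpoly.induct)
  case (hpoly_coord i d f)
  then show ?case using hpoly.hpoly_coord[of i J d "\<lambda>z. c * f z"] by (simp add: mult.left_commute)
qed (auto simp: distrib_left intro: hpoly.intros)

lemma hpoly_uminus: "hpoly J d f \<Longrightarrow> hpoly J d (\<lambda>z. - f z)"
  using hpoly_smult[of J d f "-1"] by simp

lemma hpoly_diff: "hpoly J d f \<Longrightarrow> hpoly J d g \<Longrightarrow> hpoly J d (\<lambda>z. f z - g z)"
  using hpoly_add[of J d f "\<lambda>z. - g z"] hpoly_uminus[of J d g] by simp

lemma hpoly_sum: "(\<And>x. x \<in> X \<Longrightarrow> hpoly J d (f x)) \<Longrightarrow> hpoly J d (\<lambda>z. \<Sum>x\<in>X. f x z)"
proof (induction X rule: infinite_finite_induct)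
  case (insert x F)
  then show ?case using hpoly_add[of J d "f x" "\<lambda>z. \<Sum>x\<in>F. f x z"] by simp
qed (auto intro: hpoly.intros)

lemma hpoly_mult: "hpoly J d f \<Longrightarrow> hpoly J e g \<Longrightarrow> hpoly J (d + e) (\<lambda>z. f z * g z)"
proof (induction rule: hpoly.induct)
  case (hpoly_zero d)
  then show ?case using hpoly.hpoly_zero by simp
next
  case (hpoly_const c)
  then show ?case using hpoly_smult by simp
next
  case (hpoly_add d f h)
  then show ?case using hpoly.hpoly_add[of J "d + e" "\<lambda>z. f z * g z" "\<lambda>z. h z * g z"]
    by (simp add: distrib_right)
next
  case (hpoly_coord i d f)
  then show ?case using hpoly.hpoly_coord[of i J "d + e" "\<lambda>z. f z * g z"]
    by (simp add: mult.assoc algebra_simps)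
qed

lemma hpoly_mult': "hpoly J d f \<Longrightarrow> hpoly J e g \<Longrightarrow> k = d + e \<Longrightarrow> hpoly J k (\<lambda>z. f z * g z)"
  using hpoly_mult by blast

lemma hpoly_coord1: "i \<in> J \<Longrightarrow> hpoly J 1 (\<lambda>z. z $ i)"
  using hpoly_coord[OF _ hpoly_const, of i J 1] by simp

lemma hpoly_coord_power: "i \<in> J \<Longrightarrow> hpoly J (int r) (\<lambda>z. (z $ i) ^ r)"
proof (induction r)
  case (Suc r)
  then show ?case using hpoly_coord[of i J "int r" "\<lambda>z. (z $ i) ^ r"] by (simp add: add.commute)
qed (simp add: hpoly_const)

lemma hpoly_mono: "hpoly J d f \<Longrightarrow> J \<subseteq> K \<Longrightarrow> hpoly K d f"
  by (induction rule: hpoly.induct) (auto intro: hpoly.intros)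

text \<open>The degree is an integer so that cofactors of degree \<open>d - a\<close> can be written
  down without a case distinction: the zero function has every degree, and it is the only one of
  negative degree.\<close>

lemma hpoly_nonpos: "hpoly J d f \<Longrightarrow> (d < 0 \<longrightarrow> (\<forall>z. f z = 0)) \<and> (d = 0 \<longrightarrow> (\<exists>c. \<forall>z. f z = c))"
proof (induction rule: hpoly.induct)
  case (hpoly_add d f g)
  then show ?case by (cases "d = 0") auto
qed auto

lemma hpoly_neg: "hpoly J d f \<Longrightarrow> d < 0 \<Longrightarrow> f z = 0"
  using hpoly_nonpos by blast

lemma hpoly_0D: "hpoly J 0 f \<Longrightarrow> \<exists>c. \<forall>z. f z = c"
  using hpoly_nonpos by blast

lemma hpoly_cong_on: "hpoly J d f \<Longrightarrow> (\<And>i. i \<in> J \<Longrightarrow> z $ i = w $ i) \<Longrightarrow> f z = f w"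
  by (induction rule: hpoly.induct) auto

lemma hpoly_scale: "hpoly J d f \<Longrightarrow> d \<ge> 0 \<Longrightarrow> f (c *s z) = c ^ nat d * f z"
proof (induction rule: hpoly.induct)
  case (hpoly_coord i d f)
  show ?case
  proof (cases "d < 0")
    case True
    then show ?thesis using hpoly_neg[OF hpoly_coord(2)] by simp
  next
    case False
    then have "nat (d + 1) = Suc (nat d)" by simp
    then show ?thesis using hpoly_coord False by simp
  qed
qed (auto simp: distrib_left)

lemma hpoly_at_0: "hpoly J d f \<Longrightarrow> d > 0 \<Longrightarrow> f 0 = 0"
  using hpoly_scale[of J d f 0 0] by (auto simp: power_0_left)

lemma hpoly_continuous: "hpoly J d f \<Longrightarrow> continuous_on UNIV f"
  by (induction rule: hpoly.induct) (auto intro!: continuous_intros)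

lemma hpoly_differentiable: "hpoly J d f \<Longrightarrow> f differentiable (at z)"
proof (induction rule: hpoly.induct)
  case (hpoly_coord i d f)
  have "(\<lambda>z. z $ i) differentiable (at z)"
    by (intro bounded_linear_imp_differentiable bounded_linear_vec_nth)
  with hpoly_coord show ?case by (intro differentiable_mult) auto
qed auto

lemma hpoly_linear_image:
  assumes T: "\<And>i. hpoly UNIV 1 (\<lambda>z. T z $ i)"
  shows "hpoly J d f \<Longrightarrow> hpoly UNIV d (\<lambda>z. f (T z))"
proof (induction rule: hpoly.induct)
  case (hpoly_coord i d f)
  then show ?case using hpoly_mult[OF T[of i], of d "\<lambda>z. f (T z)"] by (simp add: add.commute)
qed (auto intro: hpoly.intros)

text \<open>A coordinate may be cancelled. Polynomials are functions here, so \<open>f\<close> is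
  only known to vanish off the hyperplane; continuity along the line through \<open>z\<close> in
  direction \<open>i\<close>, which meets the hyperplane in a single point, gives the rest.\<close>

lemma hpoly_eq_0_of_coord:
  assumes "hpoly J d f" "\<And>z. z $ i * f z = 0"
  shows "f z = 0"
proof -
  have "continuous_on UNIV (\<lambda>t::complex. \<chi> l. z $ l + t * axis i 1 $ l)"
    by (intro continuous_intros continuous_on_vec_lambda)
  moreover have "(\<lambda>t::complex. \<chi> l. z $ l + t * axis i 1 $ l) = (\<lambda>t. z + t *s axis i 1)"
    by (simp add: fun_eq_iff vec_eq_iff)
  ultimately have "continuous_on UNIV (\<lambda>t::complex. z + t *s axis i 1)" by (simp only:)
  then have "continuous_on UNIV (\<lambda>t::complex. f (z + t *s axis i 1))"
    using continuous_on_compose2[OF hpoly_continuous[OF assms(1)]] by blast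
  then have "((\<lambda>t. f (z + t *s axis i 1)) \<longlongrightarrow> f (z + 0 *s axis i 1)) (at (0::complex))"
    by (simp only: continuous_on_eq_continuous_at[OF open_UNIV] isCont_def) blast
  moreover have "\<forall>\<^sub>F t in at (0::complex). f (z + t *s axis i 1) = 0"
  proof -
    have "\<forall>\<^sub>F t in at (0::complex). t \<noteq> - z $ i"
    proof (cases "z $ i = 0")
      case True
      then show ?thesis by (simp add: eventually_at_filter)
    next
      case False
      have "\<forall>\<^sub>F t in nhds (0::complex). t \<noteq> - z $ i"
        by (rule t1_space_nhds) (use False in auto)
      then show ?thesis by (simp add: eventually_at_filter eventually_mono)
    qed
    then show ?thesis
    proof eventually_elim
      case (elim t)
      then have "(z + t *s axis i 1) $ i \<noteq> 0" by (auto simp: axis_def add_eq_0_iff)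
      then show ?case using assms(2)[of "z + t *s axis i 1"] by simp
    qed
  qed
  ultimately have "((\<lambda>t::complex. 0::complex) \<longlongrightarrow> f (z + 0 *s axis i 1)) (at 0)"
    by (rule Lim_transform_eventually)
  then have "f (z + 0 *s axis i 1) = 0"
    using tendsto_unique[of "at (0::complex)"] by (metis tendsto_const trivial_limit_at)
  then show ?thesis by simp
qed

text \<open>Division by the variable \<open>j\<close>: \<open>f0\<close> is the restriction of
  \<open>f\<close> to the hyperplane where it vanishes, and \<open>f1\<close> is the
  quotient.\<close>

lemma hpoly_split:
  assumes "hpoly (insert j J) d f"
  shows "\<exists>f0 f1. hpoly J d f0 \<and> hpoly (insert j J) (d - 1) f1 \<and> (\<forall>z. f z = f0 z + z $ j * f1 z)"
  using assms
proof (induction rule: hpoly.induct)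
  case (hpoly_zero d)
  show ?case
    by (rule exI[of _ "\<lambda>_. 0"], rule exI[of _ "\<lambda>_. 0"]) (auto intro: hpoly.intros)
next
  case (hpoly_const c)
  show ?case
    by (rule exI[of _ "\<lambda>_. c"], rule exI[of _ "\<lambda>_. 0"]) (auto intro: hpoly.intros)
next
  case (hpoly_add d f g)
  then obtain f0 f1 g0 g1 where
    "hpoly J d f0" "hpoly (insert j J) (d - 1) f1" "\<forall>z. f z = f0 z + z $ j * f1 z"
    "hpoly J d g0" "hpoly (insert j J) (d - 1) g1" "\<forall>z. g z = g0 z + z $ j * g1 z" by blast
  then show ?case
    by (intro exI[of _ "\<lambda>z. f0 z + g0 z"] exI[of _ "\<lambda>z. f1 z + g1 z"])
      (auto intro: hpoly.intros simp: algebra_simps)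
next
  case (hpoly_coord i d f)
  then obtain f0 f1 where f: "hpoly J d f0" "hpoly (insert j J) (d - 1) f1"
    "\<forall>z. f z = f0 z + z $ j * f1 z" by blast
  show ?case
  proof (cases "i = j")
    case True
    have "hpoly (insert j J) (d + 1 - 1) f" using hpoly_coord by simp
    with True show ?thesis
      by (intro exI[of _ "\<lambda>_. 0"] exI[of _ f]) (simp add: hpoly.intros)
  next
    case False
    then have "i \<in> J" using hpoly_coord by auto
    moreover have "hpoly (insert j J) d (\<lambda>z. z $ i * f1 z)"
      using hpoly.hpoly_coord[OF hpoly_coord(1) f(2)] by simp
    ultimately have "hpoly J (d + 1) (\<lambda>z. z $ i * f0 z) \<and>
      hpoly (insert j J) (d + 1 - 1) (\<lambda>z. z $ i * f1 z) \<and>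
      (\<forall>z. z $ i * f z = z $ i * f0 z + z $ j * (z $ i * f1 z))"
      using f hpoly.hpoly_coord[of i J d f0] by (simp add: distrib_left mult.left_commute)
    then show ?thesis by blast
  qed
qed

text \<open>Forms of positive degree lie in the ideal generated by the variables. The cofactors are
  read off from the construction of \<open>f\<close> and are not unique.\<close>

lemma hpoly_Euler_decomp:
  assumes "hpoly J d f" "d > 0"
  shows "\<exists>g. (\<forall>i\<in>J. hpoly J (d - 1) (g i)) \<and> (\<forall>z. f z = (\<Sum>i\<in>J. z $ i * g i z))"
  using assms
proof (induction rule: hpoly.induct)
  case (hpoly_zero d)
  show ?case by (rule exI[of _ "\<lambda>_ _. 0"]) (auto intro: hpoly.intros)
next
  case (hpoly_add d f f')
  then obtain g g' where "\<forall>i\<in>J. hpoly J (d - 1) (g i)" "\<forall>z. f z = (\<Sum>i\<in>J. z $ i * g i z)"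
    "\<forall>i\<in>J. hpoly J (d - 1) (g' i)" "\<forall>z. f' z = (\<Sum>i\<in>J. z $ i * g' i z)" by blast
  then show ?case
    by (intro exI[of _ "\<lambda>i z. g i z + g' i z"])
      (auto intro: hpoly.intros simp: algebra_simps sum.distrib)
next
  case (hpoly_coord i d f)
  have "z $ i * f z = (\<Sum>l\<in>J. z $ l * (if l = i then f else (\<lambda>_. 0)) z)" for z
  proof -
    have "(\<Sum>l\<in>J. z $ l * (if l = i then f else (\<lambda>_. 0)) z) = (\<Sum>l\<in>J. if l = i then z $ i * f z else 0)"
      by (intro sum.cong) auto
    then show ?thesis using hpoly_coord by simp
  qed
  then show ?case
    by (intro exI[of _ "\<lambda>l. if l = i then f else (\<lambda>_. 0)"])
      (use hpoly_coord in \<open>auto intro: hpoly.intros\<close>)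
qed auto

text \<open>The forms of a given degree are a finite dimensional space; each variable times each
  spanning function of the previous degree spans the next degree.\<close>

lemma hpoly_finite_span:
  assumes "d \<ge> 0"
  shows "\<exists>B. finite B \<and> (\<forall>f. hpoly J d f \<longrightarrow> (\<exists>c. \<forall>z. f z = (\<Sum>b\<in>B. c b * b z)))"
  using assms
proof (induction d rule: int_ge_induct)
  case base
  show ?case
  proof (intro exI[of _ "{\<lambda>_. 1}"] conjI allI impI)
    fix f :: "complex ^ 'a \<Rightarrow> complex"
    assume "hpoly J 0 f"
    then obtain c where "\<forall>z. f z = c" using hpoly_0D by blast
    then show "\<exists>c. \<forall>z. f z = (\<Sum>b\<in>{\<lambda>_. 1}. c b * b z)" by (intro exI[of _ "\<lambda>_. c"]) auto
  qed auto
next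
  case (step d)
  then obtain B where B: "finite B" "\<And>f. hpoly J d f \<Longrightarrow> \<exists>c. \<forall>z. f z = (\<Sum>b\<in>B. c b * b z)" by blast
  define B' where "B' = (\<lambda>(i, b) z. z $ i * b z) ` (J \<times> B)"
  show ?case
  proof (intro exI[of _ B'] conjI allI impI)
    show "finite B'" unfolding B'_def using B(1) by simp
    fix f :: "complex ^ 'a \<Rightarrow> complex"
    assume "hpoly J (d + 1) f"
    then obtain g where g: "\<forall>i\<in>J. hpoly J d (g i)" "\<forall>z. f z = (\<Sum>i\<in>J. z $ i * g i z)"
      using hpoly_Euler_decomp[of J "d + 1" f] step by auto
    have "\<forall>i\<in>J. \<exists>c. \<forall>z. g i z = (\<Sum>b\<in>B. c b * b z)" using g(1) B(2) by blast
    then obtain c where c: "\<And>i z. i \<in> J \<Longrightarrow> g i z = (\<Sum>b\<in>B. c i b * b z)" by metis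
    \<comment> \<open>Different pairs \<open>(i, b)\<close> may have the same product, so the
      coefficient of a product collects all pairs that yield it.\<close>
    define c' where "c' = (\<lambda>h. \<Sum>p\<in>{p \<in> J \<times> B. (\<lambda>(i, b) z. z $ i * b z) p = h}. case p of (i, b) \<Rightarrow> c i b)"
    have "f z = (\<Sum>h\<in>B'. c' h * h z)" for z
    proof -
      have "f z = (\<Sum>p\<in>J \<times> B. case p of (i, b) \<Rightarrow> c i b * (z $ i * b z))"
        using g(2) c B(1) by (simp add: sum.cartesian_product[symmetric] sum_distrib_left mult_ac)
      also have "\<dots> = (\<Sum>h\<in>B'. \<Sum>p\<in>{p \<in> J \<times> B. (\<lambda>(i, b) z. z $ i * b z) p = h}.
          case p of (i, b) \<Rightarrow> c i b * (z $ i * b z))"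
        unfolding B'_def by (rule sum.image_gen) (use B in auto)
      also have "\<dots> = (\<Sum>h\<in>B'. c' h * h z)"
        unfolding c'_def sum_distrib_right by (intro sum.cong refl) auto
      finally show ?thesis .
    qed
    then show "\<exists>c. \<forall>z. f z = (\<Sum>b\<in>B'. c b * b z)" by blast
  qed
qed

text \<open>Gaussian elimination: the equation \<open>b\<close> is solved for a pivot unknown
  \<open>t\<close> and substituted into the others, which leaves one equation and one unknown
  less.\<close>

lemma linear_system_nontrivial:
  fixes c :: "'s \<Rightarrow> 'b \<Rightarrow> complex"
  assumes "finite B" "finite T" "card B < card T"
  shows "\<exists>x. (\<exists>s\<in>T. x s \<noteq> 0) \<and> (\<forall>b\<in>B. (\<Sum>s\<in>T. x s * c s b) = 0)"
  using assms
proof (induction B arbitrary: T c rule: finite_induct)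
  case empty
  then obtain s where "s \<in> T" by fastforce
  then show ?case by (intro exI[of _ "\<lambda>_. 1"]) auto
next
  case (insert b B)
  show ?case
  proof (cases "\<forall>s\<in>T. c s b = 0")
    case True
    obtain x where x: "\<exists>s\<in>T. x s \<noteq> 0" "\<forall>b\<in>B. (\<Sum>s\<in>T. x s * c s b) = 0"
      using insert.IH[of T c] insert.hyps insert.prems by fastforce
    then show ?thesis using True x by (intro exI[of _ x]) auto
  next
    case False
    then obtain t where t: "t \<in> T" "c t b \<noteq> 0" by blast
    obtain x where x: "\<exists>s\<in>T - {t}. x s \<noteq> 0"
      "\<forall>b'\<in>B. (\<Sum>s\<in>T - {t}. x s * (c s b' - c s b / c t b * c t b')) = 0"
      using insert.IH[of "T - {t}" "\<lambda>s b'. c s b' - c s b / c t b * c t b'"]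
        insert.hyps insert.prems t by fastforce
    \<comment> \<open>The pivot unknown gets the value \<open>- y\<close>, which equation
      \<open>b\<close> dictates.\<close>
    define y where "y = (\<Sum>s\<in>T - {t}. x s * c s b) / c t b"
    define x' where "x' = x(t := - y)"
    have eq: "(\<Sum>s\<in>T. x' s * c s b') = (\<Sum>s\<in>T - {t}. x s * c s b') - y * c t b'" for b'
      using insert.prems(1) t(1) by (subst sum.remove[of _ t]) (auto simp: x'_def)
    have "(\<Sum>s\<in>T - {t}. x s * c s b') = y * c t b'" if "b' \<in> B" for b'
    proof -
      have "0 = (\<Sum>s\<in>T - {t}. x s * c s b' - (x s * c s b) * (c t b' / c t b))"
        using x(2) that by (simp add: algebra_simps)
      also have "\<dots> = (\<Sum>s\<in>T - {t}. x s * c s b') - (\<Sum>s\<in>T - {t}. x s * c s b) * (c t b' / c t b)"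
        by (simp only: sum_subtractf sum_distrib_right)
      finally show ?thesis by (simp add: y_def)
    qed
    moreover have "(\<Sum>s\<in>T - {t}. x s * c s b) = y * c t b" using t by (simp add: y_def)
    moreover have "\<exists>s\<in>T. x' s \<noteq> 0" using x(1) by (auto simp: x'_def)
    ultimately show ?thesis using eq by (intro exI[of _ x']) auto
  qed
qed

section \<open>Relations between homogeneous polynomials\<close>

text \<open>The degree \<open>d\<close> part of the homogeneous ideal generated by the
  \<open>B i\<close>, all of degree \<open>a\<close>, in the polynomial ring in the variables
  \<open>J\<close>.\<close>

definition in_ideal ::
  "'i set \<Rightarrow> 'i set \<Rightarrow> ('i \<Rightarrow> complex ^ 'i::finite \<Rightarrow> complex) \<Rightarrow> int \<Rightarrow> int \<Rightarrow> (complex ^ 'i \<Rightarrow> complex) \<Rightarrow> bool"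
  where "in_ideal J I B a d f \<longleftrightarrow>
    (\<exists>Q. (\<forall>i\<in>I. hpoly J (d - a) (Q i)) \<and> (\<forall>z. f z = (\<Sum>i\<in>I. Q i z * B i z)))"

text \<open>The ideal is primary to the ideal of the origin: it contains all forms of large
  degree.\<close>

definition primary ::
  "'i set \<Rightarrow> 'i set \<Rightarrow> ('i \<Rightarrow> complex ^ 'i::finite \<Rightarrow> complex) \<Rightarrow> int \<Rightarrow> bool"
  where "primary J I B a \<longleftrightarrow> (\<exists>M\<ge>0. \<forall>d\<ge>M. \<forall>f. hpoly J d f \<longrightarrow> in_ideal J I B a d f)"

definition skew_on :: "'i set \<Rightarrow> ('i \<Rightarrow> 'i \<Rightarrow> 'v \<Rightarrow> complex) \<Rightarrow> bool"
  where "skew_on I C \<longleftrightarrow> (\<forall>i\<in>I. \<forall>l\<in>I. \<forall>z. C i l z = - C l i z)"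

text \<open>The first Koszul homology vanishes: every relation is a combination of the trivial
  relations between \<open>B i\<close> and \<open>B l\<close>. The skew matrix \<open>C\<close>
  stands for an element of the second exterior power.\<close>

definition koszul_acyclic ::
  "'i set \<Rightarrow> 'i set \<Rightarrow> ('i \<Rightarrow> complex ^ 'i::finite \<Rightarrow> complex) \<Rightarrow> int \<Rightarrow> bool"
  where "koszul_acyclic J I B a \<longleftrightarrow> (\<forall>e Q. (\<forall>i\<in>I. hpoly J e (Q i)) \<longrightarrow>
    (\<forall>z. (\<Sum>i\<in>I. Q i z * B i z) = 0) \<longrightarrow>
    (\<exists>C. skew_on I C \<and> (\<forall>i\<in>I. \<forall>l\<in>I. hpoly J (e - a) (C i l)) \<and>
      (\<forall>i\<in>I. \<forall>z. Q i z = (\<Sum>l\<in>I. C i l z * B l z))))"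

text \<open>Forms in the variables \<open>J\<close> do not see the other coordinates, which are
  therefore set to zero.\<close>

definition zero_free :: "'i set \<Rightarrow> 'i set \<Rightarrow> ('i \<Rightarrow> complex ^ 'i::finite \<Rightarrow> complex) \<Rightarrow> bool"
  where "zero_free J I B \<longleftrightarrow>
    (\<forall>z. (\<forall>i. i \<notin> J \<longrightarrow> z $ i = 0) \<longrightarrow> (\<forall>i\<in>I. B i z = 0) \<longrightarrow> z = 0)"

lemma koszul_acyclicD:
  assumes "koszul_acyclic J I B a" "\<And>i. i \<in> I \<Longrightarrow> hpoly J e (Q i)"
    "\<And>z. (\<Sum>i\<in>I. Q i z * B i z) = 0"
  shows "\<exists>C. skew_on I C \<and> (\<forall>i\<in>I. \<forall>l\<in>I. hpoly J (e - a) (C i l)) \<and>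
      (\<forall>i\<in>I. \<forall>z. Q i z = (\<Sum>l\<in>I. C i l z * B l z))"
  using assms unfolding koszul_acyclic_def by simp

section \<open>Calculus of graded ideals and of trivial relations\<close>

lemma in_ideal_add: "in_ideal J I B a d f \<Longrightarrow> in_ideal J I B a d g \<Longrightarrow> in_ideal J I B a d (\<lambda>z. f z + g z)"
proof -
  assume "in_ideal J I B a d f" "in_ideal J I B a d g"
  then obtain P Q where "\<forall>i\<in>I. hpoly J (d - a) (P i)" "\<forall>z. f z = (\<Sum>i\<in>I. P i z * B i z)"
    "\<forall>i\<in>I. hpoly J (d - a) (Q i)" "\<forall>z. g z = (\<Sum>i\<in>I. Q i z * B i z)"
    unfolding in_ideal_def by blast
  then show ?thesis unfolding in_ideal_def
    by (intro exI[of _ "\<lambda>i z. P i z + Q i z"]) (auto simp: hpoly_add distrib_right sum.distrib)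
qed

lemma in_ideal_mult:
  assumes "hpoly J e g" "in_ideal J I B a d f"
  shows "in_ideal J I B a (d + e) (\<lambda>z. g z * f z)"
proof -
  obtain Q where Q: "\<forall>i\<in>I. hpoly J (d - a) (Q i)" "\<forall>z. f z = (\<Sum>i\<in>I. Q i z * B i z)"
    using assms unfolding in_ideal_def by blast
  have "hpoly J (d + e - a) (\<lambda>z. g z * Q i z)" if "i \<in> I" for i
    using that Q(1) assms(1) by (intro hpoly_mult'[of J e _ "d - a"]) auto
  then show ?thesis using Q(2) unfolding in_ideal_def
    by (intro exI[of _ "\<lambda>i z. g z * Q i z"]) (auto simp: sum_distrib_left mult.assoc)
qed

lemma in_ideal_smult: "in_ideal J I B a d f \<Longrightarrow> in_ideal J I B a d (\<lambda>z. c * f z)"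
  using in_ideal_mult[OF hpoly_const] by simp

lemma in_ideal_diff: "in_ideal J I B a d f \<Longrightarrow> in_ideal J I B a d g \<Longrightarrow> in_ideal J I B a d (\<lambda>z. f z - g z)"
  using in_ideal_add[of J I B a d f "\<lambda>z. (-1) * g z"] in_ideal_smult[of J I B a d g "-1"] by simp

lemma in_ideal_zero: "in_ideal J I B a d (\<lambda>_. 0)"
  unfolding in_ideal_def by (rule exI[of _ "\<lambda>_ _. 0"]) (simp add: hpoly_zero)

lemma in_ideal_mono:
  assumes "in_ideal J I B a d f" "I \<subseteq> K" "finite K"
  shows "in_ideal J K B a d f"
proof -
  obtain Q where Q: "\<forall>i\<in>I. hpoly J (d - a) (Q i)" "\<forall>z. f z = (\<Sum>i\<in>I. Q i z * B i z)"
    using assms unfolding in_ideal_def by blast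
  have "(\<Sum>i\<in>I. Q i z * B i z) = (\<Sum>i\<in>K. (if i \<in> I then Q i else (\<lambda>_. 0)) z * B i z)" for z
    using assms by (intro sum.mono_neutral_cong_left) auto
  then show ?thesis using Q unfolding in_ideal_def
    by (intro exI[of _ "\<lambda>i. if i \<in> I then Q i else (\<lambda>_. 0)"]) (auto simp: hpoly_zero)
qed

lemma in_ideal_gen:
  assumes "i \<in> I" "finite I"
  shows "in_ideal J I B a a (B i)"
proof -
  have "(\<Sum>l\<in>I. (if l = i then \<lambda>_. 1 else (\<lambda>_. 0)) z * B l z) = B i z" for z
  proof -
    have "(\<Sum>l\<in>I. (if l = i then \<lambda>_. 1 else (\<lambda>_. 0)) z * B l z) = (\<Sum>l\<in>I. if l = i then B i z else 0)"
      by (intro sum.cong) auto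
    then show ?thesis using assms by simp
  qed
  then show ?thesis unfolding in_ideal_def
    by (intro exI[of _ "\<lambda>l. if l = i then \<lambda>_. 1 else (\<lambda>_. 0)"]) (auto simp: hpoly_zero hpoly_const)
qed

lemma in_ideal_sum:
  "(\<And>x. x \<in> X \<Longrightarrow> in_ideal J I B a d (f x)) \<Longrightarrow> in_ideal J I B a d (\<lambda>z. \<Sum>x\<in>X. f x z)"
proof (induction X rule: infinite_finite_induct)
  case (insert x F)
  then show ?case using in_ideal_add[of J I B a d "f x" "\<lambda>z. \<Sum>x\<in>F. f x z"] by simp
qed (auto intro: in_ideal_zero)

text \<open>A skew matrix is paired with the symmetric products of the \<open>b\<close>, so that
  trivial relations are indeed relations.\<close>

lemma skew_sum_zero:
  assumes "skew_on I C'"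
  shows "(\<Sum>i\<in>I. (\<Sum>l\<in>I. C' i l z * b l) * b i) = 0"
proof -
  define C where "C = (\<lambda>i l. C' i l z)"
  let ?s = "\<Sum>i\<in>I. (\<Sum>l\<in>I. C i l * b l) * b i"
  have "?s = (\<Sum>i\<in>I. \<Sum>l\<in>I. C i l * b l * b i)" by (simp add: sum_distrib_right)
  also have "\<dots> = (\<Sum>l\<in>I. \<Sum>i\<in>I. C i l * b l * b i)" by (rule sum.swap)
  also have "\<dots> = (\<Sum>l\<in>I. \<Sum>i\<in>I. - (C l i * b i * b l))"
  proof (intro sum.cong refl)
    fix l i assume "l \<in> I" "i \<in> I"
    then have eq: "C i l = - C l i" using assms unfolding skew_on_def C_def by blast
    show "C i l * b l * b i = - (C l i * b i * b l)" unfolding eq by simp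
  qed
  also have "\<dots> = - ?s" by (simp add: sum_distrib_right sum_negf)
  finally show ?thesis by (simp add: C_def)
qed

section \<open>Lifting from the coordinate hyperplane where the variable j vanishes\<close>

locale hyperplane_section =
  fixes J I :: "'i::finite set" and j :: 'i and B B0 B1 :: "'i \<Rightarrow> complex ^ 'i \<Rightarrow> complex" and a :: int
  assumes j: "j \<notin> J"
    and B: "\<And>i z. i \<in> I \<Longrightarrow> B i z = B0 i z + z $ j * B1 i z"
    and B0: "\<And>i. i \<in> I \<Longrightarrow> hpoly J a (B0 i)"
    and B1: "\<And>i. i \<in> I \<Longrightarrow> hpoly (insert j J) (a - 1) (B1 i)"
    and a: "a > 0"
begin

abbreviation "J' \<equiv> insert j J"

lemma hpoly_lift: "hpoly J d f \<Longrightarrow> hpoly J' d f"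
  by (rule hpoly_mono) auto

lemma zj: "hpoly J' 1 (\<lambda>z. z $ j)"
  by (rule hpoly_coord1) simp

lemma hpoly_zj: "hpoly J' (d - 1) f \<Longrightarrow> hpoly J' d (\<lambda>z. z $ j * f z)"
  by (rule hpoly_mult'[OF zj]) auto

lemma hpoly_B: "i \<in> I \<Longrightarrow> hpoly J' a (B i)"
proof -
  assume i: "i \<in> I"
  have "B i = (\<lambda>z. B0 i z + z $ j * B1 i z)" using B[OF i] by (simp add: fun_eq_iff)
  then show ?thesis using hpoly_add[OF hpoly_lift[OF B0[OF i]] hpoly_zj[OF B1[OF i]]] by simp
qed

text \<open>On the hyperplane, \<open>Q\<close> restricts to a relation between the
  \<open>B0 i\<close>, hence to a trivial one given by \<open>C\<close>. The trivial relation
  between the \<open>B i\<close> with the same \<open>C\<close> differs from \<open>Q\<close> by a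
  multiple of the variable \<open>j\<close>.\<close>

lemma relation_mod_zj:
  assumes K: "koszul_acyclic J I B0 a"
    and Q: "\<And>i. i \<in> I \<Longrightarrow> hpoly J' e (Q i)"
    and rel: "\<And>z. z $ j = 0 \<Longrightarrow> (\<Sum>i\<in>I. Q i z * B i z) = 0"
  shows "\<exists>C R. skew_on I C \<and> (\<forall>i\<in>I. \<forall>l\<in>I. hpoly J (e - a) (C i l)) \<and>
    (\<forall>i\<in>I. hpoly J' (e - 1) (R i)) \<and>
    (\<forall>i\<in>I. \<forall>z. Q i z = (\<Sum>l\<in>I. C i l z * B l z) + z $ j * R i z)"
proof -
  have "\<forall>i\<in>I. \<exists>f0 f1. hpoly J e f0 \<and> hpoly J' (e - 1) f1 \<and> (\<forall>z. Q i z = f0 z + z $ j * f1 z)"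
    using hpoly_split Q by blast
  then obtain Q0 Q1 where Q0: "\<And>i. i \<in> I \<Longrightarrow> hpoly J e (Q0 i)"
    and Q1: "\<And>i. i \<in> I \<Longrightarrow> hpoly J' (e - 1) (Q1 i)"
    and QQ: "\<And>i z. i \<in> I \<Longrightarrow> Q i z = Q0 i z + z $ j * Q1 i z" by metis
  have "(\<Sum>i\<in>I. Q0 i z * B0 i z) = 0" for z
  proof -
    \<comment> \<open>The projection of \<open>z\<close> to the hyperplane; functions of the
      variables \<open>J\<close> do not notice the change.\<close>
    let ?w = "\<chi> i. if i = j then 0 else z $ i"
    have "Q0 i z * B0 i z = Q i ?w * B i ?w" if "i \<in> I" for i
    proof -
      have "Q0 i z = Q0 i ?w" by (rule hpoly_cong_on[OF Q0[OF that]]) (use j in auto)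
      moreover have "B0 i z = B0 i ?w" by (rule hpoly_cong_on[OF B0[OF that]]) (use j in auto)
      ultimately show ?thesis using that QQ B by simp
    qed
    then have "(\<Sum>i\<in>I. Q0 i z * B0 i z) = (\<Sum>i\<in>I. Q i ?w * B i ?w)" by (intro sum.cong) auto
    then show ?thesis using rel[of ?w] by simp
  qed
  then obtain C where C: "skew_on I C \<and> (\<forall>i\<in>I. \<forall>l\<in>I. hpoly J (e - a) (C i l))"
    "\<forall>i\<in>I. \<forall>z. Q0 i z = (\<Sum>l\<in>I. C i l z * B0 l z)"
    using koszul_acyclicD[OF K, of e Q0] Q0 by blast
  \<comment> \<open>The quotient of \<open>Q\<close> by the variable \<open>j\<close>, corrected by
    the error made in replacing \<open>B0\<close> by \<open>B\<close>.\<close>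
  define R where "R = (\<lambda>i z. Q1 i z - (\<Sum>l\<in>I. C i l z * B1 l z))"
  have "hpoly J' (e - 1) (R i)" if "i \<in> I" for i
    unfolding R_def using that C(1) Q1 B1
    by (intro hpoly_diff hpoly_sum hpoly_mult'[OF hpoly_lift, of "e - a" _ "a - 1"]) auto
  moreover have "Q i z = (\<Sum>l\<in>I. C i l z * B l z) + z $ j * R i z" if "i \<in> I" for i z
  proof -
    have "(\<Sum>l\<in>I. C i l z * B l z) = (\<Sum>l\<in>I. C i l z * B0 l z + z $ j * (C i l z * B1 l z))"
      by (intro sum.cong refl) (simp add: B algebra_simps)
    also have "\<dots> = (\<Sum>l\<in>I. C i l z * B0 l z) + z $ j * (\<Sum>l\<in>I. C i l z * B1 l z)"
      by (simp only: sum.distrib sum_distrib_left)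
    finally have "(\<Sum>l\<in>I. C i l z * B l z) = Q0 i z + z $ j * (\<Sum>l\<in>I. C i l z * B1 l z)"
      using C(2) that by simp
    then show ?thesis using QQ[OF that] by (simp add: R_def algebra_simps)
  qed
  ultimately show ?thesis using C(1) by blast
qed

text \<open>The trivial part of the decomposition contributes nothing to the sum, so that only the
  multiple of the variable \<open>j\<close> remains and this variable can be cancelled.\<close>

lemma relation_cancel_zj:
  assumes C: "skew_on I C \<and> (\<forall>i\<in>I. \<forall>l\<in>I. hpoly J (e - a) (C i l))"
    and Q: "\<forall>i\<in>I. \<forall>z. Q i z = (\<Sum>l\<in>I. C i l z * B l z) + z $ j * R i z"
  shows "(\<Sum>i\<in>I. Q i z * B i z) = z $ j * (\<Sum>i\<in>I. R i z * B i z)"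
proof -
  have "(\<Sum>i\<in>I. Q i z * B i z) = (\<Sum>i\<in>I. (\<Sum>l\<in>I. C i l z * B l z) * B i z + z $ j * (R i z * B i z))"
    using Q by (intro sum.cong refl) (simp add: algebra_simps)
  also have "\<dots> = (\<Sum>i\<in>I. (\<Sum>l\<in>I. C i l z * B l z) * B i z) + z $ j * (\<Sum>i\<in>I. R i z * B i z)"
    by (simp only: sum.distrib sum_distrib_left)
  also have "(\<Sum>i\<in>I. (\<Sum>l\<in>I. C i l z * B l z) * B i z) = 0"
    by (rule skew_sum_zero) (use C in blast)
  finally show ?thesis by simp
qed

text \<open>If the coefficients \<open>Q\<close> express a multiple of the variable
  \<open>j\<close>, they form a relation on the hyperplane. By \<open>relation_mod_zj\<close> they
  may be replaced by a multiple of that variable, which is then cancelled on both sides.\<close>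

lemma zj_nonzerodivisor:
  assumes K: "koszul_acyclic J I B0 a" and h: "hpoly J' d h"
    and ideal: "in_ideal J' I B a (d + 1) (\<lambda>z. z $ j * h z)"
  shows "in_ideal J' I B a d h"
proof -
  obtain Q where Q: "\<forall>i\<in>I. hpoly J' (d + 1 - a) (Q i)"
    "\<And>z. z $ j * h z = (\<Sum>i\<in>I. Q i z * B i z)"
    using ideal unfolding in_ideal_def by blast
  have "(\<Sum>i\<in>I. Q i z * B i z) = 0" if "z $ j = 0" for z using Q(2)[of z] that by simp
  then obtain C R where
    C: "skew_on I C \<and> (\<forall>i\<in>I. \<forall>l\<in>I. hpoly J (d + 1 - a - a) (C i l))"
    and R: "\<forall>i\<in>I. hpoly J' (d + 1 - a - 1) (R i)"
    and QR: "\<forall>i\<in>I. \<forall>z. Q i z = (\<Sum>l\<in>I. C i l z * B l z) + z $ j * R i z"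
    using relation_mod_zj[OF K, of "d + 1 - a" Q] Q(1) by auto
  have hR: "hpoly J' d (\<lambda>z. \<Sum>i\<in>I. R i z * B i z)"
    using R hpoly_B by (intro hpoly_sum hpoly_mult'[of J' "d - a" _ a]) auto
  have "z $ j * (h z - (\<Sum>i\<in>I. R i z * B i z)) = 0" for z
    using relation_cancel_zj[OF C QR, of z] Q(2)[of z] by (simp add: right_diff_distrib)
  then have "h z - (\<Sum>i\<in>I. R i z * B i z) = 0" for z
    by (rule hpoly_eq_0_of_coord[OF hpoly_diff[OF h hR]])
  then show ?thesis using R unfolding in_ideal_def by (intro exI[of _ R]) (auto simp: algebra_simps)
qed

lemma zj_power_nonzerodivisor:
  assumes K: "koszul_acyclic J I B0 a" and h: "hpoly J' d h"
    and ideal: "in_ideal J' I B a (d + int r) (\<lambda>z. (z $ j) ^ r * h z)"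
  shows "in_ideal J' I B a d h"
  using ideal
proof (induction r)
  case (Suc r)
  have "hpoly J' (d + int r) (\<lambda>z. (z $ j) ^ r * h z)"
    by (rule hpoly_mult'[OF hpoly_coord_power h]) auto
  then have "in_ideal J' I B a (d + int r) (\<lambda>z. (z $ j) ^ r * h z)"
    by (rule zj_nonzerodivisor[OF K]) (use Suc.prems in \<open>simp add: algebra_simps\<close>)
  then show ?case by (rule Suc.IH)
qed simp

text \<open>A relation is trivial modulo the variable \<open>j\<close>, and the remainder divided by
  that variable is again a relation, of degree one less. The process ends because there is nothing
  in negative degree.\<close>

lemma koszul_lift:
  assumes K: "koszul_acyclic J I B0 a"
  shows "koszul_acyclic J' I B a"
  unfolding koszul_acyclic_def
proof (intro allI impI)
  fix e Q
  assume "\<forall>i\<in>I. hpoly J' e (Q i)" "\<forall>z. (\<Sum>i\<in>I. Q i z * B i z) = 0"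
  then show "\<exists>C. skew_on I C \<and> (\<forall>i\<in>I. \<forall>l\<in>I. hpoly J' (e - a) (C i l)) \<and>
      (\<forall>i\<in>I. \<forall>z. Q i z = (\<Sum>l\<in>I. C i l z * B l z))"
  \<comment> \<open>The shift by one makes degree 0 positive, so that the step from degree 0 to
    degree -1 decreases the measure.\<close>
  proof (induction "nat (e + 1)" arbitrary: e Q rule: less_induct)
    case less
    show ?case
    proof (cases "e < 0")
      case True
      then have "Q i z = 0" if "i \<in> I" for i z using less.prems(1) that hpoly_neg by blast
      then show ?thesis
        by (intro exI[of _ "\<lambda>_ _ _. 0"]) (auto simp: hpoly_zero skew_on_def)
    next
      case False
      obtain C R where C: "skew_on I C \<and> (\<forall>i\<in>I. \<forall>l\<in>I. hpoly J (e - a) (C i l))"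
        and R: "\<forall>i\<in>I. hpoly J' (e - 1) (R i)"
        and QR: "\<forall>i\<in>I. \<forall>z. Q i z = (\<Sum>l\<in>I. C i l z * B l z) + z $ j * R i z"
        using relation_mod_zj[OF K, of e Q] less.prems by auto
      have hR: "hpoly J' (e - 1 + a) (\<lambda>z. \<Sum>i\<in>I. R i z * B i z)"
        using R hpoly_B by (intro hpoly_sum hpoly_mult'[of J' "e - 1" _ a]) auto
      have "z $ j * (\<Sum>i\<in>I. R i z * B i z) = 0" for z
        using relation_cancel_zj[OF C QR, of z] less.prems(2) by simp
      then have "(\<Sum>i\<in>I. R i z * B i z) = 0" for z
        by (rule hpoly_eq_0_of_coord[OF hR])
      then obtain D where D: "skew_on I D \<and> (\<forall>i\<in>I. \<forall>l\<in>I. hpoly J' (e - 1 - a) (D i l))"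
        "\<forall>i\<in>I. \<forall>z. R i z = (\<Sum>l\<in>I. D i l z * B l z)"
        using less.hyps[of "e - 1" R] R False by auto
      have "hpoly J' (e - a) (\<lambda>z. C i l z + z $ j * D i l z)" if "i \<in> I" "l \<in> I" for i l
      proof (rule hpoly_add)
        show "hpoly J' (e - a) (C i l)" using C that hpoly_lift by blast
        have "hpoly J' (e - a - 1) (D i l)" using D(1) that by (simp add: algebra_simps)
        then show "hpoly J' (e - a) (\<lambda>z. z $ j * D i l z)" by (rule hpoly_zj)
      qed
      moreover have "skew_on I (\<lambda>i l z. C i l z + z $ j * D i l z)"
        unfolding skew_on_def
      proof (intro ballI allI)
        fix i l z assume il: "i \<in> I" "l \<in> I"
        have "C i l z = - C l i z" "D i l z = - D l i z"
          using C D(1) il unfolding skew_on_def by blast+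
        then show "C i l z + z $ j * D i l z = - (C l i z + z $ j * D l i z)" by simp
      qed
      moreover have "Q i z = (\<Sum>l\<in>I. (C i l z + z $ j * D i l z) * B l z)" if "i \<in> I" for i z
      proof -
        have "(\<Sum>l\<in>I. (C i l z + z $ j * D i l z) * B l z) =
          (\<Sum>l\<in>I. C i l z * B l z + z $ j * (D i l z * B l z))"
          by (intro sum.cong refl) (simp add: algebra_simps)
        also have "\<dots> = (\<Sum>l\<in>I. C i l z * B l z) + z $ j * (\<Sum>l\<in>I. D i l z * B l z)"
          by (simp only: sum.distrib sum_distrib_left)
        finally show ?thesis using QR D(2) that by simp
      qed
      ultimately show ?thesis
        by (intro exI[of _ "\<lambda>i l z. C i l z + z $ j * D i l z"]) blast
    qed
  qed
qed

text \<open>In degree at least \<open>M\<close> the restriction of \<open>f\<close> to the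
  hyperplane lies in the restricted ideal. Lifting its cofactors makes \<open>f\<close> congruent to
  a multiple of the variable \<open>j\<close>.\<close>

lemma reduce_mod_ideal_step:
  assumes M: "\<And>d f. d \<ge> M \<Longrightarrow> hpoly J d f \<Longrightarrow> in_ideal J I B0 a d f"
    and f: "hpoly J' d f" "d \<ge> M"
  shows "\<exists>g. hpoly J' (d - 1) g \<and> in_ideal J' I B a d (\<lambda>z. f z - z $ j * g z)"
proof -
  obtain f0 f1 where s: "hpoly J d f0" "hpoly J' (d - 1) f1" "\<And>z. f z = f0 z + z $ j * f1 z"
    using hpoly_split[OF f(1)] by blast
  obtain Q where Q: "\<forall>i\<in>I. hpoly J (d - a) (Q i)" "\<forall>z. f0 z = (\<Sum>i\<in>I. Q i z * B0 i z)"
    using M[OF f(2) s(1)] unfolding in_ideal_def by blast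
  define g where "g = (\<lambda>z. f1 z - (\<Sum>i\<in>I. Q i z * B1 i z))"
  have "hpoly J' (d - 1) g"
    unfolding g_def using s(2) Q(1) B1
    by (intro hpoly_diff hpoly_sum hpoly_mult'[OF hpoly_lift, of "d - a" _ "a - 1"]) auto
  moreover have "f z - z $ j * g z = (\<Sum>i\<in>I. Q i z * B i z)" for z
  proof -
    have "(\<Sum>i\<in>I. Q i z * B i z) = (\<Sum>i\<in>I. Q i z * B0 i z + z $ j * (Q i z * B1 i z))"
      by (intro sum.cong refl) (simp add: B algebra_simps)
    also have "\<dots> = f0 z + z $ j * (\<Sum>i\<in>I. Q i z * B1 i z)"
      using Q(2) by (simp only: sum.distrib sum_distrib_left)
    finally show ?thesis by (simp add: g_def s(3) algebra_simps)
  qed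
  ultimately show ?thesis using Q(1) hpoly_lift unfolding in_ideal_def
    by (intro exI[of _ g] conjI exI[of _ Q]) auto
qed

text \<open>Modulo the ideal, forms of high degree come from those of the fixed degree
  \<open>M\<close> by multiplication with a power of the variable \<open>j\<close>. This finiteness
  is what the Nullstellensatz below starts from.\<close>

lemma reduce_mod_ideal:
  assumes M: "\<And>d f. d \<ge> M \<Longrightarrow> hpoly J d f \<Longrightarrow> in_ideal J I B0 a d f"
    and f: "hpoly J' (M + int r) f"
  shows "\<exists>g. hpoly J' M g \<and> in_ideal J' I B a (M + int r) (\<lambda>z. f z - (z $ j) ^ r * g z)"
  using f
proof (induction r arbitrary: f)
  case 0
  then show ?case by (intro exI[of _ f]) (simp add: in_ideal_zero)
next
  case (Suc r)
  obtain g where g: "hpoly J' (M + int r) g"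
    "in_ideal J' I B a (M + int (Suc r)) (\<lambda>z. f z - z $ j * g z)"
    using reduce_mod_ideal_step[of M "M + int (Suc r)" f] M Suc.prems by (auto simp: algebra_simps)
  obtain h where h: "hpoly J' M h" "in_ideal J' I B a (M + int r) (\<lambda>z. g z - (z $ j) ^ r * h z)"
    using Suc.IH[OF g(1)] by blast
  have "in_ideal J' I B a (M + int r + 1) (\<lambda>z. z $ j * (g z - (z $ j) ^ r * h z))"
    by (rule in_ideal_mult[OF zj h(2)])
  then have "in_ideal J' I B a (M + int (Suc r)) (\<lambda>z. z $ j * (g z - (z $ j) ^ r * h z))"
    by (simp add: algebra_simps)
  from in_ideal_add[OF g(2) this] show ?case
    by (intro exI[of _ h]) (simp add: h(1) algebra_simps)
qed

end

section \<open>A homogeneous Nullstellensatz\<close>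

text \<open>\<open>R d\<close> is the degree \<open>d\<close> part of a homogeneous ideal on whose quotient the coordinate \<open>j\<close> is a
  nonzerodivisor, and which does not contain 1. The quotient of its localization at \<open>j\<close> is finite
  dimensional, so the coordinates, as commuting operators, have a common eigenvector there, whose
  eigenvalues form a zero of the ideal.\<close>

locale saturated_ideal =
  fixes J :: "'i::finite set" and j :: 'i and R :: "int \<Rightarrow> (complex ^ 'i \<Rightarrow> complex) \<Rightarrow> bool" and M :: int
  assumes j: "j \<in> J"
    and R_zero: "\<And>d. R d (\<lambda>_. 0)"
    and R_add: "\<And>d f g. R d f \<Longrightarrow> R d g \<Longrightarrow> R d (\<lambda>z. f z + g z)"
    and R_mult: "\<And>d e f g. hpoly J e g \<Longrightarrow> R d f \<Longrightarrow> R (d + e) (\<lambda>z. g z * f z)"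
    and R_sat: "\<And>d h. hpoly J d h \<Longrightarrow> R (d + 1) (\<lambda>z. z $ j * h z) \<Longrightarrow> R d h"
    and M: "M \<ge> 0"
    and R_fin: "\<And>r f. hpoly J (M + int r) f \<Longrightarrow>
      \<exists>g. hpoly J M g \<and> R (M + int r) (\<lambda>z. f z - (z $ j) ^ r * g z)"
    and R_one: "\<not> R 0 (\<lambda>_. 1)"
begin

lemma R_smult: "R d f \<Longrightarrow> R d (\<lambda>z. c * f z)"
  using R_mult[OF hpoly_const] by simp

lemma R_diff: "R d f \<Longrightarrow> R d g \<Longrightarrow> R d (\<lambda>z. f z - g z)"
  using R_add[of d f "\<lambda>z. (-1) * g z"] R_smult[of d g "-1"] by simp

lemma R_sum: "(\<And>x. x \<in> X \<Longrightarrow> R d (f x)) \<Longrightarrow> R d (\<lambda>z. \<Sum>x\<in>X. f x z)"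
proof (induction X rule: infinite_finite_induct)
  case (insert x F)
  then show ?case using R_add[of d "f x" "\<lambda>z. \<Sum>x\<in>F. f x z"] by simp
qed (auto intro: R_zero)

lemma R_sat_power: "hpoly J d h \<Longrightarrow> R (d + int r) (\<lambda>z. (z $ j) ^ r * h z) \<Longrightarrow> R d h"
proof (induction r)
  case (Suc r)
  have "hpoly J (d + int r) (\<lambda>z. (z $ j) ^ r * h z)"
    by (rule hpoly_mult'[OF hpoly_coord_power[OF j] Suc.prems(1)]) auto
  then have "R (d + int r) (\<lambda>z. (z $ j) ^ r * h z)"
    by (rule R_sat) (use Suc.prems in \<open>simp add: algebra_simps\<close>)
  then show ?case by (rule Suc.IH[OF Suc.prems(1)])
qed simp

lemma hpoly_linear_factor:
  assumes "i \<in> J" shows "hpoly J 1 (\<lambda>z. z $ i - \<mu> * z $ j)"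
  using assms j by (intro hpoly_diff hpoly_smult hpoly_coord1)

text \<open>The polynomial \<open>q\<close> evaluated at the quotient of the coordinates
  \<open>i\<close> and \<open>j\<close>, with denominators cleared by the power \<open>r\<close> of
  the latter. Allowing \<open>r\<close> above the degree of \<open>q\<close> keeps all terms in one
  degree.\<close>

definition homogenization :: "'i \<Rightarrow> complex poly \<Rightarrow> nat \<Rightarrow> complex ^ 'i \<Rightarrow> complex"
  where "homogenization i q r z = (\<Sum>s\<le>r. coeff q s * (z $ i) ^ s * (z $ j) ^ (r - s))"

lemma homogenization_linear_factor:
  assumes "degree q \<le> r"
  shows "homogenization i ([:- \<mu>, 1:] * q) (Suc r) z = (z $ i - \<mu> * z $ j) * homogenization i q r z"
proof -
  let ?x = "z $ i" and ?y = "z $ j"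
  have c: "coeff ([:- \<mu>, 1:] * q) s = (case s of 0 \<Rightarrow> 0 | Suc t \<Rightarrow> coeff q t) - \<mu> * coeff q s" for s
    by (simp add: coeff_pCons split: nat.split)
  have "homogenization i ([:- \<mu>, 1:] * q) (Suc r) z =
    (\<Sum>s\<le>Suc r. (case s of 0 \<Rightarrow> 0 | Suc t \<Rightarrow> coeff q t) * ?x ^ s * ?y ^ (Suc r - s)) -
    \<mu> * (\<Sum>s\<le>Suc r. coeff q s * ?x ^ s * ?y ^ (Suc r - s))"
    unfolding homogenization_def c sum_distrib_left sum_subtractf[symmetric]
    by (intro sum.cong refl) (simp add: algebra_simps)
  also have "(\<Sum>s\<le>Suc r. (case s of 0 \<Rightarrow> 0 | Suc t \<Rightarrow> coeff q t) * ?x ^ s * ?y ^ (Suc r - s)) =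
    ?x * homogenization i q r z"
    unfolding homogenization_def sum.atMost_Suc_shift
    by (simp add: sum_distrib_left mult_ac)
  also have "(\<Sum>s\<le>Suc r. coeff q s * ?x ^ s * ?y ^ (Suc r - s)) = ?y * homogenization i q r z"
  proof -
    have "coeff q (Suc r) = 0" using assms by (intro coeff_eq_0) auto
    then have "(\<Sum>s\<le>Suc r. coeff q s * ?x ^ s * ?y ^ (Suc r - s)) =
        (\<Sum>s\<le>r. coeff q s * ?x ^ s * ?y ^ (Suc r - s))" by simp
    also have "\<dots> = ?y * homogenization i q r z"
      unfolding homogenization_def sum_distrib_left
      by (intro sum.cong refl) (simp add: Suc_diff_le mult_ac)
    finally show ?thesis .
  qed
  finally show ?thesis by (simp add: algebra_simps)
qed

text \<open>An operator annihilated by a polynomial has an eigenvector: linear factors of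
  \<open>q\<close> are applied to \<open>h\<close> one after the other, until one of them kills a
  class that was not yet zero. The form \<open>g\<close> is the product of the factors applied
  before.\<close>

lemma eigenvector_of_annihilating_polynomial:
  assumes i: "i \<in> J"
  shows "q \<noteq> 0 \<Longrightarrow> degree q \<le> r \<Longrightarrow> hpoly J d h \<Longrightarrow> \<not> R d h \<Longrightarrow>
    R (d + int r) (\<lambda>z. homogenization i q r z * h z) \<Longrightarrow>
    \<exists>g e \<mu>. hpoly J e g \<and> \<not> R (d + e) (\<lambda>z. g z * h z) \<and>
      R (d + e + 1) (\<lambda>z. (z $ i - \<mu> * z $ j) * (g z * h z))"
proof (induction "degree q" arbitrary: q r d h)
  case 0
  \<comment> \<open>For constant \<open>q\<close> the hypothesis puts a power of the coordinate
    \<open>j\<close> times \<open>h\<close> into the ideal, which saturation excludes.\<close>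
  then obtain c where c: "q = [:c:]" "c \<noteq> 0" by (metis degree_eq_zeroE pCons_0_0)
  have "coeff q s * (z $ i) ^ s * (z $ j) ^ (r - s) = (if s = 0 then c * (z $ j) ^ r else 0)" for s z
    by (cases s) (simp_all add: c(1))
  then have "homogenization i q r z = c * (z $ j) ^ r" for z
    by (simp add: homogenization_def)
  then have "R (d + int r) (\<lambda>z. c * (z $ j) ^ r * h z)" using 0 by simp
  from R_smult[OF this, of "inverse c"] have "R (d + int r) (\<lambda>z. (z $ j) ^ r * h z)"
    using c(2) by (simp add: mult.assoc[symmetric])
  then show ?case using R_sat_power 0 by blast
next
  case (Suc n)
  have "degree q \<in> {1..degree q}" "coeff q (degree q) \<noteq> 0"
    using Suc.hyps(2) Suc.prems(1) leading_coeff_neq_0 by auto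
  then obtain \<mu> where "(\<Sum>i\<le>degree q. coeff q i * \<mu> ^ i) = 0"
    using fundamental_theorem_of_algebra[of "coeff q" "degree q"] by blast
  then have "poly q \<mu> = 0" by (simp add: poly_altdef)
  then obtain q' where q': "q = [:- \<mu>, 1:] * q'" unfolding poly_eq_0_iff_dvd dvd_def by blast
  with Suc.prems have "q' \<noteq> 0" by auto
  then have deg: "degree q = Suc (degree q')" unfolding q' by (subst degree_mult_eq) auto
  then obtain r' where r': "r = Suc r'" "degree q' \<le> r'" using Suc.prems(2) by (cases r) auto
  let ?h = "\<lambda>z. (z $ i - \<mu> * z $ j) * h z"
  have h: "hpoly J (d + 1) ?h"
    by (rule hpoly_mult'[OF hpoly_linear_factor[OF i] Suc.prems(3)]) auto
  show ?case
  proof (cases "R (d + 1) ?h")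
    case True
    then show ?thesis using Suc.prems
      by (intro exI[of _ "\<lambda>_. 1"] exI[of _ 0] exI[of _ \<mu>]) (simp add: hpoly_const)
  next
    case False
    have "R (d + 1 + int r') (\<lambda>z. homogenization i q' r' z * ?h z)"
      using Suc.prems(5) unfolding q' r'(1) homogenization_linear_factor[OF r'(2)]
      by (simp add: mult_ac add_ac)
    then obtain g e \<nu> where g: "hpoly J e g" "\<not> R (d + 1 + e) (\<lambda>z. g z * ?h z)"
      "R (d + 1 + e + 1) (\<lambda>z. (z $ i - \<nu> * z $ j) * (g z * ?h z))"
      using Suc.hyps(1)[of q' r' "d + 1" ?h] h False \<open>q' \<noteq> 0\<close> r' deg Suc.hyps(2) by auto
    have "hpoly J (e + 1) (\<lambda>z. g z * (z $ i - \<mu> * z $ j))"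
      by (rule hpoly_mult[OF g(1) hpoly_linear_factor[OF i]])
    then show ?thesis using g(2,3)
      by (intro exI[of _ "\<lambda>z. g z * (z $ i - \<mu> * z $ j)"] exI[of _ "e + 1"] exI[of _ \<nu>])
        (simp add: algebra_simps)
  qed
qed

text \<open>Multiplying \<open>h\<close> by the monomials of degree \<open>r\<close> in the
  coordinates \<open>i\<close> and \<open>j\<close> gives \<open>r + 1\<close> forms. Modulo the
  ideal all of them are the same power of the coordinate \<open>j\<close> times forms of degree
  \<open>M\<close>, so they are linearly dependent once \<open>r\<close> reaches the size of a
  spanning set.\<close>

lemma annihilating_polynomial:
  assumes i: "i \<in> J" and h: "hpoly J d h" "d \<ge> 0"
  shows "\<exists>q r. q \<noteq> 0 \<and> degree q \<le> r \<and> R (d + int r) (\<lambda>z. homogenization i q r z * h z)"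
proof -
  obtain B where B: "finite B" "\<And>f. hpoly J M f \<Longrightarrow> \<exists>c. \<forall>z. f z = (\<Sum>b\<in>B. c b * b z)"
    using hpoly_finite_span[OF M] by blast
  \<comment> \<open>The summand \<open>card B\<close> forces the linear dependence;
    \<open>nat M\<close> makes \<open>d + r\<close> at least \<open>M\<close>, where
    \<open>R_fin\<close> applies.\<close>
  define r where "r = nat M + card B"
  define k where "k = nat (d + int r - M)"
  have k: "d + int r = M + int k" using h(2) M unfolding k_def r_def by simp
  have "\<forall>s\<in>{..r}. \<exists>g. hpoly J M g \<and>
      R (M + int k) (\<lambda>z. (z $ i) ^ s * (z $ j) ^ (r - s) * h z - (z $ j) ^ k * g z)"
  proof
    fix s assume "s \<in> {..r}"
    then have "hpoly J (M + int k) (\<lambda>z. (z $ i) ^ s * (z $ j) ^ (r - s) * h z)"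
      unfolding k[symmetric]
      by (intro hpoly_mult'[OF hpoly_mult[OF hpoly_coord_power[OF i] hpoly_coord_power[OF j]] h(1)]) auto
    then show "\<exists>g. hpoly J M g \<and>
        R (M + int k) (\<lambda>z. (z $ i) ^ s * (z $ j) ^ (r - s) * h z - (z $ j) ^ k * g z)"
      by (rule R_fin)
  qed
  from bchoice[OF this] obtain g where g: "\<And>s. s \<le> r \<Longrightarrow> hpoly J M (g s)"
    "\<And>s. s \<le> r \<Longrightarrow> R (M + int k) (\<lambda>z. (z $ i) ^ s * (z $ j) ^ (r - s) * h z - (z $ j) ^ k * g s z)"
    by auto
  have "\<forall>s\<in>{..r}. \<exists>c. \<forall>z. g s z = (\<Sum>b\<in>B. c b * b z)" using g(1) B(2) by auto
  from bchoice[OF this] obtain c where c: "\<And>s z. s \<le> r \<Longrightarrow> g s z = (\<Sum>b\<in>B. c s b * b z)" by auto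
  obtain x where x: "\<exists>s\<in>{..r}. x s \<noteq> 0" "\<forall>b\<in>B. (\<Sum>s\<le>r. x s * c s b) = 0"
    using linear_system_nontrivial[OF B(1), of "{..r}" c] unfolding r_def by auto
  \<comment> \<open>The coefficients of the linear dependence become those of the annihilating
    polynomial.\<close>
  define q where "q = (\<Sum>s\<le>r. monom (x s) s)"
  have q: "coeff q s = (if s \<le> r then x s else 0)" for s
    unfolding q_def by (simp add: coeff_sum coeff_monom)
  have zero: "(\<Sum>s\<le>r. x s * g s z) = 0" for z
  proof -
    have "(\<Sum>s\<le>r. x s * g s z) = (\<Sum>s\<le>r. \<Sum>b\<in>B. x s * c s b * b z)"
      by (intro sum.cong refl) (simp add: c sum_distrib_left mult.assoc)
    also have "\<dots> = (\<Sum>b\<in>B. (\<Sum>s\<le>r. x s * c s b) * b z)"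
      by (subst sum.swap) (simp add: sum_distrib_right)
    finally show ?thesis using x(2) by simp
  qed
  have "R (M + int k) (\<lambda>z. \<Sum>s\<le>r. x s * ((z $ i) ^ s * (z $ j) ^ (r - s) * h z - (z $ j) ^ k * g s z))"
    using g(2) by (intro R_sum R_smult) auto
  moreover have "(\<Sum>s\<le>r. x s * ((z $ i) ^ s * (z $ j) ^ (r - s) * h z - (z $ j) ^ k * g s z)) =
      homogenization i q r z * h z" for z
  proof -
    have "(\<Sum>s\<le>r. x s * ((z $ i) ^ s * (z $ j) ^ (r - s) * h z - (z $ j) ^ k * g s z)) =
      (\<Sum>s\<le>r. x s * (z $ i) ^ s * (z $ j) ^ (r - s) * h z - (z $ j) ^ k * (x s * g s z))"
      by (intro sum.cong refl) (simp add: algebra_simps)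
    also have "\<dots> = (\<Sum>s\<le>r. x s * (z $ i) ^ s * (z $ j) ^ (r - s)) * h z - (z $ j) ^ k * (\<Sum>s\<le>r. x s * g s z)"
      by (simp only: sum_subtractf sum_distrib_left sum_distrib_right)
    also have "\<dots> = homogenization i q r z * h z"
      unfolding zero homogenization_def by (simp add: q)
    finally show ?thesis .
  qed
  ultimately have "R (d + int r) (\<lambda>z. homogenization i q r z * h z)" unfolding k by simp
  moreover have "q \<noteq> 0" using x(1) q by (metis atMost_iff coeff_0)
  moreover have "degree q \<le> r" by (rule degree_le) (simp add: q)
  ultimately show ?thesis by blast
qed

text \<open>The operators commute: multiplying \<open>h\<close> by the factor \<open>g\<close> found
  for a new coordinate preserves the eigenvalue equations for the old ones, since the
  \<open>R d\<close> form an ideal.\<close>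

lemma common_eigenvector:
  assumes "finite X" "X \<subseteq> J"
  shows "\<exists>d h p. d \<ge> 0 \<and> hpoly J d h \<and> \<not> R d h \<and>
    (\<forall>i\<in>X. R (d + 1) (\<lambda>z. (z $ i - p i * z $ j) * h z))"
  using assms
proof (induction X rule: finite_induct)
  case empty
  then show ?case using R_one by (intro exI[of _ 0] exI[of _ "\<lambda>_. 1"]) (simp add: hpoly_const)
next
  case (insert i X)
  then obtain d h p where h: "d \<ge> 0" "hpoly J d h" "\<not> R d h"
    "\<forall>i\<in>X. R (d + 1) (\<lambda>z. (z $ i - p i * z $ j) * h z)" by blast
  have i: "i \<in> J" using insert by auto
  obtain q r where "q \<noteq> 0" "degree q \<le> r" "R (d + int r) (\<lambda>z. homogenization i q r z * h z)"
    using annihilating_polynomial[OF i h(2,1)] by blast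
  then obtain g e \<mu> where g: "hpoly J e g" "\<not> R (d + e) (\<lambda>z. g z * h z)"
      "R (d + e + 1) (\<lambda>z. (z $ i - \<mu> * z $ j) * (g z * h z))"
    using eigenvector_of_annihilating_polynomial[OF i _ _ h(2,3)] by blast
  have gh: "hpoly J (d + e) (\<lambda>z. g z * h z)" by (rule hpoly_mult'[OF g(1) h(2)]) simp
  \<comment> \<open>In negative degree the product would vanish and so lie in the ideal.\<close>
  have "d + e \<ge> 0"
  proof (rule ccontr)
    assume "\<not> ?thesis"
    then have "(\<lambda>z. g z * h z) = (\<lambda>_. 0)" using hpoly_neg[OF gh] by auto
    then show False using g(2) R_zero by simp
  qed
  moreover have "R (d + e + 1) (\<lambda>z. (z $ l - (p(i := \<mu>)) l * z $ j) * (g z * h z))" if "l \<in> insert i X" for l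
  proof (cases "l = i")
    case False
    then have "R (d + 1 + e) (\<lambda>z. g z * ((z $ l - p l * z $ j) * h z))"
      using that h(4) by (intro R_mult[OF g(1)]) auto
    then show ?thesis using False by (simp add: algebra_simps)
  qed (use g in simp)
  ultimately show ?case using gh g(2)
    by (intro exI[of _ "d + e"] exI[of _ "\<lambda>z. g z * h z"] exI[of _ "p(i := \<mu>)"]) blast
qed

text \<open>On the common eigenvector \<open>h\<close>, a form \<open>f\<close> of degree
  \<open>e\<close> acts as its value at the eigenvalues \<open>p\<close> times the power
  \<open>e\<close> of the coordinate \<open>j\<close>. If \<open>f\<close> lies in the ideal, this
  product does too, and by saturation the value must be 0.\<close>

theorem exists_zero:
  "\<exists>p. p \<noteq> 0 \<and> (\<forall>i. i \<notin> J \<longrightarrow> p $ i = 0) \<and>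
    (\<forall>e f. e \<ge> 0 \<longrightarrow> hpoly J e f \<longrightarrow> R e f \<longrightarrow> f p = 0)"
proof -
  obtain d h p' where h: "d \<ge> 0" "hpoly J d h" "\<not> R d h"
    "\<forall>i\<in>J. R (d + 1) (\<lambda>z. (z $ i - p' i * z $ j) * h z)"
    using common_eigenvector[of J] by auto
  define p where "p = (\<chi> i. if i \<in> J then p' i else 0)"
  have p: "R (d + 1) (\<lambda>z. (z $ i - p $ i * z $ j) * h z)" if "i \<in> J" for i
    using h(4) that by (simp add: p_def)
  \<comment> \<open>By induction on the construction of \<open>f\<close>; the eigenvalue equations
    are the case of a coordinate.\<close>
  have eval: "R (d + e) (\<lambda>z. (f z - f p * (z $ j) ^ nat e) * h z)" if "hpoly J e f" "e \<ge> 0" for e f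
    using that
  proof (induction rule: hpoly.induct)
    case (hpoly_add e f g)
    from R_add[OF hpoly_add.IH] hpoly_add.prems show ?case by (simp add: algebra_simps)
  next
    case (hpoly_coord i e f)
    show ?case
    proof (cases "e < 0")
      case True
      then show ?thesis using hpoly_neg[OF hpoly_coord.hyps(2)] R_zero by simp
    next
      case False
      then have e: "nat (e + 1) = Suc (nat e)" "hpoly J e (\<lambda>z. f p * (z $ j) ^ nat e)"
        using hpoly_smult[OF hpoly_coord_power[OF j, of "nat e"], of "f p"] by auto
      have 1: "R (d + e + 1) (\<lambda>z. z $ i * ((f z - f p * (z $ j) ^ nat e) * h z))"
        using hpoly_coord False by (intro R_mult[OF hpoly_coord1]) auto
      have "R (d + 1 + e) (\<lambda>z. f p * (z $ j) ^ nat e * ((z $ i - p $ i * z $ j) * h z))"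
        using hpoly_coord by (intro R_mult[OF e(2)] p) auto
      then have 2: "R (d + e + 1) (\<lambda>z. f p * (z $ j) ^ nat e * ((z $ i - p $ i * z $ j) * h z))"
        by (simp add: algebra_simps)
      from R_add[OF 1 2] show ?thesis unfolding e(1) by (simp add: algebra_simps)
    qed
  qed (auto simp: R_zero)
  have "f p = 0" if f: "e \<ge> 0" "hpoly J e f" "R e f" for e f
  proof (rule ccontr)
    assume "f p \<noteq> 0"
    have "R (e + d) (\<lambda>z. h z * f z)" by (rule R_mult[OF h(2) f(3)])
    then have "R (d + e) (\<lambda>z. h z * f z)" by (simp add: add.commute)
    from R_diff[OF this eval[OF f(2,1)]]
    have "R (d + e) (\<lambda>z. f p * ((z $ j) ^ nat e * h z))" by (simp add: algebra_simps)
    from R_smult[OF this, of "inverse (f p)"]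
    have "R (d + int (nat e)) (\<lambda>z. (z $ j) ^ nat e * h z)"
      using \<open>f p \<noteq> 0\<close> f(1) by (simp add: mult.assoc[symmetric])
    then show False using R_sat_power h(2,3) by blast
  qed
  \<comment> \<open>If \<open>p\<close> vanished, the eigenvalue equation for \<open>j\<close>
    itself would put the coordinate \<open>j\<close> times \<open>h\<close> into the ideal.\<close>
  moreover have "p \<noteq> 0"
  proof
    assume "p = 0"
    then have "R (d + 1) (\<lambda>z. z $ j * h z)" using p[OF j] by simp
    then show False using R_sat h(2,3) by blast
  qed
  moreover have "\<forall>i. i \<notin> J \<longrightarrow> p $ i = 0" by (simp add: p_def)
  ultimately show ?thesis by blast
qed

end

section \<open>Forms without common zeros\<close>

lemma negligible_complex_hyperplane:
  fixes m :: "complex ^ 'i::finite"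
  assumes "m \<noteq> 0"
  shows "negligible {z. (\<Sum>i\<in>UNIV. m $ i * z $ i) = 0}"
proof -
  \<comment> \<open>The real inner product with this vector is the real part of the complex linear
    form, so the complex hyperplane lies in a real one.\<close>
  let ?a = "\<chi> i. cnj (m $ i)"
  have "?a \<bullet> z = Re (\<Sum>i\<in>UNIV. m $ i * z $ i)" for z
    by (simp add: inner_vec_def inner_complex_def)
  then have "{z. (\<Sum>i\<in>UNIV. m $ i * z $ i) = 0} \<subseteq> {z. ?a \<bullet> z = 0}"
    by (auto simp del: Re_sum)
  moreover have "?a \<noteq> 0" using assms by (auto simp: vec_eq_iff)
  ultimately show ?thesis using negligible_hyperplane[of ?a 0] negligible_subset by blast
qed

lemma has_derivative_vec_lambda:
  fixes f :: "'i::finite \<Rightarrow> 'a::real_normed_vector \<Rightarrow> complex"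
  assumes "\<And>i. (f i has_derivative f' i) (at z)"
  shows "((\<lambda>z. \<chi> i. f i z) has_derivative (\<lambda>v. \<chi> i. f' i v)) (at z)"
proof (subst has_derivative_componentwise_within, intro ballI)
  fix b :: "complex ^ 'i" assume "b \<in> Basis"
  then obtain i u where b: "b = axis i u" by (auto simp: Basis_vec_def)
  show "((\<lambda>x. (\<chi> i. f i x) \<bullet> b) has_derivative (\<lambda>x. (\<chi> i. f' i x) \<bullet> b)) (at z)"
    unfolding b inner_axis using assms by (auto intro!: has_derivative_inner_left)
qed

lemma differentiable_on_vec_lambda:
  fixes f :: "'i::finite \<Rightarrow> complex ^ 'i \<Rightarrow> complex"
  assumes "\<And>i z. f i differentiable (at z)"
  shows "(\<lambda>z. \<chi> i. f i z) differentiable_on S"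
proof -
  have "((\<lambda>z. \<chi> i. f i z) has_derivative (\<lambda>v. \<chi> i. frechet_derivative (f i) (at z) v)) (at z)" for z
    by (rule has_derivative_vec_lambda) (use assms frechet_derivative_works in blast)
  then show ?thesis
    unfolding differentiable_on_def differentiable_def using has_derivative_at_withinI by blast
qed

text \<open>Fewer than \<open>card I\<close> variables do not suffice to attain all values, for reasons of measure.\<close>

lemma exists_missed_direction:
  fixes I J :: "'a::finite set"
  assumes j: "j \<notin> J" and card: "card I = Suc (card J)" and a: "a > 0"
    and B: "\<And>i. i \<in> I \<Longrightarrow> hpoly (insert j J) a (B i)"
  shows "\<exists>k\<in>I. \<exists>\<mu>. \<forall>w. (\<forall>i. i \<notin> J \<longrightarrow> w $ i = 0) \<longrightarrow>
    (\<forall>i\<in>I - {k}. B i w = \<mu> i * B k w) \<longrightarrow> B k w = (0::complex)"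
proof -
  have "card (UNIV - I) = card (UNIV - insert j J)"
    using j card by (subst (1 2) card_Diff_subset) auto
  \<comment> \<open>The free coordinates on both sides are matched, so that the \<open>B i\<close>
    on the span of \<open>J\<close> extend to a map of the whole space to itself, restricted to the
    hyperplane \<open>S\<close>. Differentiable images of negligible sets are negligible only
    between equal dimensions.\<close>
  then obtain \<tau> where \<tau>: "bij_betw \<tau> (UNIV - I) (UNIV - insert j J)"
    using finite_same_card_bij[of "UNIV - I" "UNIV - insert j J"] by auto
  define T where "T = (\<lambda>z::complex ^ 'a. \<chi> i. if i \<in> J then z $ i else 0)"
  define g where "g = (\<lambda>i z. if i \<in> I then B i (T z) else z $ \<tau> i)"
  define S where "S = {z :: complex ^ 'a. z $ j = 0}"
  have "hpoly UNIV 1 (\<lambda>z. T z $ i)" for i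
    by (cases "i \<in> J") (simp_all add: T_def hpoly_coord1 hpoly_zero)
  then have "g i differentiable (at z)" for i z
    using B hpoly_linear_image[of T "insert j J" a "B i"] hpoly_differentiable
      bounded_linear_imp_differentiable[OF bounded_linear_vec_nth]
    by (cases "i \<in> I") (auto simp: g_def)
  then have diff: "(\<lambda>z. \<chi> i. g i z) differentiable_on S" by (rule differentiable_on_vec_lambda)
  have "negligible S"
  proof -
    have "axis j 1 \<noteq> (0 :: complex ^ 'a)" by simp
    moreover have "(\<Sum>i\<in>UNIV. axis j 1 $ i * z $ i) = z $ j" for z :: "complex ^ 'a"
    proof -
      have "(\<Sum>i\<in>UNIV. axis j 1 $ i * z $ i) = (\<Sum>i\<in>UNIV. if i = j then z $ j else 0)"
        by (intro sum.cong) (auto simp: axis_def)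
      then show ?thesis by simp
    qed
    ultimately show ?thesis unfolding S_def using negligible_complex_hyperplane[of "axis j 1 :: complex ^ 'a"] by simp
  qed
  then have "negligible ((\<lambda>z. \<chi> i. g i z) ` S)"
    by (rule negligible_differentiable_image_negligible[OF order_refl _ diff])
  then have "(\<lambda>z. \<chi> i. g i z) ` S \<noteq> UNIV" using non_negligible_UNIV by metis
  then obtain c where c: "c \<notin> (\<lambda>z. \<chi> i. g i z) ` S" by blast
  have miss: "\<not> (\<forall>i\<in>I. B i w = c $ i)" if w: "\<forall>i. i \<notin> J \<longrightarrow> w $ i = 0" for w
  proof
    assume eq: "\<forall>i\<in>I. B i w = c $ i"
    define z where "z = (\<chi> i. if i \<in> J then w $ i else if i = j then 0
      else c $ (the_inv_into (UNIV - I) \<tau> i))"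
    have "T z = w" using w by (auto simp: T_def z_def vec_eq_iff)
    moreover have "z $ \<tau> i = c $ i" if "i \<notin> I" for i
    proof -
      have "\<tau> i \<in> UNIV - insert j J" using \<tau> that by (auto simp: bij_betw_def)
      then show ?thesis using the_inv_into_f_f[of \<tau> "UNIV - I" i] \<tau> that
        by (auto simp: z_def bij_betw_def)
    qed
    ultimately have "g i z = c $ i" for i using eq by (cases "i \<in> I") (simp_all add: g_def)
    then have "c = (\<chi> i. g i z)" by (simp add: vec_eq_iff)
    moreover have "z \<in> S" using j by (simp add: S_def z_def)
    ultimately show False using c by blast
  qed
  \<comment> \<open>The \<open>B i\<close> all vanish at the origin, so a missed value is not zero
    on \<open>I\<close>.\<close>
  have "\<exists>k\<in>I. c $ k \<noteq> 0"
    using miss[of 0] hpoly_at_0[OF B a] by auto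
  then obtain k where k: "k \<in> I" "c $ k \<noteq> 0" by blast
  have "B k w = 0" if w: "\<forall>i. i \<notin> J \<longrightarrow> w $ i = 0" and eq: "\<forall>i\<in>I - {k}. B i w = c $ i / c $ k * B k w" for w
  proof (rule ccontr)
    assume nz: "B k w \<noteq> 0"
    \<comment> \<open>Up to a scalar the values at \<open>w\<close> would agree with
      \<open>c\<close>; a root of degree \<open>a\<close> of that scalar rescales \<open>w\<close>
      to a point where \<open>c\<close> is attained.\<close>
    have "card {t. t ^ nat a = c $ k / B k w} = nat a" using nz k(2) a by (intro card_nth_roots) auto
    then obtain t where t: "t ^ nat a = c $ k / B k w" using a by fastforce
    have "B i (t *s w) = c $ i" if "i \<in> I" for i
    proof -
      have "B i (t *s w) = t ^ nat a * B i w" using hpoly_scale[OF B[OF that]] a by simp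
      also have "\<dots> = c $ i" using eq that nz k(2) t by (cases "i = k") auto
      finally show ?thesis .
    qed
    moreover have "\<forall>i. i \<notin> J \<longrightarrow> (t *s w) $ i = 0" using w by simp
    ultimately show False using miss by blast
  qed
  then show ?thesis using k(1) by (intro bexI[of _ k] exI[of _ "\<lambda>i. c $ i / c $ k"]) auto
qed

lemma in_ideal_trans:
  assumes "in_ideal J I B' a d f" "\<And>i. i \<in> I \<Longrightarrow> in_ideal J I B a a (B' i)"
  shows "in_ideal J I B a d f"
proof -
  obtain Q where Q: "\<forall>i\<in>I. hpoly J (d - a) (Q i)" "\<forall>z. f z = (\<Sum>i\<in>I. Q i z * B' i z)"
    using assms(1) unfolding in_ideal_def by blast
  have "in_ideal J I B a (a + (d - a)) (\<lambda>z. \<Sum>i\<in>I. Q i z * B' i z)"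
    using Q(1) assms(2) by (intro in_ideal_sum in_ideal_mult) auto
  moreover have "(\<lambda>z. \<Sum>i\<in>I. Q i z * B' i z) = f" using Q(2) by auto
  ultimately show ?thesis by simp
qed

text \<open>Acyclicity depends only on the span of the generators. Under an elementary change of
  generators, relations transform contragrediently and the matrix of a trivial relation by
  congruence, which keeps it skew.\<close>

lemma koszul_acyclic_change:
  assumes K: "koszul_acyclic J I B' a" and k: "k \<in> I" "\<nu> k = 0" and I: "finite I"
    and B': "\<And>i z. i \<in> I \<Longrightarrow> B' i z = B i z - \<nu> i * B k z"
  shows "koszul_acyclic J I B a"
  unfolding koszul_acyclic_def
proof (intro allI impI)
  fix e Q
  assume Q: "\<forall>i\<in>I. hpoly J e (Q i)" and rel: "\<forall>z. (\<Sum>i\<in>I. Q i z * B i z) = 0"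
  \<comment> \<open>Subtracting multiples of \<open>B k\<close> from the other generators is
    compensated in the coefficient of \<open>B k\<close> alone.\<close>
  define Q' where "Q' = (\<lambda>i z. Q i z + of_bool (i = k) * (\<Sum>l\<in>I. \<nu> l * Q l z))"
  have hQ': "hpoly J e (Q' i)" if "i \<in> I" for i
    unfolding Q'_def using that Q by (intro hpoly_add hpoly_smult hpoly_sum) auto
  have "(\<Sum>i\<in>I. Q' i z * B' i z) = 0" for z
  proof -
    have "(\<Sum>i\<in>I. Q' i z * B' i z) =
      (\<Sum>i\<in>I. Q i z * B i z - \<nu> i * Q i z * B k z + (if i = k then (\<Sum>l\<in>I. \<nu> l * Q l z) * B k z else 0))"
      using k by (intro sum.cong refl) (auto simp: Q'_def B' algebra_simps)
    also have "\<dots> = (\<Sum>i\<in>I. Q i z * B i z) - (\<Sum>i\<in>I. \<nu> i * Q i z) * B k z + (\<Sum>l\<in>I. \<nu> l * Q l z) * B k z"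
      using k I by (simp add: sum.distrib sum_subtractf sum_distrib_right)
    finally show ?thesis using rel by simp
  qed
  then obtain C where skew: "skew_on I C" and C: "\<forall>i\<in>I. \<forall>l\<in>I. hpoly J (e - a) (C i l)"
    and QC: "\<forall>i\<in>I. \<forall>z. Q' i z = (\<Sum>l\<in>I. C i l z * B' l z)"
    using koszul_acyclicD[OF K, of e Q'] hQ' by blast
  \<comment> \<open>\<open>D\<close> changes the columns of \<open>C\<close> and \<open>E\<close>
    then the rows in the same way; only both together give a skew matrix.\<close>
  define D where "D = (\<lambda>i l z. C i l z - of_bool (l = k) * (\<Sum>q\<in>I. \<nu> q * C i q z))"
  define E where "E = (\<lambda>i l z. D i l z - of_bool (i = k) * (\<Sum>p\<in>I. \<nu> p * D p l z))"
  have hD: "hpoly J (e - a) (D i l)" if "i \<in> I" "l \<in> I" for i l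
    unfolding D_def using that C by (intro hpoly_diff hpoly_smult hpoly_sum) auto
  have hE: "hpoly J (e - a) (E i l)" if "i \<in> I" "l \<in> I" for i l
    unfolding E_def using that hD by (intro hpoly_diff hpoly_smult hpoly_sum) auto
  have QD: "Q' i z = (\<Sum>l\<in>I. D i l z * B l z)" if "i \<in> I" for i z
  proof -
    have "(\<Sum>l\<in>I. D i l z * B l z) =
      (\<Sum>l\<in>I. C i l z * B l z - (if l = k then (\<Sum>q\<in>I. \<nu> q * C i q z) * B k z else 0))"
      by (intro sum.cong refl) (auto simp: D_def algebra_simps)
    also have "\<dots> = (\<Sum>l\<in>I. C i l z * B l z) - (\<Sum>q\<in>I. \<nu> q * C i q z) * B k z"
      using k I by (simp add: sum_subtractf)
    also have "\<dots> = (\<Sum>l\<in>I. C i l z * B' l z)"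
      unfolding sum_distrib_right sum_subtractf[symmetric]
      by (intro sum.cong refl) (simp add: B' algebra_simps)
    finally show ?thesis using QC that by simp
  qed
  have "Q i z = (\<Sum>l\<in>I. E i l z * B l z)" if "i \<in> I" for i z
  proof -
    have "(\<Sum>l\<in>I. E i l z * B l z) =
      (\<Sum>l\<in>I. D i l z * B l z) - of_bool (i = k) * (\<Sum>l\<in>I. \<Sum>p\<in>I. \<nu> p * (D p l z * B l z))"
      by (simp add: E_def algebra_simps sum_subtractf sum_distrib_left sum_distrib_right)
    also have "(\<Sum>l\<in>I. \<Sum>p\<in>I. \<nu> p * (D p l z * B l z)) = (\<Sum>p\<in>I. \<nu> p * (\<Sum>l\<in>I. D p l z * B l z))"
      by (subst sum.swap) (simp add: sum_distrib_left)
    also have "\<dots> = (\<Sum>p\<in>I. \<nu> p * Q' p z)" using QD by (intro sum.cong) auto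
    also have "\<dots> = (\<Sum>p\<in>I. \<nu> p * Q p z)"
      using k(2) by (intro sum.cong) (auto simp: Q'_def)
    finally have E: "(\<Sum>l\<in>I. E i l z * B l z) =
      (\<Sum>l\<in>I. D i l z * B l z) - of_bool (i = k) * (\<Sum>p\<in>I. \<nu> p * Q p z)" .
    show ?thesis unfolding E QD[OF that, symmetric] by (simp add: Q'_def)
  qed
  moreover have "skew_on I E"
    unfolding skew_on_def
  proof (intro ballI allI)
    fix i l z assume il: "i \<in> I" "l \<in> I"
    have s: "C p q z = - C q p z" if "p \<in> I" "q \<in> I" for p q
      using skew that unfolding skew_on_def by blast
    have 1: "(\<Sum>q\<in>I. \<nu> q * C p q z) = - (\<Sum>q\<in>I. \<nu> q * C q p z)" if "p \<in> I" for p
    proof -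
      have "(\<Sum>q\<in>I. \<nu> q * C p q z) = (\<Sum>q\<in>I. - (\<nu> q * C q p z))"
        using that by (intro sum.cong refl) (subst s, auto)
      then show ?thesis by (simp add: sum_negf)
    qed
    have 2: "(\<Sum>p\<in>I. \<nu> p * (\<Sum>q\<in>I. \<nu> q * C p q z)) = 0"
      using skew_sum_zero[OF skew, where z = z and b = \<nu>] by (simp add: mult.commute)
    have 3: "(\<Sum>p\<in>I. \<nu> p * D p q z) = (\<Sum>p\<in>I. \<nu> p * C p q z)" for q
    proof -
      have "(\<Sum>p\<in>I. \<nu> p * D p q z) =
        (\<Sum>p\<in>I. \<nu> p * C p q z) - of_bool (q = k) * (\<Sum>p\<in>I. \<nu> p * (\<Sum>q\<in>I. \<nu> q * C p q z))"
        by (simp add: D_def algebra_simps sum_subtractf sum_distrib_left)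
      then show ?thesis using 2 by simp
    qed
    show "E i l z = - E l i z"
      unfolding E_def unfolding 3 unfolding D_def using s[OF il] 1[OF il(1)] 1[OF il(2)] by simp
  qed
  ultimately show "\<exists>C. skew_on I C \<and> (\<forall>i\<in>I. \<forall>l\<in>I. hpoly J (e - a) (C i l)) \<and>
      (\<forall>i\<in>I. \<forall>z. Q i z = (\<Sum>l\<in>I. C i l z * B l z))"
    using hE by blast
qed

section \<open>Putting back the form that was dropped on the hyperplane\<close>

context hyperplane_section
begin

text \<open>Otherwise the saturation of the ideal with respect to the variable \<open>j\<close>
  would be proper. \<open>reduce_mod_ideal\<close> supplies the finiteness required by
  \<open>saturated_ideal\<close>, and \<open>exists_zero\<close> then yields a common zero of the
  forms.\<close>

lemma zj_power_in_ideal: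
  assumes prim: "primary J I B0 a" and k: "hpoly J' a (B k)" and zf: "zero_free J' (insert k I) B"
  shows "\<exists>r. in_ideal J' (insert k I) B a (int r) (\<lambda>z. (z $ j) ^ r)"
proof (rule ccontr)
  let ?I = "insert k I"
  \<comment> \<open>The saturation: forms that some power of the variable \<open>j\<close> brings
    into the ideal.\<close>
  define R where "R = (\<lambda>d f. \<exists>r. in_ideal J' ?I B a (d + int r) (\<lambda>z. (z $ j) ^ r * f z))"
  assume contra: "\<not> ?thesis"
  obtain M where M: "M \<ge> 0" "\<And>d f. d \<ge> M \<Longrightarrow> hpoly J d f \<Longrightarrow> in_ideal J I B0 a d f"
    using prim unfolding primary_def by blast
  have Rmono: "in_ideal J' ?I B a (d + int (r + s)) (\<lambda>z. (z $ j) ^ (r + s) * f z)"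
    if "in_ideal J' ?I B a (d + int r) (\<lambda>z. (z $ j) ^ r * f z)" for d f r s
  proof -
    have "in_ideal J' ?I B a (d + int r + int s) (\<lambda>z. (z $ j) ^ s * ((z $ j) ^ r * f z))"
      by (rule in_ideal_mult[OF hpoly_coord_power that]) simp
    then show ?thesis by (simp add: power_add mult_ac add_ac)
  qed
  interpret saturated_ideal J' j R M
  proof
    show "R d (\<lambda>_. 0)" for d by (simp add: R_def in_ideal_zero)
    show "R d (\<lambda>z. f z + g z)" if fg: "R d f" "R d g" for d f g
    proof -
      obtain r s where "in_ideal J' ?I B a (d + int r) (\<lambda>z. (z $ j) ^ r * f z)"
        "in_ideal J' ?I B a (d + int s) (\<lambda>z. (z $ j) ^ s * g z)" using fg unfolding R_def by blast
      from in_ideal_add[OF Rmono[OF this(1), of s] Rmono[OF this(2), of r, unfolded add.commute[of s r]]]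
      show ?thesis unfolding R_def by (intro exI[of _ "r + s"]) (simp add: distrib_left)
    qed
    show "R (d + e) (\<lambda>z. g z * f z)" if g: "hpoly J' e g" and f: "R d f" for d e f g
    proof -
      obtain r where "in_ideal J' ?I B a (d + int r) (\<lambda>z. (z $ j) ^ r * f z)"
        using f unfolding R_def by blast
      from in_ideal_mult[OF g this] show ?thesis
        unfolding R_def by (intro exI[of _ r]) (simp add: mult_ac add_ac)
    qed
    show "R d h" if "R (d + 1) (\<lambda>z. z $ j * h z)" for d h
    proof -
      obtain r where "in_ideal J' ?I B a (d + 1 + int r) (\<lambda>z. (z $ j) ^ r * (z $ j * h z))"
        using \<open>R (d + 1) (\<lambda>z. z $ j * h z)\<close> unfolding R_def by blast
      then show ?thesis unfolding R_def by (intro exI[of _ "Suc r"]) (simp add: mult_ac add_ac)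
    qed
    show "\<exists>g. hpoly J' M g \<and> R (M + int r) (\<lambda>z. f z - (z $ j) ^ r * g z)"
      if f: "hpoly J' (M + int r) f" for r f
    proof -
      obtain g where g: "hpoly J' M g" "in_ideal J' I B a (M + int r) (\<lambda>z. f z - (z $ j) ^ r * g z)"
        using reduce_mod_ideal[of M r f] M(2) f by blast
      have "R (M + int r) (\<lambda>z. f z - (z $ j) ^ r * g z)"
        unfolding R_def using in_ideal_mono[OF g(2), of ?I] by (intro exI[of _ 0]) auto
      with g(1) show ?thesis by blast
    qed
    show "\<not> R 0 (\<lambda>_. 1)" using contra by (simp add: R_def)
  qed (use M in auto)
  obtain p where p: "p \<noteq> 0" "\<forall>i. i \<notin> J' \<longrightarrow> p $ i = 0"
    "\<And>e f. e \<ge> 0 \<Longrightarrow> hpoly J' e f \<Longrightarrow> R e f \<Longrightarrow> f p = 0" using exists_zero by blast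
  have "B i p = 0" if "i \<in> ?I" for i
  proof (rule p(3))
    show "hpoly J' a (B i)" using that k hpoly_B by blast
    show "R a (B i)"
      unfolding R_def using in_ideal_gen[of i ?I J' B a] that by (intro exI[of _ 0]) auto
  qed (use a in auto)
  then show False using zf p(1,2) unfolding zero_free_def by blast
qed

text \<open>In a relation, the product of \<open>Q k\<close> and \<open>B k\<close> lies in the
  ideal of the others. So does \<open>Q k\<close> times a power of the variable \<open>j\<close>, as
  that power lies in the full ideal, and hence \<open>Q k\<close> itself. Subtracting a trivial
  relation removes \<open>Q k\<close>, and \<open>koszul_lift\<close> treats the rest.\<close>

lemma koszul_acyclic_insert:
  assumes K: "koszul_acyclic J I B0 a" and k: "k \<notin> I" "hpoly J' a (B k)"
    and r: "in_ideal J' (insert k I) B a (int r) (\<lambda>z. (z $ j) ^ r)"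
  shows "koszul_acyclic J' (insert k I) B a"
  unfolding koszul_acyclic_def
proof (intro allI impI)
  let ?I = "insert k I"
  fix e Q
  assume Q: "\<forall>i\<in>?I. hpoly J' e (Q i)" and rel: "\<forall>z. (\<Sum>i\<in>?I. Q i z * B i z) = 0"
  have rel': "Q k z * B k z = - (\<Sum>i\<in>I. Q i z * B i z)" for z
    using rel k(1) by (simp add: add_eq_0_iff)
  obtain P where P: "\<forall>i\<in>?I. hpoly J' (int r - a) (P i)" "\<And>z. (z $ j) ^ r = (\<Sum>i\<in>?I. P i z * B i z)"
    using r unfolding in_ideal_def by blast
  have "in_ideal J' I B a (e + int r) (\<lambda>z. (z $ j) ^ r * Q k z)"
    unfolding in_ideal_def
  proof (intro exI conjI allI ballI)
    \<comment> \<open>Expanding the power of the variable \<open>j\<close> by \<open>P\<close>,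
      multiplying by \<open>Q k\<close> and eliminating the product of \<open>Q k\<close> and
      \<open>B k\<close> by the relation produces these coefficients.\<close>
    show "hpoly J' (e + int r - a) (\<lambda>z. P i z * Q k z - P k z * Q i z)" if "i \<in> I" for i
      using P(1) Q that by (intro hpoly_diff hpoly_mult'[of J' "int r - a" _ e]) auto
    fix z
    have "(z $ j) ^ r * Q k z = (\<Sum>i\<in>I. P i z * B i z) * Q k z + P k z * (Q k z * B k z)"
      unfolding P(2) using k(1) by (simp add: algebra_simps)
    also have "\<dots> = (\<Sum>i\<in>I. (P i z * Q k z - P k z * Q i z) * B i z)"
      unfolding rel' sum_distrib_right sum_distrib_left mult_minus_right add_uminus_conv_diff
        sum_subtractf[symmetric]
      by (intro sum.cong refl) (simp add: algebra_simps)
    finally show "(z $ j) ^ r * Q k z = (\<Sum>i\<in>I. (P i z * Q k z - P k z * Q i z) * B i z)" .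
  qed
  then have "in_ideal J' I B a e (Q k)"
    using zj_power_nonzerodivisor[OF K] Q by blast
  then obtain S where S: "\<forall>i\<in>I. hpoly J' (e - a) (S i)" "\<And>z. Q k z = (\<Sum>i\<in>I. S i z * B i z)"
    unfolding in_ideal_def by blast
  have "hpoly J' e (\<lambda>z. Q i z + S i z * B k z)" if "i \<in> I" for i
    using Q S(1) k(2) that by (intro hpoly_add hpoly_mult'[of J' "e - a" _ a]) auto
  moreover have "(\<Sum>i\<in>I. (Q i z + S i z * B k z) * B i z) = 0" for z
  proof -
    have "(\<Sum>i\<in>I. (Q i z + S i z * B k z) * B i z) = (\<Sum>i\<in>I. Q i z * B i z) + Q k z * B k z"
      unfolding S(2) sum_distrib_right sum.distrib[symmetric]
      by (intro sum.cong refl) (simp add: algebra_simps)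
    then show ?thesis using rel' by simp
  qed
  ultimately obtain C where skew: "skew_on I C" and C: "\<forall>i\<in>I. \<forall>l\<in>I. hpoly J' (e - a) (C i l)"
    and QC: "\<forall>i\<in>I. \<forall>z. Q i z + S i z * B k z = (\<Sum>l\<in>I. C i l z * B l z)"
    using koszul_acyclicD[OF koszul_lift[OF K], of e "\<lambda>i z. Q i z + S i z * B k z"] by blast
  \<comment> \<open>\<open>C\<close> bordered by a row and a column for \<open>k\<close> that hold
    \<open>S\<close> and its negative.\<close>
  define D where "D = (\<lambda>i l. if i = k then (if l = k then \<lambda>_. 0 else S l)
    else (if l = k then \<lambda>z. - S i z else C i l))"
  have ne: "i \<noteq> k" if "i \<in> I" for i using that k(1) by blast
  have "hpoly J' (e - a) (D i l)" if "i \<in> ?I" "l \<in> ?I" for i l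
    using that S(1) C by (auto simp: D_def hpoly_zero hpoly_uminus)
  moreover have "skew_on ?I D"
    unfolding skew_on_def
  proof (intro ballI allI)
    fix i l z assume il: "i \<in> ?I" "l \<in> ?I"
    show "D i l z = - D l i z"
    proof (cases "i = k \<or> l = k")
      case False
      then have "C i l z = - C l i z" using il skew unfolding skew_on_def by blast
      then show ?thesis using False by (simp add: D_def)
    qed (auto simp: D_def)
  qed
  moreover have "Q i z = (\<Sum>l\<in>?I. D i l z * B l z)" if "i \<in> ?I" for i z
  proof (cases "i = k")
    case True
    have "(\<Sum>l\<in>?I. D k l z * B l z) = (\<Sum>l\<in>I. S l z * B l z)"
      using k(1) ne by (simp add: D_def cong: sum.cong)
    then show ?thesis using True S(2) by simp
  next
    case False
    then have i: "i \<in> I" using that by simp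
    have "(\<Sum>l\<in>?I. D i l z * B l z) = - S i z * B k z + (\<Sum>l\<in>I. C i l z * B l z)"
      using k(1) ne False by (simp add: D_def cong: sum.cong)
    also have "(\<Sum>l\<in>I. C i l z * B l z) = Q i z + S i z * B k z" using QC i by simp
    finally show ?thesis by simp
  qed
  ultimately show "\<exists>C. skew_on ?I C \<and> (\<forall>i\<in>?I. \<forall>l\<in>?I. hpoly J' (e - a) (C i l)) \<and>
      (\<forall>i\<in>?I. \<forall>z. Q i z = (\<Sum>l\<in>?I. C i l z * B l z))"
    by (intro exI[of _ D] conjI ballI allI)
qed

text \<open>In degree at least \<open>M + r\<close> a form reduces to one of degree \<open>M\<close>
  times at least the power \<open>r\<close> of the variable \<open>j\<close>, and that power lies in
  the enlarged ideal.\<close>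

lemma primary_insert:
  assumes prim: "primary J I B0 a"
    and r: "in_ideal J' (insert k I) B a (int r) (\<lambda>z. (z $ j) ^ r)"
  shows "primary J' (insert k I) B a"
proof -
  let ?I = "insert k I"
  obtain M where M: "M \<ge> 0" "\<And>d f. d \<ge> M \<Longrightarrow> hpoly J d f \<Longrightarrow> in_ideal J I B0 a d f"
    using prim unfolding primary_def by blast
  show ?thesis
    unfolding primary_def
  proof (intro exI[of _ "M + int r"] conjI allI impI)
    fix d f
    assume d: "M + int r \<le> d" and f: "hpoly J' d f"
    define s where "s = nat (d - M - int r)"
    have d_eq: "d = M + int (s + r)" using d by (simp add: s_def)
    obtain g where g: "hpoly J' M g" "in_ideal J' I B a d (\<lambda>z. f z - (z $ j) ^ (s + r) * g z)"
      using reduce_mod_ideal[of M "s + r" f] M(2) f unfolding d_eq by blast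
    have "hpoly J' (int s + M) (\<lambda>z. (z $ j) ^ s * g z)"
      by (rule hpoly_mult[OF hpoly_coord_power g(1)]) simp
    from in_ideal_mult[OF this r]
    have "in_ideal J' ?I B a d (\<lambda>z. (z $ j) ^ (s + r) * g z)"
      by (simp add: d_eq power_add mult_ac add_ac)
    from in_ideal_add[OF in_ideal_mono[OF g(2), of ?I] this]
    show "in_ideal J' ?I B a d f" by auto
  qed (use M in auto)
qed

end

text \<open>Macaulay's theorem that \<open>n\<close> forms in \<open>n\<close> variables without a common zero form a regular
  sequence, here for forms of equal degree. Passing to a hyperplane, a general combination of the
  forms drops out; \<open>koszul_acyclic_insert\<close> and \<open>primary_insert\<close> put it back.\<close>

theorem zero_free_regular:
  assumes "finite J"
  shows "card I = card J \<Longrightarrow> a > 0 \<Longrightarrow> (\<And>i. i \<in> I \<Longrightarrow> hpoly J a (B i)) \<Longrightarrow> zero_free J I B \<Longrightarrow>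
    koszul_acyclic J I B a \<and> primary J I B a"
  using assms
proof (induction J arbitrary: I B rule: finite_induct)
  case empty
  then have I: "I = {}" by simp
  have "in_ideal {} {} B a d f" if "d \<ge> 1" "hpoly {} d f" for d f
    using hpoly_Euler_decomp[OF that(2)] that(1) unfolding in_ideal_def by auto
  then have "primary {} {} B a" unfolding primary_def by (intro exI[of _ 1]) auto
  moreover have "koszul_acyclic {} {} B a" unfolding koszul_acyclic_def by (simp add: skew_on_def)
  ultimately show ?case using I by simp
next
  case (insert j J)
  let ?J' = "insert j J"
  have cardI: "card I = Suc (card J)" using insert by simp
  obtain k \<mu> where k: "k \<in> I" and \<mu>: "\<And>w. (\<forall>i. i \<notin> J \<longrightarrow> w $ i = 0) \<Longrightarrow>
    (\<forall>i\<in>I - {k}. B i w = \<mu> i * B k w) \<Longrightarrow> B k w = 0"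
    using exists_missed_direction[OF insert.hyps(2) cardI insert.prems(2), of B] insert.prems(3) by blast
  \<comment> \<open>With the entry at \<open>k\<close> reset, \<open>B k\<close> itself is kept
    among the new generators.\<close>
  define \<nu> where "\<nu> = \<mu>(k := 0)"
  define B' where "B' = (\<lambda>i z. B i z - \<nu> i * B k z)"
  have hB': "hpoly ?J' a (B' i)" if "i \<in> I" for i
    unfolding B'_def using insert.prems(3) that k by (intro hpoly_diff hpoly_smult) auto
  have "\<forall>i\<in>I. \<exists>f0 f1. hpoly J a f0 \<and> hpoly ?J' (a - 1) f1 \<and> (\<forall>z. B' i z = f0 z + z $ j * f1 z)"
    using hpoly_split hB' by blast
  from bchoice[OF this] obtain B0 where
    "\<forall>i\<in>I. \<exists>f1. hpoly J a (B0 i) \<and> hpoly ?J' (a - 1) f1 \<and> (\<forall>z. B' i z = B0 i z + z $ j * f1 z)" ..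
  from bchoice[OF this] obtain B1 where
    B1: "\<forall>i\<in>I. hpoly J a (B0 i) \<and> hpoly ?J' (a - 1) (B1 i) \<and> (\<forall>z. B' i z = B0 i z + z $ j * B1 i z)" ..
  have B01: "hpoly J a (B0 i)" "hpoly ?J' (a - 1) (B1 i)" "B' i z = B0 i z + z $ j * B1 i z"
    if "i \<in> I" for i z using bspec[OF B1 that] by simp_all
  have hs: "hyperplane_section J (I - {k}) j B' B0 B1 a"
  proof
    show "j \<notin> J" by (rule insert.hyps(2))
    show "a > 0" by (rule insert.prems(2))
    fix i assume "i \<in> I - {k}"
    then have i: "i \<in> I" by blast
    show "hpoly J a (B0 i)" "hpoly ?J' (a - 1) (B1 i)" by (rule B01[OF i])+
    show "B' i z = B0 i z + z $ j * B1 i z" for z by (rule B01(3)[OF i])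
  qed
  note zj_power_in_ideal = hyperplane_section.zj_power_in_ideal[OF hs]
    and koszul_acyclic_insert = hyperplane_section.koszul_acyclic_insert[OF hs]
    and primary_insert = hyperplane_section.primary_insert[OF hs]
  have zf': "zero_free ?J' I B'"
    unfolding zero_free_def
  proof (intro allI impI)
    fix z assume z: "\<forall>i. i \<notin> ?J' \<longrightarrow> z $ i = 0" "\<forall>i\<in>I. B' i z = 0"
    have k0: "B k z = 0" using bspec[OF z(2) k] by (simp add: B'_def \<nu>_def)
    have "B i z = 0" if "i \<in> I" for i using bspec[OF z(2) that] k0 by (simp add: B'_def)
    then show "z = 0" using insert.prems(4) z(1) unfolding zero_free_def by blast
  qed
  \<comment> \<open>A common zero of the restricted forms is a point of the smaller coordinate space
    where all \<open>B i\<close> are the multiples \<open>\<mu> i\<close> of \<open>B k\<close>;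
    \<open>\<mu>\<close> was chosen so that \<open>B k\<close> vanishes there.\<close>
  have zf0: "zero_free J (I - {k}) B0"
    unfolding zero_free_def
  proof (intro allI impI)
    fix z assume z: "\<forall>i. i \<notin> J \<longrightarrow> z $ i = 0" "\<forall>i\<in>I - {k}. B0 i z = 0"
    have "z $ j = 0" using z(1) insert.hyps(2) by blast
    then have eq: "B' i z = 0" if "i \<in> I - {k}" for i using z(2) B01(3) that by auto
    have "B i z = \<mu> i * B k z" if "i \<in> I - {k}" for i
      using eq[OF that] that by (simp add: B'_def \<nu>_def)
    then have k0: "B k z = 0" using \<mu> z(1) by blast
    have "B i z = 0" if "i \<in> I" for i
      using eq[of i] that k0 by (cases "i = k") (simp_all add: B'_def)
    then show "z = 0" using insert.prems(4) z(1) unfolding zero_free_def by blast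
  qed
  have IH: "koszul_acyclic J (I - {k}) B0 a" "primary J (I - {k}) B0 a"
    using insert.IH[OF _ insert.prems(2) _ zf0] B01(1) cardI k by auto
  have Ik: "insert k (I - {k}) = I" using k by blast
  obtain r where r: "in_ideal ?J' I B' a (int r) (\<lambda>z. (z $ j) ^ r)"
    using zj_power_in_ideal[OF IH(2) hB'[OF k]] zf' unfolding Ik by blast
  have "koszul_acyclic ?J' I B' a"
    using koszul_acyclic_insert[OF IH(1) _ hB'[OF k], of r] r unfolding Ik by simp
  then have K: "koszul_acyclic ?J' I B a"
    by (rule koszul_acyclic_change[of _ _ _ _ k \<nu>]) (use k in \<open>auto simp: B'_def \<nu>_def\<close>)
  have "primary ?J' I B' a"
    using primary_insert[OF IH(2), of k r] r unfolding Ik by simp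
  moreover have "in_ideal ?J' I B a a (B' i)" if "i \<in> I" for i
    unfolding B'_def using that k by (intro in_ideal_diff in_ideal_smult in_ideal_gen) auto
  ultimately have "primary ?J' I B a"
    unfolding primary_def using in_ideal_trans[of ?J' I B' a _ _ B] by blast
  then show ?case using K by blast
qed

section \<open>Low degree relations of a twisted one-form with isolated zeros\<close>

lemma exists_not_in_countable_negligible:
  fixes F :: "'a::euclidean_space set set"
  assumes "countable F" "\<And>S. S \<in> F \<Longrightarrow> negligible S"
  shows "\<exists>x. x \<notin> \<Union>F"
  using negligible_countable_Union[OF assms] non_negligible_UNIV by (metis UNIV_I subsetI top.extremum_uniqueI)

text \<open>The zero set of \<open>A\<close> on the cone is covered by countably many lines, spanned
  by the vectors of \<open>W\<close>; the origin is always a zero and is treated separately.\<close>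

locale isolated_zeros =
  fixes A :: "'i::finite \<Rightarrow> complex ^ 'i \<Rightarrow> complex" and a :: int and W :: "(complex ^ 'i) set"
  assumes a: "a > 0"
    and A: "\<And>i. hpoly UNIV a (A i)"
    and W: "countable W" "0 \<notin> W"
    and zeros: "\<And>z. (\<And>i. A i z = 0) \<Longrightarrow> \<exists>c. \<exists>w\<in>insert 0 W. z = c *s w"
begin

text \<open>Each line through a \<open>w\<close> excludes only a negligible set of hyperplanes,
  those that contain it, and there are countably many lines.\<close>

lemma exists_avoiding_hyperplane:
  "\<exists>m::complex ^ 'i. m \<noteq> 0 \<and> (\<forall>w\<in>W. (\<Sum>i\<in>UNIV. m $ i * w $ i) \<noteq> 0)"
proof -
  let ?F = "insert {0} ((\<lambda>w. {m. (\<Sum>i\<in>UNIV. w $ i * m $ i) = 0}) ` W)"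
  have "\<exists>m. m \<notin> \<Union>?F"
  proof (rule exists_not_in_countable_negligible)
    show "countable ?F" using W by simp
    fix S assume "S \<in> ?F"
    then have "S = {0} \<or> (\<exists>w\<in>W. S = {m. (\<Sum>i\<in>UNIV. w $ i * m $ i) = 0})" by blast
    then show "negligible S"
    proof (elim disjE bexE)
      fix w assume w: "w \<in> W" "S = {m. (\<Sum>i\<in>UNIV. w $ i * m $ i) = 0}"
      then have "w \<noteq> 0" using W(2) by blast
      then show ?thesis unfolding w(2) by (rule negligible_complex_hyperplane)
    qed simp
  qed
  then show ?thesis by (auto simp: mult.commute)
qed

definition hyp :: "complex ^ 'i"
  where "hyp = (SOME m. m \<noteq> 0 \<and> (\<forall>w\<in>W. (\<Sum>i\<in>UNIV. m $ i * w $ i) \<noteq> 0))"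

lemma hyp: "hyp \<noteq> 0" "w \<in> W \<Longrightarrow> (\<Sum>i\<in>UNIV. hyp $ i * w $ i) \<noteq> 0"
  using someI_ex[OF exists_avoiding_hyperplane] unfolding hyp_def by blast+

text \<open>The values of \<open>A\<close> on the chosen hyperplane. Vectors outside this negligible
  set are the general ones.\<close>

definition bad :: "(complex ^ 'i) set"
  where "bad = (\<lambda>z. \<chi> i. A i z) ` {z. (\<Sum>i\<in>UNIV. hyp $ i * z $ i) = 0}"

lemma negligible_bad: "negligible bad"
  unfolding bad_def
proof (rule negligible_differentiable_image_negligible[OF order_refl])
  show "negligible {z. (\<Sum>i\<in>UNIV. hyp $ i * z $ i) = 0}"
    by (rule negligible_complex_hyperplane[OF hyp(1)])
  show "(\<lambda>z. \<chi> i. A i z) differentiable_on {z. (\<Sum>i\<in>UNIV. hyp $ i * z $ i) = 0}"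
    by (rule differentiable_on_vec_lambda[OF hpoly_differentiable[OF A]])
qed

lemma zero_in_bad: "0 \<in> bad"
proof -
  have "0 = (\<chi> i. A i 0)" using hpoly_at_0[OF A a] by (simp add: vec_eq_iff)
  then show ?thesis unfolding bad_def by (intro image_eqI[of _ _ 0]) auto
qed

text \<open>A value of \<open>A\<close> that is a nonzero multiple of \<open>l\<close> becomes
  \<open>l\<close> after rescaling the argument, which \<open>bad\<close> excludes; where
  \<open>A\<close> vanishes, the argument lies on one of the lines that the hyperplane
  avoids.\<close>

lemma not_proportional:
  assumes l: "l \<notin> bad" and z: "(\<Sum>i\<in>UNIV. hyp $ i * z $ i) = 0" and s: "\<And>i. A i z = s * l $ i"
  shows "z = 0"
proof (cases "s = 0")
  case True
  then have "A i z = 0" for i using s by simp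
  then obtain c w where w: "w \<in> insert 0 W" "z = c *s w" using zeros[of z] by blast
  show ?thesis
  proof (cases "w = 0")
    case False
    have "0 = c * (\<Sum>i\<in>UNIV. hyp $ i * w $ i)"
      using z unfolding w(2) by (simp add: sum_distrib_left mult.left_commute)
    then show ?thesis using hyp(2)[of w] w False by auto
  qed (use w in simp)
next
  case False
  have "card {t. t ^ nat a = inverse s} = nat a" using False a by (intro card_nth_roots) auto
  then obtain t where t: "t ^ nat a = inverse s" using a by fastforce
  have "A i (t *s z) = l $ i" for i using hpoly_scale[OF A, of i t z] a s t False by simp
  then have "l = (\<chi> i. A i (t *s z))" by (simp add: vec_eq_iff)
  moreover have "(\<Sum>i\<in>UNIV. hyp $ i * (t *s z) $ i) = t * (\<Sum>i\<in>UNIV. hyp $ i * z $ i)"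
    by (simp add: sum_distrib_left mult.left_commute)
  ultimately have "l \<in> bad" using z unfolding bad_def by auto
  then show ?thesis using l by blast
qed

text \<open>The condition on \<open>l\<close> eliminates one entry of \<open>V\<close>, leaving a
  relation between one form fewer. By \<open>not_proportional\<close> these forms have no common
  zero on the hyperplane, where they are as many as the variables. \<open>zero_free_regular\<close>
  applies there, and \<open>koszul_lift\<close> returns to the whole space.\<close>

lemma tangential_relation:
  assumes l: "l \<notin> bad" and V: "\<And>i. hpoly UNIV k (V i)"
    and rel: "\<And>z. (\<Sum>i\<in>UNIV. V i z * A i z) = 0"
    and tan: "\<And>z. (\<Sum>i\<in>UNIV. l $ i * V i z) = 0"
  shows "in_ideal UNIV UNIV A a k (V i)"
proof -
  have "l \<noteq> 0" using l zero_in_bad by blast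
  then obtain i0 where i0: "l $ i0 \<noteq> 0" by (auto simp: vec_eq_iff)
  obtain i1 where i1: "hyp $ i1 \<noteq> 0" using hyp(1) by (auto simp: vec_eq_iff)
  define I J where "I = UNIV - {i0}" and "J = UNIV - {i1}"
  have UN: "insert i1 J = UNIV" "insert i0 I = UNIV" "i0 \<notin> I" by (auto simp: I_def J_def)
  \<comment> \<open>The combinations of the \<open>A i\<close> that vanish where \<open>A\<close> is
    proportional to \<open>l\<close>; the one for \<open>i0\<close> is zero and is left out.\<close>
  define B where "B = (\<lambda>i z. A i z - l $ i / l $ i0 * A i0 z)"
  have hB: "hpoly UNIV a (B i)" for i unfolding B_def by (intro hpoly_diff hpoly_smult A)
  have sumUN: "(\<Sum>i\<in>UNIV. f i) = f i0 + (\<Sum>i\<in>I. f i)" for f :: "'i \<Rightarrow> complex"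
    using sum.insert[of I i0 f] UN by simp
  have V0: "V i0 z = - (\<Sum>i\<in>I. l $ i / l $ i0 * V i z)" for z
  proof -
    have "l $ i0 * V i0 z = - (\<Sum>i\<in>I. l $ i * V i z)" using tan[of z] sumUN by (simp add: add_eq_0_iff2)
    then have "V i0 z = - (\<Sum>i\<in>I. l $ i * V i z) / l $ i0" using i0 by (simp add: field_simps)
    then show ?thesis by (simp add: sum_divide_distrib)
  qed
  have relB: "(\<Sum>i\<in>I. V i z * B i z) = 0" for z
  proof -
    have "(\<Sum>i\<in>I. V i z * B i z) = (\<Sum>i\<in>I. V i z * A i z) - (\<Sum>i\<in>I. l $ i / l $ i0 * V i z) * A i0 z"
      unfolding sum_distrib_right sum_subtractf[symmetric]
      by (intro sum.cong refl) (simp add: B_def algebra_simps)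
    also have "\<dots> = (\<Sum>i\<in>I. V i z * A i z) + V i0 z * A i0 z" unfolding V0 by simp
    also have "\<dots> = 0" using rel[of z] unfolding sumUN by (simp add: add.commute)
    finally show ?thesis .
  qed
  \<comment> \<open>A linear change of coordinates with inverse \<open>T'\<close> that turns the
    chosen hyperplane into the one where the coordinate \<open>i1\<close> vanishes.\<close>
  define T where "T = (\<lambda>z::complex ^ 'i. \<chi> i. if i = i1 then (z $ i1 - (\<Sum>j\<in>J. hyp $ j * z $ j)) / hyp $ i1 else z $ i)"
  define T' where "T' = (\<lambda>z::complex ^ 'i. \<chi> i. if i = i1 then (\<Sum>j\<in>UNIV. hyp $ j * z $ j) else z $ i)"
  have sumJ: "(\<Sum>j\<in>UNIV. f j) = f i1 + (\<Sum>j\<in>J. f j)" for f :: "'i \<Rightarrow> complex"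
    using sum.insert[of J i1 f] UN by (simp add: J_def)
  have TJ: "(\<Sum>j\<in>J. hyp $ j * T z $ j) = (\<Sum>j\<in>J. hyp $ j * z $ j)" for z
    by (intro sum.cong refl) (auto simp: T_def J_def)
  have T'J: "(\<Sum>j\<in>J. hyp $ j * T' z $ j) = (\<Sum>j\<in>J. hyp $ j * z $ j)" for z
    by (intro sum.cong refl) (auto simp: T'_def J_def)
  have hypT: "(\<Sum>j\<in>UNIV. hyp $ j * T z $ j) = z $ i1" for z
    unfolding sumJ TJ using i1 by (simp add: T_def)
  have TT': "T (T' z) = z" for z
  proof -
    have "T (T' z) $ i = z $ i" for i
    proof (cases "i = i1")
      case True
      have "T (T' z) $ i1 = (T' z $ i1 - (\<Sum>j\<in>J. hyp $ j * T' z $ j)) / hyp $ i1" by (simp add: T_def)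
      also have "T' z $ i1 = hyp $ i1 * z $ i1 + (\<Sum>j\<in>J. hyp $ j * z $ j)" by (simp add: T'_def sumJ)
      finally show ?thesis using True i1 T'J by simp
    qed (simp add: T_def T'_def)
    then show ?thesis by (simp add: vec_eq_iff)
  qed
  have hT: "hpoly UNIV 1 (\<lambda>z. T z $ i)" for i
  proof (cases "i = i1")
    case True
    have "hpoly UNIV 1 (\<lambda>z. inverse (hyp $ i1) * (z $ i1 - (\<Sum>j\<in>J. hyp $ j * z $ j)))"
      by (intro hpoly_smult hpoly_diff hpoly_sum hpoly_coord1) auto
    then show ?thesis using True by (simp add: T_def field_simps)
  qed (simp add: T_def hpoly_coord1)
  have hT': "hpoly UNIV 1 (\<lambda>z. T' z $ i)" for i
  proof (cases "i = i1")
    case True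
    have "hpoly UNIV 1 (\<lambda>z. \<Sum>j\<in>UNIV. hyp $ j * z $ j)"
      by (intro hpoly_smult hpoly_sum hpoly_coord1) auto
    then show ?thesis using True by (simp add: T'_def)
  qed (simp add: T'_def hpoly_coord1)
  define BT where "BT = (\<lambda>i z. B i (T z))"
  have hBT: "hpoly (insert i1 J) a (BT i)" for i
    unfolding BT_def UN by (rule hpoly_linear_image[OF hT hB])
  have "\<forall>i\<in>I. \<exists>f0 f1. hpoly J a f0 \<and> hpoly (insert i1 J) (a - 1) f1 \<and> (\<forall>z. BT i z = f0 z + z $ i1 * f1 z)"
    using hpoly_split hBT by blast
  from bchoice[OF this] obtain B0 where
    "\<forall>i\<in>I. \<exists>f1. hpoly J a (B0 i) \<and> hpoly (insert i1 J) (a - 1) f1 \<and> (\<forall>z. BT i z = B0 i z + z $ i1 * f1 z)" ..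
  from bchoice[OF this] obtain B1 where
    B1: "\<forall>i\<in>I. hpoly J a (B0 i) \<and> hpoly (insert i1 J) (a - 1) (B1 i) \<and> (\<forall>z. BT i z = B0 i z + z $ i1 * B1 i z)" ..
  have B01: "hpoly J a (B0 i)" "hpoly (insert i1 J) (a - 1) (B1 i)" "BT i z = B0 i z + z $ i1 * B1 i z"
    if "i \<in> I" for i z using bspec[OF B1 that] by simp_all
  have hs: "hyperplane_section J I i1 BT B0 B1 a"
    by unfold_locales (use a B01 in \<open>auto simp: J_def\<close>)
  have "zero_free J I B0"
    unfolding zero_free_def
  proof (intro allI impI)
    fix z assume z: "\<forall>i. i \<notin> J \<longrightarrow> z $ i = 0" "\<forall>i\<in>I. B0 i z = 0"
    have z1: "z $ i1 = 0" using z(1) by (simp add: J_def)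
    \<comment> \<open>The vanishing of the combinations means that \<open>A\<close> is proportional
      to \<open>l\<close> at the corresponding point of the hyperplane.\<close>
    have par: "A i (T z) = A i0 (T z) / l $ i0 * l $ i" for i
    proof (cases "i = i0")
      case False
      then have "i \<in> I" by (simp add: I_def)
      then have "BT i z = 0" using z(2) B01(3)[of i z] z1 by simp
      then show ?thesis by (simp add: BT_def B_def field_simps)
    qed (use i0 in simp)
    have "T z = 0" by (rule not_proportional[OF l _ par]) (simp add: hypT z1)
    then have "z $ i = 0" for i using z1 by (cases "i = i1") (auto simp: T_def vec_eq_iff split: if_splits)
    then show "z = 0" by (simp add: vec_eq_iff)
  qed
  moreover have "card I = card J" by (simp add: I_def J_def)
  ultimately have "koszul_acyclic J I B0 a"
    using zero_free_regular[of J I a B0] a B01(1) by simp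
  then have K: "koszul_acyclic UNIV I BT a"
    using hyperplane_section.koszul_lift[OF hs] UN by simp
  obtain C where C: "\<forall>i\<in>I. \<forall>l\<in>I. hpoly UNIV (k - a) (C i l)"
    "\<forall>i\<in>I. \<forall>z. V i (T z) = (\<Sum>l\<in>I. C i l z * BT l z)"
    using koszul_acyclicD[OF K, of k "\<lambda>i z. V i (T z)"] relB hpoly_linear_image[OF hT V]
    unfolding BT_def by blast
  have inB: "in_ideal UNIV UNIV A a a (B i)" for i
    unfolding B_def by (intro in_ideal_diff in_ideal_smult in_ideal_gen) auto
  have inI: "in_ideal UNIV UNIV A a k (V i)" if "i \<in> I" for i
  proof -
    have "hpoly UNIV (k - a) (\<lambda>z. C i l (T' z))" if "l \<in> I" for l
      using C(1) \<open>i \<in> I\<close> that hpoly_linear_image[OF hT'] by blast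
    then have "in_ideal UNIV UNIV A a (a + (k - a)) (\<lambda>z. \<Sum>l\<in>I. C i l (T' z) * B l z)"
      by (intro in_ideal_sum in_ideal_mult inB)
    moreover have "(\<lambda>z. \<Sum>l\<in>I. C i l (T' z) * B l z) = V i"
    proof
      fix z
      have "V i (T (T' z)) = (\<Sum>l\<in>I. C i l (T' z) * BT l (T' z))" using C(2) that by blast
      then show "(\<Sum>l\<in>I. C i l (T' z) * B l z) = V i z" by (simp add: BT_def TT')
    qed
    ultimately show ?thesis by simp
  qed
  show ?thesis
  proof (cases "i = i0")
    case True
    have "in_ideal UNIV UNIV A a k (\<lambda>z. (-1) * (\<Sum>i\<in>I. l $ i / l $ i0 * V i z))"
      by (intro in_ideal_smult in_ideal_sum inI)
    moreover have "V i0 = (\<lambda>z. (-1) * (\<Sum>i\<in>I. l $ i / l $ i0 * V i z))" using V0 by auto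
    ultimately show ?thesis unfolding True by simp
  qed (use inI in \<open>simp add: I_def\<close>)
qed

text \<open>The coefficients have degree \<open>k - a\<close>: below 0 they vanish, in degree 0 they
  are constants.\<close>

lemma in_ideal_low_degree:
  assumes "in_ideal UNIV UNIV A a k f"
  shows "k < a \<Longrightarrow> f z = 0" and "k \<le> a \<Longrightarrow> \<exists>c. \<forall>z. f z = (\<Sum>i\<in>UNIV. c i * A i z)"
proof -
  obtain Q where Q: "\<And>i. hpoly UNIV (k - a) (Q i)" "\<And>z. f z = (\<Sum>i\<in>UNIV. Q i z * A i z)"
    using assms unfolding in_ideal_def by blast
  show "f z = 0" if "k < a" 
  proof -
    have "Q i z = 0" for i using hpoly_neg[OF Q(1)] that by simp
    then show ?thesis using Q(2) by simp
  qed
  assume "k \<le> a"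
  have "\<exists>c. \<forall>z. Q i z = c" for i
    using hpoly_nonpos[OF Q(1), of i] \<open>k \<le> a\<close> by (cases "k = a") auto
  then obtain c where "\<And>i z. Q i z = c i" by metis
  then show "\<exists>c. \<forall>z. f z = (\<Sum>i\<in>UNIV. c i * A i z)" using Q(2) by auto
qed

text \<open>Linear relations are multiples of the radial one; only this consequence at the basis
  vectors is needed. A combination of \<open>Y\<close> with the radial relation is tangential for
  \<open>m\<close> and has degree 2, so it vanishes because \<open>a \<ge> 3\<close>.\<close>

lemma linear_relation_at_axis:
  assumes a3: "a \<ge> 3" and zA: "\<And>z. (\<Sum>i\<in>UNIV. z $ i * A i z) = 0"
    and Y: "\<And>l. hpoly UNIV 1 (Y l)" and rel: "\<And>z. (\<Sum>l\<in>UNIV. Y l z * A l z) = 0" and "i \<noteq> l"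
  shows "Y l (axis i 1) = 0"
proof -
  let ?F = "{bad, {m. (\<Sum>j\<in>UNIV. axis i 1 $ j * m $ j) = 0}}"
  have "\<exists>m. m \<notin> \<Union>?F"
    by (rule exists_not_in_countable_negligible)
      (use negligible_bad negligible_complex_hyperplane[of "axis i 1"] in auto)
  moreover have ax: "(\<Sum>j\<in>UNIV. axis i 1 $ j * m $ j) = m $ i" for m :: "complex ^ 'i"
  proof -
    have "(\<Sum>j\<in>UNIV. axis i 1 $ j * m $ j) = (\<Sum>j\<in>UNIV. if j = i then m $ i else 0)"
      by (intro sum.cong) (auto simp: axis_def)
    then show ?thesis by simp
  qed
  ultimately obtain m where m: "m \<notin> bad" "m $ i \<noteq> 0" by auto
  define mz where "mz = (\<lambda>z::complex ^ 'i. \<Sum>j\<in>UNIV. m $ j * z $ j)"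
  define mY where "mY = (\<lambda>z. \<Sum>j\<in>UNIV. m $ j * Y j z)"
  \<comment> \<open>The combination of \<open>Y\<close> and the radial relation that pairs to zero
    with \<open>m\<close>.\<close>
  define V where "V = (\<lambda>i z. mz z * Y i z - mY z * z $ i)"
  have "hpoly UNIV 1 mz" unfolding mz_def by (intro hpoly_sum hpoly_smult hpoly_coord1) auto
  moreover have "hpoly UNIV 1 mY" unfolding mY_def by (intro hpoly_sum hpoly_smult Y)
  ultimately have hV: "hpoly UNIV 2 (V i)" for i
    unfolding V_def by (intro hpoly_diff hpoly_mult'[of UNIV 1 _ 1] Y hpoly_coord1) auto
  have 1: "(\<Sum>i\<in>UNIV. V i z * A i z) = 0" for z
  proof -
    have "(\<Sum>i\<in>UNIV. V i z * A i z) = mz z * (\<Sum>i\<in>UNIV. Y i z * A i z) - mY z * (\<Sum>i\<in>UNIV. z $ i * A i z)"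
      unfolding sum_distrib_left sum_subtractf[symmetric]
      by (intro sum.cong refl) (simp add: V_def algebra_simps)
    then show ?thesis using rel zA by simp
  qed
  have 2: "(\<Sum>i\<in>UNIV. m $ i * V i z) = 0" for z
  proof -
    have "(\<Sum>i\<in>UNIV. m $ i * V i z) =
      mz z * (\<Sum>i\<in>UNIV. m $ i * Y i z) - mY z * (\<Sum>i\<in>UNIV. m $ i * z $ i)"
      unfolding sum_distrib_left sum_subtractf[symmetric]
      by (intro sum.cong refl) (simp add: V_def algebra_simps)
    then show ?thesis by (simp add: mz_def mY_def)
  qed
  have "V l (axis i 1) = 0"
    by (rule in_ideal_low_degree(1)[OF tangential_relation[OF m(1) hV 1 2]]) (use a3 in simp)
  moreover have "mz (axis i 1) = m $ i" using ax[of m] unfolding mz_def by (simp add: mult.commute)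
  ultimately show ?thesis using m(2) \<open>i \<noteq> l\<close> by (simp add: V_def axis_def)
qed

text \<open>For general \<open>m\<close> the contraction of \<open>P\<close> with \<open>m\<close>
  is a relation between the \<open>A i\<close> of degree at most \<open>a\<close>, and it is
  tangential for the same \<open>m\<close> because \<open>P\<close> is skew.\<close>

theorem bivector_eq_0:
  assumes a3: "a \<ge> 3" and card: "CARD('i) \<ge> 4" and zA: "\<And>z. (\<Sum>i\<in>UNIV. z $ i * A i z) = 0"
    and P: "\<And>i j. hpoly UNIV b (P i j)" and "b \<le> a"
    and skew: "\<And>i j z. P i j z = - P j i z"
    and rel: "\<And>i z. (\<Sum>j\<in>UNIV. P i j z * A j z) = 0"
    and radial: "\<And>i j k z. i \<noteq> j \<Longrightarrow> j \<noteq> k \<Longrightarrow> k \<noteq> i \<Longrightarrow>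
      z $ i * P j k z + z $ j * P k i z + z $ k * P i j z = 0"
  shows "P j k z = 0"
proof -
  have good: "\<exists>c. \<forall>z. (\<Sum>i\<in>UNIV. m $ i * P i j z) = (\<Sum>l\<in>UNIV. c l * A l z)" if m: "m \<notin> bad" for m j
  proof -
    define V where "V = (\<lambda>j z. \<Sum>i\<in>UNIV. m $ i * P i j z)"
    have hV: "hpoly UNIV b (V j)" for j unfolding V_def by (intro hpoly_sum hpoly_smult P)
    have 1: "(\<Sum>j\<in>UNIV. V j z * A j z) = 0" for z
    proof -
      have "(\<Sum>j\<in>UNIV. V j z * A j z) = (\<Sum>j\<in>UNIV. \<Sum>i\<in>UNIV. m $ i * (P i j z * A j z))"
        by (simp add: V_def sum_distrib_right mult.assoc)
      also have "\<dots> = (\<Sum>i\<in>UNIV. m $ i * (\<Sum>j\<in>UNIV. P i j z * A j z))"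
        by (subst sum.swap) (simp add: sum_distrib_left)
      finally show ?thesis using rel by simp
    qed
    have 2: "(\<Sum>j\<in>UNIV. m $ j * V j z) = 0" for z
    proof -
      have "skew_on UNIV P" unfolding skew_on_def using skew by blast
      from skew_sum_zero[OF this, where z = z and b = "\<lambda>i. m $ i"]
      have "(\<Sum>i\<in>UNIV. \<Sum>l\<in>UNIV. P i l z * m $ l * m $ i) = 0" by (simp add: sum_distrib_right)
      then have "(\<Sum>l\<in>UNIV. \<Sum>i\<in>UNIV. P i l z * m $ l * m $ i) = 0" by (subst sum.swap)
      then show ?thesis by (simp add: V_def sum_distrib_left mult_ac)
    qed
    show ?thesis
      using in_ideal_low_degree(2)[OF tangential_relation[OF m hV 1 2] \<open>b \<le> a\<close>] unfolding V_def .
  qed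
  have "\<exists>c. \<forall>z. P i j z = (\<Sum>l\<in>UNIV. c l * A l z)" for i j
  proof -
    \<comment> \<open>A basis vector need not be general, but it is the difference of two general
      vectors.\<close>
    let ?F = "{bad, (+) (- axis i 1) ` bad}"
    have "negligible ((+) (- axis i 1) ` bad)" by (rule negligible_translation[OF negligible_bad])
    then have "\<exists>m. m \<notin> \<Union>?F"
      using negligible_bad by (intro exists_not_in_countable_negligible) (auto simp del: add_uminus_conv_diff uminus_add_conv_diff)
    then obtain m where m: "m \<notin> bad" "m \<notin> (+) (- axis i 1) ` bad" by auto
    have m': "axis i 1 + m \<notin> bad"
    proof
      assume "axis i 1 + m \<in> bad"
      then have "- axis i 1 + (axis i 1 + m) \<in> (+) (- axis i 1) ` bad" by (rule imageI)
      then show False using m(2) by simp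
    qed
    obtain c c' where c: "\<And>z. (\<Sum>l\<in>UNIV. m $ l * P l j z) = (\<Sum>l\<in>UNIV. c l * A l z)"
      "\<And>z. (\<Sum>l\<in>UNIV. (axis i 1 + m) $ l * P l j z) = (\<Sum>l\<in>UNIV. c' l * A l z)"
      using good[OF m(1), of j] good[OF m', of j] by blast
    have "P i j z = (\<Sum>l\<in>UNIV. (c' l - c l) * A l z)" for z
    proof -
      have "(\<Sum>l\<in>UNIV. axis i 1 $ l * P l j z) = (\<Sum>l\<in>UNIV. if l = i then P i j z else 0)"
        by (intro sum.cong) (auto simp: axis_def)
      then have "P i j z = (\<Sum>l\<in>UNIV. axis i 1 $ l * P l j z)" by simp
      also have "\<dots> = (\<Sum>l\<in>UNIV. (axis i 1 + m) $ l * P l j z) - (\<Sum>l\<in>UNIV. m $ l * P l j z)"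
        unfolding sum_subtractf[symmetric] by (intro sum.cong refl) (simp add: algebra_simps)
      also have "\<dots> = (\<Sum>l\<in>UNIV. (c' l - c l) * A l z)"
        unfolding c sum_subtractf[symmetric] by (intro sum.cong refl) (simp add: algebra_simps)
      finally show ?thesis .
    qed
    then show ?thesis by (intro exI[of _ "\<lambda>l. c' l - c l"]) blast
  qed
  then obtain c where c: "\<And>i j z. P i j z = (\<Sum>l\<in>UNIV. c i j l * A l z)" by metis
  have c0: "c j k l = 0" if jk: "j \<noteq> k" for j k l
  proof -
    \<comment> \<open>Four coordinates leave an index \<open>i\<close> different from all
      three.\<close>
    have "card {j, k, l} \<le> 3" by (simp add: card_insert_if)
    then have "card {j, k, l} < CARD('i)" using card by simp
    then have "{j, k, l} \<noteq> UNIV" by (metis less_irrefl)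
    then obtain i where i: "i \<noteq> j" "i \<noteq> k" "i \<noteq> l" by auto
    \<comment> \<open>Expressed through the constants \<open>c\<close>, the identity
      \<open>radial\<close> is a linear relation between the \<open>A l\<close>. At the basis vector
      \<open>i\<close> only the constant \<open>c j k l\<close> survives in its coefficient.\<close>
    define Y where "Y = (\<lambda>l z. c j k l * z $ i + c k i l * z $ j + c i j l * z $ k)"
    have "hpoly UNIV 1 (Y l)" for l
      unfolding Y_def by (intro hpoly_add hpoly_smult hpoly_coord1) auto
    moreover have "(\<Sum>l\<in>UNIV. Y l z * A l z) = 0" for z
    proof -
      have "(\<Sum>l\<in>UNIV. Y l z * A l z) = z $ i * P j k z + z $ j * P k i z + z $ k * P i j z"
        unfolding c sum_distrib_left sum.distrib[symmetric]
        by (intro sum.cong refl) (simp add: Y_def algebra_simps)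
      then show ?thesis using radial[of i j k z] i jk by simp
    qed
    ultimately have "Y l (axis i 1) = 0" by (rule linear_relation_at_axis[OF a3 zA _ _ i(3)])
    then show ?thesis using i by (simp add: Y_def axis_def)
  qed
  show ?thesis
  proof (cases "j = k")
    case True
    then show ?thesis using skew[of j j z] by simp
  next
    case False
    then show ?thesis using c c0 by simp
  qed
qed

end

section \<open>Holomorphic functions of several variables\<close>

abbreviation dirder :: "(complex ^ 'i::finite \<Rightarrow> complex) \<Rightarrow> complex ^ 'i \<Rightarrow> complex ^ 'i \<Rightarrow> complex"
  where "dirder f z v \<equiv> frechet_derivative f (at z) v"

lemma holo_on_derivative:
  assumes "holo_on S f" "z \<in> S"
  shows "(f has_derivative dirder f z) (at z)" and "dirder f z (c *s v) = c * dirder f z v"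
proof -
  obtain f' where f': "(f has_derivative f') (at z)" "\<forall>c v. f' (c *s v) = c * f' v"
    using assms unfolding holo_on_def by blast
  then have "f' = dirder f z" using frechet_derivative_at by blast
  then show "(f has_derivative dirder f z) (at z)" "dirder f z (c *s v) = c * dirder f z v"
    using f' by auto
qed

lemma dirder_expand:
  assumes "holo_on S f" "z \<in> S"
  shows "dirder f z v = (\<Sum>i\<in>UNIV. v $ i * dirder f z (axis i 1))"
proof -
  have "v = (\<Sum>i\<in>UNIV. v $ i *s axis i 1)" by (simp add: basis_expansion)
  then have "dirder f z v = dirder f z (\<Sum>i\<in>UNIV. v $ i *s axis i 1)" by simp
  also have "\<dots> = (\<Sum>i\<in>UNIV. dirder f z (v $ i *s axis i 1))"
    using has_derivative_linear[OF holo_on_derivative(1)[OF assms]] by (rule linear_sum)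
  finally show ?thesis using holo_on_derivative(2)[OF assms] by simp
qed

lemma holo_on_cong_local:
  assumes "\<And>z. z \<in> S \<Longrightarrow> \<exists>T g. open T \<and> z \<in> T \<and> holo_on T g \<and> (\<forall>w\<in>T. g w = f w)"
  shows "holo_on S f"
  unfolding holo_on_def
proof
  fix z assume "z \<in> S"
  from assms[OF this] obtain T g where T: "open T" "z \<in> T" "holo_on T g" "\<forall>w\<in>T. g w = f w"
    by (elim exE conjE)
  from T(2,3) obtain g' where g': "(g has_derivative g') (at z)" "\<forall>c v. g' (c *s v) = c * g' v"
    unfolding holo_on_def by blast
  have "(f has_derivative g') (at z)"
    by (rule has_derivative_transform_within_open[OF g'(1) T(1,2)]) (use T(4) in blast)
  then show "\<exists>f'. (f has_derivative f') (at z) \<and> (\<forall>c v. f' (c *s v) = c * f' v)"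
    using g'(2) by blast
qed

lemma holo_on_subset: "holo_on S f \<Longrightarrow> T \<subseteq> S \<Longrightarrow> holo_on T f"
  unfolding holo_on_def by blast

lemma holo_on_cong: "open S \<Longrightarrow> holo_on S g \<Longrightarrow> (\<And>z. z \<in> S \<Longrightarrow> g z = f z) \<Longrightarrow> holo_on S f"
  by (rule holo_on_cong_local) blast

lemma holo_on_const: "holo_on S (\<lambda>_. c)"
  unfolding holo_on_def by (auto intro!: exI[of _ "\<lambda>_. 0"])

lemma holo_on_coord: "holo_on S (\<lambda>z. z $ i)"
  unfolding holo_on_def
  by (auto intro!: exI[of _ "\<lambda>z. z $ i"] bounded_linear_imp_has_derivative bounded_linear_vec_nth)

lemma holo_on_add: "holo_on S f \<Longrightarrow> holo_on S g \<Longrightarrow> holo_on S (\<lambda>z. f z + g z)"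
  unfolding holo_on_def
proof
  fix z assume "\<forall>z\<in>S. \<exists>f'. (f has_derivative f') (at z) \<and> (\<forall>c v. f' (c *s v) = c * f' v)"
    "\<forall>z\<in>S. \<exists>f'. (g has_derivative f') (at z) \<and> (\<forall>c v. f' (c *s v) = c * f' v)" "z \<in> S"
  then obtain f' g' where "(f has_derivative f') (at z)" "\<forall>c v. f' (c *s v) = c * f' v"
    "(g has_derivative g') (at z)" "\<forall>c v. g' (c *s v) = c * g' v" by blast
  then show "\<exists>f'. ((\<lambda>z. f z + g z) has_derivative f') (at z) \<and> (\<forall>c v. f' (c *s v) = c * f' v)"
    by (intro exI[of _ "\<lambda>v. f' v + g' v"]) (auto intro: has_derivative_add simp: distrib_left)
qed

lemma holo_on_mult: "holo_on S f \<Longrightarrow> holo_on S g \<Longrightarrow> holo_on S (\<lambda>z. f z * g z)"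
  unfolding holo_on_def
proof
  fix z assume "\<forall>z\<in>S. \<exists>f'. (f has_derivative f') (at z) \<and> (\<forall>c v. f' (c *s v) = c * f' v)"
    "\<forall>z\<in>S. \<exists>f'. (g has_derivative f') (at z) \<and> (\<forall>c v. f' (c *s v) = c * f' v)" "z \<in> S"
  then obtain f' g' where "(f has_derivative f') (at z)" "\<forall>c v. f' (c *s v) = c * f' v"
    "(g has_derivative g') (at z)" "\<forall>c v. g' (c *s v) = c * g' v" by blast
  then show "\<exists>f'. ((\<lambda>z. f z * g z) has_derivative f') (at z) \<and> (\<forall>c v. f' (c *s v) = c * f' v)"
    by (intro exI[of _ "\<lambda>v. f z * g' v + f' v * g z"])
      (auto intro!: has_derivative_mult simp: algebra_simps)
qed

lemma holo_on_sum: "(\<And>x. x \<in> X \<Longrightarrow> holo_on S (f x)) \<Longrightarrow> holo_on S (\<lambda>z. \<Sum>x\<in>X. f x z)"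
  by (induction X rule: infinite_finite_induct) (auto intro: holo_on_const holo_on_add)

lemma holo_on_compose_field:
  assumes "holo_on S f" "\<And>z. z \<in> S \<Longrightarrow> \<exists>h'. (h has_field_derivative h') (at (f z))"
  shows "holo_on S (\<lambda>z. h (f z))"
  unfolding holo_on_def
proof
  fix z assume z: "z \<in> S"
  then obtain f' where f': "(f has_derivative f') (at z)" "\<forall>c v. f' (c *s v) = c * f' v"
    using assms(1) unfolding holo_on_def by blast
  obtain h' where "(h has_derivative (*) h') (at (f z))"
    using assms(2)[OF z] unfolding has_field_derivative_def by blast
  from has_derivative_compose[OF f'(1) this]
  show "\<exists>f'. ((\<lambda>z. h (f z)) has_derivative f') (at z) \<and> (\<forall>c v. f' (c *s v) = c * f' v)"
    using f'(2) by (intro exI[of _ "\<lambda>v. h' * f' v"]) (auto simp: o_def)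
qed

lemma holo_on_inverse:
  assumes "holo_on S f" "\<And>z. z \<in> S \<Longrightarrow> f z \<noteq> 0"
  shows "holo_on S (\<lambda>z. inverse (f z))"
  using holo_on_compose_field[OF assms(1), of inverse] assms(2) DERIV_inverse by blast

lemma holo_on_power: "holo_on S f \<Longrightarrow> holo_on S (\<lambda>z. f z ^ k)"
  by (induction k) (auto intro: holo_on_const holo_on_mult)

lemma holo_on_power_int:
  assumes "holo_on S f" "\<And>z. z \<in> S \<Longrightarrow> f z \<noteq> 0"
  shows "holo_on S (\<lambda>z. f z powi k)"
proof (cases "k \<ge> 0")
  case True
  then show ?thesis using holo_on_power[OF assms(1)] by (simp add: power_int_def)
next
  case False
  then show ?thesis using holo_on_inverse[OF assms] holo_on_power
    by (simp add: power_int_def power_inverse[symmetric])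
qed

lemma holo_on_hpoly: "hpoly J d f \<Longrightarrow> holo_on S f"
  by (induction rule: hpoly.induct) (auto intro: holo_on_const holo_on_add holo_on_mult holo_on_coord)

lemma holo_on_continuous: "holo_on S f \<Longrightarrow> continuous_on S f"
  by (meson continuous_at_imp_continuous_on has_derivative_continuous holo_on_derivative(1))

section \<open>Complex lines, Cauchy integrals and differentiation under the integral sign\<close>

lemma bounded_linear_smult:
  "bounded_linear (\<lambda>\<zeta>::complex. \<zeta> *s (v :: complex ^ 'i::finite))"
  "bounded_linear (\<lambda>v::complex ^ 'i. \<zeta> *s v)"
  unfolding linear_conv_bounded_linear[symmetric]
  by (auto intro!: linearI simp: vec_eq_iff algebra_simps)

lemma holo_on_line:
  assumes "holo_on S f" "z + \<zeta> *s v \<in> S"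
  shows "((\<lambda>\<zeta>. f (z + \<zeta> *s v)) has_field_derivative dirder f (z + \<zeta> *s v) v) (at \<zeta>)"
proof -
  have "((\<lambda>\<zeta>. z + \<zeta> *s v) has_derivative (\<lambda>\<zeta>. \<zeta> *s v)) (at \<zeta>)"
    by (auto intro!: derivative_eq_intros bounded_linear_imp_has_derivative bounded_linear_smult)
  from has_derivative_compose[OF this holo_on_derivative(1)[OF assms]]
  show ?thesis unfolding has_field_derivative_def
    using holo_on_derivative(2)[OF assms] by (simp add: o_def mult.commute[of _ "dirder f (z + \<zeta> *s v) v"])
qed

lemma continuous_on_smult_vec:
  fixes f :: "'a::topological_space \<Rightarrow> complex" and g :: "'a \<Rightarrow> complex ^ 'i::finite"
  assumes "continuous_on S f" "continuous_on S g"
  shows "continuous_on S (\<lambda>x. f x *s g x)"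
proof -
  have "continuous_on S (\<lambda>x. \<chi> i. f x * g x $ i)"
    using assms by (intro continuous_on_vec_lambda continuous_intros)
  then show ?thesis by (simp add: vector_scalar_mult_def)
qed

text \<open>Differentiation under the integral sign, with complex linearity preserved. The argument
  is affine in \<open>z\<close> to cover both a circle around \<open>z\<close>, with
  \<open>\<alpha>\<close> constant, and a segment that ends in \<open>z\<close>.\<close>

lemma holo_on_integral:
  fixes \<alpha> \<gamma> :: "real \<Rightarrow> complex" and \<beta> :: "real \<Rightarrow> complex ^ 'i::finite"
  assumes k: "holo_on S k" and D: "\<And>v. continuous_on S (\<lambda>z. dirder k z v)"
    and T: "open T" "convex T" and sub: "\<And>z t. z \<in> T \<Longrightarrow> t \<in> {0..1} \<Longrightarrow> \<alpha> t *s z + \<beta> t \<in> S"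
    and cont: "continuous_on {0..1} \<alpha>" "continuous_on {0..1} \<beta>" "continuous_on {0..1} \<gamma>"
  shows "holo_on T (\<lambda>z. integral {0..1} (\<lambda>t. \<gamma> t * k (\<alpha> t *s z + \<beta> t)))"
  unfolding holo_on_def
proof
  fix z0 assume z0: "z0 \<in> T"
  let ?\<psi> = "\<lambda>z t. \<alpha> t *s z + \<beta> t"
  have \<psi>: "continuous_on (T \<times> {0..1}) (\<lambda>(z, t). ?\<psi> z t)"
    unfolding case_prod_unfold
    by (intro continuous_on_add continuous_on_smult_vec continuous_on_compose2[OF cont(1)]
        continuous_on_compose2[OF cont(2)] continuous_intros) auto
  have \<gamma>: "continuous_on (T \<times> {0..1}) (\<lambda>(z, t). \<gamma> t)" and \<alpha>: "continuous_on (T \<times> {0..1}) (\<lambda>(z, t). \<alpha> t)"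
    unfolding case_prod_unfold
    by (intro continuous_on_compose2[OF cont(3)] continuous_on_compose2[OF cont(1)] continuous_intros; auto)+
  \<comment> \<open>The derivative of the integrand in \<open>z\<close>. It is wrapped as a bounded
    linear function since \<open>leibniz_rule\<close> integrates a family of such functions.\<close>
  define L where "L = (\<lambda>z t v. \<gamma> t * dirder k (?\<psi> z t) (\<alpha> t *s v))"
  have der: "((\<lambda>z. \<gamma> t * k (?\<psi> z t)) has_derivative L z t) (at z)" if "z \<in> T" "t \<in> {0..1}" for z t
  proof -
    have "((\<lambda>z. ?\<psi> z t) has_derivative (\<lambda>v. \<alpha> t *s v)) (at z)"
      by (auto intro!: derivative_eq_intros bounded_linear_imp_has_derivative bounded_linear_smult)
    from has_derivative_compose[OF this holo_on_derivative(1)[OF k sub[OF that]]]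
    have "((\<lambda>z. k (?\<psi> z t)) has_derivative (\<lambda>v. dirder k (?\<psi> z t) (\<alpha> t *s v))) (at z)" by simp
    from has_derivative_mult_right[OF this, of "\<gamma> t"] show ?thesis unfolding L_def .
  qed
  have L: "blinfun_apply (Blinfun (L z t)) = L z t" if "z \<in> T" "t \<in> {0..1}" for z t
    using der[OF that] by (intro bounded_linear_Blinfun_apply has_derivative_bounded_linear)
  have L': "L z t v = \<gamma> t * (\<alpha> t * dirder k (?\<psi> z t) v)" if "z \<in> T" "t \<in> {0..1}" for z t v
    unfolding L_def using holo_on_derivative(2)[OF k sub[OF that]] by simp
  have contL: "continuous_on (T \<times> {0..1}) (\<lambda>(z, t). Blinfun (L z t))"
    unfolding case_prod_unfold
  proof (rule continuous_on_blinfun_componentwise)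
    fix v :: "complex ^ 'i" assume "v \<in> Basis"
    have "continuous_on (T \<times> {0..1}) (\<lambda>p. \<gamma> (snd p) * (\<alpha> (snd p) * dirder k (?\<psi> (fst p) (snd p)) v))"
      using \<gamma> \<alpha> \<psi> sub unfolding case_prod_unfold
      by (intro continuous_on_mult continuous_on_compose2[OF D]) auto
    then show "continuous_on (T \<times> {0..1}) (\<lambda>p. blinfun_apply (Blinfun (L (fst p) (snd p))) v)"
      by (rule continuous_on_eq) (auto simp: L L')
  qed
  have contF: "continuous_on (T \<times> {0..1}) (\<lambda>(z, t). \<gamma> t * k (?\<psi> z t))"
    using \<gamma> \<psi> sub unfolding case_prod_unfold
    by (intro continuous_on_mult continuous_on_compose2[OF holo_on_continuous[OF k]]) auto
  have "((\<lambda>z. integral (cbox 0 1) (\<lambda>t. \<gamma> t * k (?\<psi> z t))) has_derivative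
      blinfun_apply (integral (cbox 0 1) (\<lambda>t. Blinfun (L z0 t)))) (at z0 within T)"
  proof (rule leibniz_rule)
    show "((\<lambda>z. \<gamma> t * k (?\<psi> z t)) has_derivative blinfun_apply (Blinfun (L z t))) (at z within T)"
      if "z \<in> T" "t \<in> cbox 0 1" for z t
      using der[of z t] L[of z t] that by (auto intro: has_derivative_at_withinI)
    show "(\<lambda>t. \<gamma> t * k (?\<psi> z t)) integrable_on cbox 0 1" if "z \<in> T" for z
    proof -
      have "continuous_on {0..1} (Pair z)" "Pair z ` {0..1} \<subseteq> T \<times> {0..1::real}"
        using that by (auto intro: continuous_intros)
      from continuous_on_compose2[OF contF this] show ?thesis
        by (simp add: integrable_continuous_real)
    qed
  qed (use z0 T contL in auto)
  then have 1: "((\<lambda>z. integral {0..1} (\<lambda>t. \<gamma> t * k (?\<psi> z t))) has_derivative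
      blinfun_apply (integral {0..1} (\<lambda>t. Blinfun (L z0 t)))) (at z0)"
    by (simp only: at_within_open[OF z0 T(1)] cbox_interval)
  have cz0: "continuous_on {0..1} (\<lambda>t. Blinfun (L z0 t))"
  proof -
    have "continuous_on {0..1} (Pair z0)" "Pair z0 ` {0..1} \<subseteq> T \<times> {0..1::real}"
      using z0 by (auto intro: continuous_intros)
    from continuous_on_compose2[OF contL this] show ?thesis by simp
  qed
  then have int: "(\<lambda>t. Blinfun (L z0 t)) integrable_on {0..1}" by (rule integrable_continuous_real)
  have 2: "blinfun_apply (integral {0..1} (\<lambda>t. Blinfun (L z0 t))) v = integral {0..1} (\<lambda>t. L z0 t v)" for v
    unfolding blinfun_apply_integral[OF int]
    by (intro Henstock_Kurzweil_Integration.integral_cong) (simp add: L[OF z0])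
  have "integral {0..1} (\<lambda>t. L z0 t (c *s v)) = c * integral {0..1} (\<lambda>t. L z0 t v)" for c v
  proof -
    have "integral {0..1} (\<lambda>t. L z0 t (c *s v)) = integral {0..1} (\<lambda>t. c * L z0 t v)"
      by (intro Henstock_Kurzweil_Integration.integral_cong)
        (simp add: L'[OF z0] holo_on_derivative(2)[OF k sub[OF z0]] mult_ac)
    then show ?thesis by simp
  qed
  then show "\<exists>f'. ((\<lambda>z. integral {0..1} (\<lambda>t. \<gamma> t * k (?\<psi> z t))) has_derivative f') (at z0) \<and>
      (\<forall>c v. f' (c *s v) = c * f' v)" using 1 2 by auto
qed

text \<open>Cauchy's formula for the first derivative on the complex line through \<open>z\<close>
  in direction \<open>v\<close>. Parametrizing the circle cancels the constant and one power of the
  radius vector; the factor \<open>1\<close> matches the shape of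
  \<open>holo_on_integral\<close>.\<close>

lemma dirder_Cauchy:
  assumes k: "holo_on S k" and \<rho>: "\<rho> > 0" and sub: "\<And>\<zeta>. norm \<zeta> \<le> \<rho> \<Longrightarrow> z + \<zeta> *s v \<in> S"
  shows "dirder k z v = integral {0..1} (\<lambda>t. inverse (\<rho> * exp (2 * of_real pi * \<i> * of_real t)) *
    k (1 *s z + (\<rho> * exp (2 * of_real pi * \<i> * of_real t)) *s v))"
proof -
  let ?g = "\<lambda>\<zeta>. k (z + \<zeta> *s v)"
  have der: "(?g has_field_derivative dirder k (z + \<zeta> *s v) v) (at \<zeta>)" if "norm \<zeta> \<le> \<rho>" for \<zeta>
    by (rule holo_on_line[OF k sub[OF that]])
  have "continuous_on (cball 0 \<rho>) ?g"
  proof (rule continuous_at_imp_continuous_on, rule ballI)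
    fix \<zeta> assume "\<zeta> \<in> cball (0::complex) \<rho>"
    then show "isCont ?g \<zeta>" by (intro DERIV_isCont[OF der]) simp
  qed
  moreover have "?g holomorphic_on ball 0 \<rho>"
  proof (rule holomorphic_onI)
    fix \<zeta> assume "\<zeta> \<in> ball (0::complex) \<rho>"
    then have "(?g has_field_derivative dirder k (z + \<zeta> *s v) v) (at \<zeta>)" by (intro der) auto
    then show "?g field_differentiable at \<zeta> within ball 0 \<rho>"
      by (meson field_differentiable_at_within field_differentiable_def)
  qed
  ultimately have "((\<lambda>u. ?g u / (u - 0) ^ Suc 1) has_contour_integral
      (2 * pi * \<i> / fact 1 * (deriv ^^ 1) ?g 0)) (circlepath 0 \<rho>)"
    using \<rho> by (intro Cauchy_has_contour_integral_higher_derivative_circlepath) auto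
  moreover have "deriv ?g 0 = dirder k z v" using DERIV_imp_deriv[OF der[of 0]] \<rho> by simp
  ultimately have "((\<lambda>u. ?g u / u ^ 2) has_contour_integral (2 * pi * \<i> * dirder k z v)) (circlepath 0 \<rho>)"
    by (simp add: power2_eq_square)
  then have "((\<lambda>t. ?g (circlepath 0 \<rho> t) / (circlepath 0 \<rho> t) ^ 2 *
      vector_derivative (circlepath 0 \<rho>) (at t within {0..1})) has_integral (2 * pi * \<i> * dirder k z v)) {0..1}"
    unfolding has_contour_integral_def .
  then have "((\<lambda>t. inverse (2 * pi * \<i>) * (?g (circlepath 0 \<rho> t) / (circlepath 0 \<rho> t) ^ 2 *
      vector_derivative (circlepath 0 \<rho>) (at t within {0..1}))) has_integral
      (inverse (2 * pi * \<i>) * (2 * pi * \<i> * dirder k z v))) {0..1}"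
    by (rule has_integral_mult_right)
  then have "((\<lambda>t. inverse (\<rho> * exp (2 * of_real pi * \<i> * of_real t)) *
    k (1 *s z + (\<rho> * exp (2 * of_real pi * \<i> * of_real t)) *s v)) has_integral dirder k z v) {0..1}"
  proof (rule has_integral_eq_rhs[OF has_integral_eq, rotated])
    fix t :: real assume t: "t \<in> {0..1}"
    define E where "E = of_real \<rho> * exp (2 * of_real pi * \<i> * of_real t)"
    have "circlepath 0 \<rho> t = E" unfolding E_def circlepath by simp
    moreover have "vector_derivative (circlepath 0 \<rho>) (at t within {0..1}) = 2 * pi * \<i> * E"
      using vector_derivative_circlepath01[of t 0 \<rho>] t unfolding E_def by simp
    moreover have "E \<noteq> 0" using \<rho> unfolding E_def by simp
    ultimately show "inverse (2 * pi * \<i>) * (?g (circlepath 0 \<rho> t) / (circlepath 0 \<rho> t) ^ 2 *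
      vector_derivative (circlepath 0 \<rho>) (at t within {0..1})) =
      inverse (\<rho> * exp (2 * of_real pi * \<i> * of_real t)) *
      k (1 *s z + (\<rho> * exp (2 * of_real pi * \<i> * of_real t)) *s v)"
      unfolding E_def[symmetric] by (simp add: power2_eq_square field_simps)
  qed (auto simp: field_simps)
  then show ?thesis by (simp add: integral_unique)
qed

text \<open>The weights of the Cauchy integral can be chosen independently of \<open>z\<close> near
  \<open>z0\<close>, which allows differentiating it once more.\<close>

lemma dirder_local:
  assumes S: "open S" and k: "holo_on S k" and z0: "z0 \<in> S"
  obtains T \<alpha> \<beta> \<gamma> where "open T" "convex T" "z0 \<in> T" "T \<subseteq> S"
    "\<And>z t. z \<in> T \<Longrightarrow> t \<in> {0..1::real} \<Longrightarrow> \<alpha> t *s z + \<beta> t \<in> S"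
    "continuous_on {0..1} \<alpha>" "continuous_on {0..1} \<beta>" "continuous_on {0..1} \<gamma>"
    "\<And>z. z \<in> T \<Longrightarrow> dirder k z v = integral {0..1} (\<lambda>t. \<gamma> t * k (\<alpha> t *s z + \<beta> t))"
proof -
  obtain r where r: "r > 0" "ball z0 r \<subseteq> S" using S z0 openE by blast
  have norm: "norm (\<zeta> *s v) = norm \<zeta> * norm v" for \<zeta> :: complex
    by (simp add: norm_vec_def norm_mult L2_set_right_distrib)
  \<comment> \<open>Circles of this radius around points of the half-size ball stay in the ball;
    adding one avoids division by zero for \<open>v = 0\<close>.\<close>
  define \<rho> where "\<rho> = r / (2 * (norm v + 1))"
  have \<rho>: "\<rho> > 0" "\<rho> * norm v < r / 2"
  proof -
    have "norm v + 1 > 0" using norm_ge_zero[of v] by linarith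
    then show "\<rho> > 0" using r(1) unfolding \<rho>_def by simp
    have "\<rho> * norm v < \<rho> * (norm v + 1)" using \<open>\<rho> > 0\<close> by simp
    also have "\<dots> = r / 2" using \<open>norm v + 1 > 0\<close> unfolding \<rho>_def by (simp add: field_simps)
    finally show "\<rho> * norm v < r / 2" .
  qed
  have sub: "z + \<zeta> *s v \<in> S" if "z \<in> ball z0 (r / 2)" "norm \<zeta> \<le> \<rho>" for z \<zeta>
  proof -
    have "norm (\<zeta> *s v) \<le> \<rho> * norm v" using that(2) by (simp add: norm mult_right_mono)
    then have "dist z0 (z + \<zeta> *s v) < r"
      using that(1) \<rho>(2) dist_triangle[of z0 "z + \<zeta> *s v" z] by (simp add: dist_norm)
    then show ?thesis using r(2) by auto
  qed
  define e where "e = (\<lambda>t::real. of_real \<rho> * exp (2 * of_real pi * \<i> * of_real t) :: complex)"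
  have e: "norm (e t) = \<rho>" "e t \<noteq> 0" for t using \<rho>(1) by (simp_all add: e_def norm_mult)
  have cont_e: "continuous_on {0..1} e" unfolding e_def by (intro continuous_intros)
  show ?thesis
  proof (rule that[of "ball z0 (r / 2)" "\<lambda>_. 1" "\<lambda>t. e t *s v" "\<lambda>t. inverse (e t)"])
    show "1 *s z + e t *s v \<in> S" if "z \<in> ball z0 (r / 2)" for z t
      using sub[OF that, of "e t"] e(1)[of t] by simp
    show "continuous_on {0..1} (\<lambda>t. e t *s v)"
      by (intro continuous_on_smult_vec cont_e continuous_intros)
    show "continuous_on {0..1} (\<lambda>t. inverse (e t))"
      using e(2) by (intro continuous_intros cont_e) auto
    show "dirder k z v = integral {0..1} (\<lambda>t. inverse (e t) * k (1 *s z + e t *s v))"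
      if "z \<in> ball z0 (r / 2)" for z
      unfolding e_def by (rule dirder_Cauchy[OF k \<rho>(1) sub[OF that]])
  qed (use r in \<open>auto simp: subset_ball\<close>)
qed

text \<open>Complex differentiability alone is assumed, so continuity of the derivative comes from
  the Cauchy integral. \<open>holo_on_integral\<close> requires it.\<close>

lemma continuous_on_dirder:
  assumes S: "open S" and k: "holo_on S k"
  shows "continuous_on S (\<lambda>z. dirder k z v)"
proof (rule continuous_at_imp_continuous_on, rule ballI)
  fix z0 assume "z0 \<in> S"
  then obtain T \<alpha> \<beta> \<gamma> where T: "open T" "z0 \<in> T"
    and sub: "\<And>z t. z \<in> T \<Longrightarrow> t \<in> {0..1::real} \<Longrightarrow> \<alpha> t *s z + \<beta> t \<in> S"
    and cont: "continuous_on {0..1} \<alpha>" "continuous_on {0..1} \<beta>" "continuous_on {0..1} \<gamma>"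
    and eq: "\<And>z. z \<in> T \<Longrightarrow> dirder k z v = integral {0..1} (\<lambda>t. \<gamma> t * k (\<alpha> t *s z + \<beta> t))"
    by (rule dirder_local[OF S k, of z0 v]) blast
  have "continuous_on T (\<lambda>z. integral (cbox 0 1) (\<lambda>t. \<gamma> t * k (\<alpha> t *s z + \<beta> t)))"
  proof (rule integral_continuous_on_param)
    have "continuous_on (T \<times> {0..1}) (\<lambda>p. \<alpha> (snd p) *s fst p + \<beta> (snd p))"
      by (intro continuous_on_add continuous_on_smult_vec continuous_on_compose2[OF cont(1)]
        continuous_on_compose2[OF cont(2)] continuous_intros) auto
    then have "continuous_on (T \<times> {0..1}) (\<lambda>p. \<gamma> (snd p) * k (\<alpha> (snd p) *s fst p + \<beta> (snd p)))"
    proof (rule continuous_on_mult[rotated, OF continuous_on_compose2[OF holo_on_continuous[OF k]]])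
      show "continuous_on (T \<times> {0..1}) (\<lambda>p. \<gamma> (snd p))"
        by (rule continuous_on_compose2[OF cont(3)]) (auto intro: continuous_intros)
    qed (use sub in auto)
    then show "continuous_on (T \<times> cbox 0 1) (\<lambda>(z, t). \<gamma> t * k (\<alpha> t *s z + \<beta> t))"
      by (simp add: case_prod_unfold)
  qed
  then have "continuous_on T (\<lambda>z. dirder k z v)" by (rule continuous_on_eq) (simp add: eq)
  then show "isCont (\<lambda>z. dirder k z v) z0" using T by (simp add: continuous_on_eq_continuous_at)
qed

text \<open>The Cauchy integral for the derivative depends holomorphically on its centre.\<close>

theorem holo_on_dirder:
  assumes S: "open S" and k: "holo_on S k"
  shows "holo_on S (\<lambda>z. dirder k z v)"
proof (rule holo_on_cong_local)
  fix z0 assume "z0 \<in> S"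
  then obtain T \<alpha> \<beta> \<gamma> where T: "open T" "convex T" "z0 \<in> T"
    and sub: "\<And>z t. z \<in> T \<Longrightarrow> t \<in> {0..1::real} \<Longrightarrow> \<alpha> t *s z + \<beta> t \<in> S"
    and cont: "continuous_on {0..1} \<alpha>" "continuous_on {0..1} \<beta>" "continuous_on {0..1} \<gamma>"
    and eq: "\<And>z. z \<in> T \<Longrightarrow> dirder k z v = integral {0..1} (\<lambda>t. \<gamma> t * k (\<alpha> t *s z + \<beta> t))"
    by (rule dirder_local[OF S k, of z0 v]) blast
  have "holo_on T (\<lambda>z. integral {0..1} (\<lambda>t. \<gamma> t * k (\<alpha> t *s z + \<beta> t)))"
    by (rule holo_on_integral[OF k continuous_on_dirder[OF S k] T(1,2) sub cont])
  then show "\<exists>T g. open T \<and> z0 \<in> T \<and> holo_on T g \<and> (\<forall>w\<in>T. g w = dirder k w v)"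
    using T(1,3) eq[symmetric]
    by (intro exI[of _ T] exI[of _ "\<lambda>z. integral {0..1} (\<lambda>t. \<gamma> t * k (\<alpha> t *s z + \<beta> t))"] conjI) auto
qed

text \<open>Integrating the derivative along the segment from \<open>s0\<close> to \<open>s\<close>
  gives the coefficients \<open>g i\<close>. The proof that derivations come from vectors applies
  this expansion to germs.\<close>

lemma holo_on_Hadamard:
  assumes k: "holo_on (ball s0 r) k" and r: "r > 0"
  obtains g where "\<And>i. holo_on (ball s0 r) (g i)" "\<And>i. g i s0 = dirder k s0 (axis i 1)"
    "\<And>s. s \<in> ball s0 r \<Longrightarrow> k s = k s0 + (\<Sum>i\<in>UNIV. (s $ i - s0 $ i) * g i s)"
proof
  let ?S = "ball s0 r"
  define g where "g = (\<lambda>i s. integral {0..1} (\<lambda>t. 1 * dirder k (of_real t *s s + (1 - of_real t) *s s0) (axis i 1)))"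
  have D: "holo_on ?S (\<lambda>z. dirder k z v)" for v by (rule holo_on_dirder[OF open_ball k])
  have sub: "of_real t *s s + (1 - of_real t) *s s0 \<in> ?S" if "s \<in> ?S" "t \<in> {0..1::real}" for s t
  proof -
    have "of_real t *s s + (1 - of_real t) *s s0 = t *\<^sub>R s + (1 - t) *\<^sub>R s0"
      unfolding vec_eq_iff
      by (simp only: vector_add_component vector_scaleR_component vector_smult_component)
        (simp add: scaleR_conv_of_real)
    then show ?thesis using convexD[OF convex_ball that(1), of s0 t "1 - t"] that(2) r by simp
  qed
  have cont: "continuous_on {0..1} (\<lambda>t. of_real t :: complex)"
    "continuous_on {0..1} (\<lambda>t. (1 - of_real t) *s s0)" "continuous_on {0..1::real} (\<lambda>_. 1 :: complex)"
    by (intro continuous_on_smult_vec continuous_intros)+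
  show "holo_on ?S (g i)" for i
    unfolding g_def
    by (rule holo_on_integral[OF D continuous_on_dirder[OF open_ball D] open_ball convex_ball sub cont])
  show "g i s0 = dirder k s0 (axis i 1)" for i
  proof -
    have "of_real t *s s0 + (1 - of_real t) *s s0 = s0" for t :: real
      by (simp add: vec_eq_iff algebra_simps)
    then show ?thesis unfolding g_def by simp
  qed
  show "k s = k s0 + (\<Sum>i\<in>UNIV. (s $ i - s0 $ i) * g i s)" if s: "s \<in> ?S" for s
  proof -
    let ?c = "\<lambda>t::real. of_real t *s s + (1 - of_real t) *s s0"
    have c: "?c t = s0 + of_real t *s (s - s0)" for t by (simp add: vec_eq_iff algebra_simps)
    have "((\<lambda>t. k (?c t)) has_vector_derivative dirder k (?c t) (s - s0)) (at t within {0..1})"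
      if t: "t \<in> {0..1}" for t
    proof -
      have "((\<lambda>\<zeta>. k (s0 + \<zeta> *s (s - s0))) has_field_derivative dirder k (?c t) (s - s0)) (at (of_real t))"
        using holo_on_line[OF k, of s0 "of_real t" "s - s0"] sub[OF s t] unfolding c by blast
      then show ?thesis unfolding c by (rule has_vector_derivative_real_field)
    qed
    then have "((\<lambda>t. dirder k (?c t) (s - s0)) has_integral (k (?c 1) - k (?c 0))) {0..1}"
      by (intro fundamental_theorem_of_calculus) auto
    then have "k s - k s0 = integral {0..1} (\<lambda>t. dirder k (?c t) (s - s0))"
      by (simp add: integral_unique)
    also have "\<dots> = integral {0..1} (\<lambda>t. \<Sum>i\<in>UNIV. (s $ i - s0 $ i) * dirder k (?c t) (axis i 1))"
      by (intro Henstock_Kurzweil_Integration.integral_cong) (subst dirder_expand[OF k sub[OF s]], auto)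
    also have "\<dots> = (\<Sum>i\<in>UNIV. integral {0..1} (\<lambda>t. (s $ i - s0 $ i) * dirder k (?c t) (axis i 1)))"
    proof (rule Henstock_Kurzweil_Integration.integral_sum)
      show "(\<lambda>t. (s $ i - s0 $ i) * dirder k (?c t) (axis i 1)) integrable_on {0..1}" for i
      proof -
        have "continuous_on {0..1} ?c" by (intro continuous_on_add continuous_on_smult_vec continuous_intros)
        moreover have "?c ` {0..1} \<subseteq> ?S" using sub[OF s] by blast
        ultimately have "continuous_on {0..1} (\<lambda>t. dirder k (?c t) (axis i 1))"
          by (rule continuous_on_compose2[OF holo_on_continuous[OF D]])
        then show ?thesis by (intro integrable_continuous_real continuous_on_mult_left)
      qed
    qed auto
    also have "\<dots> = (\<Sum>i\<in>UNIV. (s $ i - s0 $ i) * g i s)" by (simp add: g_def)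
    finally show ?thesis by (simp add: algebra_simps)
  qed
qed

section \<open>Homogeneous holomorphic functions\<close>

locale homogeneous_holo =
  fixes f :: "complex ^ 'i::finite \<Rightarrow> complex" and k :: int
  assumes holo: "holo_on (- {0}) f"
    and homog: "\<And>c z. c \<noteq> 0 \<Longrightarrow> z \<noteq> 0 \<Longrightarrow> f (c *s z) = c powi k * f z"
begin

text \<open>Along a line that misses the origin, Liouville's theorem applies.\<close>

lemma eq_of_missing_line:
  assumes k: "k \<le> 0" and line: "\<And>t. z + t *s w \<noteq> 0" and w: "w \<noteq> 0"
  shows "f z = (if k = 0 then f w else 0)"
proof -
  let ?g = "\<lambda>t::complex. f (z + t *s w)"
  have "?g holomorphic_on UNIV"
  proof (rule holomorphic_onI)
    fix t :: complex
    have "(?g has_field_derivative dirder f (z + t *s w) w) (at t)"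
      by (rule holo_on_line[OF holo]) (use line in simp)
    then show "?g field_differentiable at t within UNIV" unfolding field_differentiable_def by blast
  qed
  moreover have "(?g \<longlongrightarrow> (if k = 0 then f w else 0)) at_infinity"
  proof -
    \<comment> \<open>Dividing the argument by \<open>t\<close> turns the behaviour at infinity into
      a power of \<open>t\<close> with exponent \<open>k\<close> times a limit at
      \<open>w\<close>.\<close>
    have "((\<lambda>t::complex. w + inverse t *s z) \<longlongrightarrow> w + 0 *s z) at_infinity"
      by (intro tendsto_add tendsto_const bounded_linear.tendsto[OF bounded_linear_smult(1)] tendsto_inverse_0)
    moreover have "isCont f w"
      using holo_on_continuous[OF holo] w by (simp add: continuous_on_eq_continuous_at open_Compl)
    ultimately have 1: "((\<lambda>t::complex. f (w + inverse t *s z)) \<longlongrightarrow> f w) at_infinity"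
      using isCont_tendsto_compose by fastforce
    have 2: "((\<lambda>t::complex. t powi k) \<longlongrightarrow> (if k = 0 then 1 else 0)) at_infinity"
    proof (cases "k = 0")
      case False
      then have "((\<lambda>t::complex. inverse t ^ nat (- k)) \<longlongrightarrow> 0 ^ nat (- k)) at_infinity"
        by (intro tendsto_power tendsto_inverse_0)
      then show ?thesis using False k by (simp add: power_int_def power_inverse power_0_left)
    qed simp
    have 3: "\<forall>\<^sub>F t in at_infinity. t powi k * f (w + inverse t *s z) = ?g t"
    proof -
      have "t powi k * f (w + inverse t *s z) = ?g t" if "norm t \<ge> 1" for t :: complex
      proof -
        have t: "t \<noteq> 0" using that by auto
        have eq: "t *s (w + inverse t *s z) = z + t *s w"
          using t by (simp add: vec_eq_iff algebra_simps)
        then have "w + inverse t *s z \<noteq> 0" using line[of t] by (metis vector_smult_rzero)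
        from homog[OF t this] show ?thesis unfolding eq by simp
      qed
      then show ?thesis unfolding eventually_at_infinity by blast
    qed
    from Lim_transform_eventually[OF tendsto_mult[OF 2 1] 3] show ?thesis by (cases "k = 0") simp_all
  qed
  ultimately have "?g 0 = (if k = 0 then f w else 0)" by (rule Liouville_weak)
  then show ?thesis by simp
qed

text \<open>With two coordinates every nonzero point lies on a line that misses the origin, so
  negative degree leaves only zero. In degree 0, linearly independent points are compared along such
  a line and dependent ones by homogeneity.\<close>

lemma hpoly_nonpos_degree:
  assumes k: "k \<le> 0" and card: "CARD('i) \<ge> 2"
  shows "\<exists>g. hpoly UNIV k g \<and> (\<forall>z. z \<noteq> 0 \<longrightarrow> f z = g z)"
proof (cases "k = 0")
  case False
  have "f z = 0" if "z \<noteq> 0" for z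
  proof -
    obtain i where i: "z $ i \<noteq> 0" using \<open>z \<noteq> 0\<close> by (auto simp: vec_eq_iff)
    have "card {i} < CARD('i)" using card by simp
    then obtain j where j: "j \<noteq> i" by (metis UNIV_eq_I insertCI less_irrefl singletonD)
    have "(z + t *s axis j 1) $ i \<noteq> 0" for t using i j by (simp add: axis_def)
    then have "z + t *s axis j 1 \<noteq> 0" for t by (metis zero_index)
    then show ?thesis using eq_of_missing_line[OF k, of z "axis j 1"] False by simp
  qed
  then show ?thesis by (intro exI[of _ "\<lambda>_. 0"]) (simp add: hpoly_zero)
next
  case True
  have eq: "f z = f w" if zw: "z \<noteq> 0" "w \<noteq> 0" for z w
  proof (cases "\<exists>t. z + t *s w = 0")
    case True
    then obtain t where t: "z + t *s w = 0" by blast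
    then have "z = (- t) *s w" by (simp add: vec_eq_iff add_eq_0_iff2)
    moreover from this have "- t \<noteq> 0" using zw by auto
    ultimately show ?thesis using homog[of "- t" w] zw \<open>k = 0\<close> by simp
  next
    case False
    then show ?thesis using eq_of_missing_line[OF k, of z w] zw \<open>k = 0\<close> by simp
  qed
  have const: "f z = f (axis undefined 1)" if "z \<noteq> 0" for z
    by (rule eq[OF that]) (simp add: axis_eq_0_iff)
  show ?thesis unfolding True
    by (rule exI[of _ "\<lambda>_. f (axis undefined 1)"]) (blast intro: hpoly_const const)
qed

lemma dirder_homogeneous:
  "homogeneous_holo (\<lambda>z. dirder f z v) (k - 1)"
proof
  show "holo_on (- {0}) (\<lambda>z. dirder f z v)" by (rule holo_on_dirder[OF _ holo]) (simp add: open_Compl)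
  fix c :: complex and z :: "complex ^ 'i" assume cz: "c \<noteq> 0" "z \<noteq> 0"
  then have cz': "c *s z \<noteq> 0" by simp
  have "((\<lambda>z. f (c *s z)) has_derivative (\<lambda>v. dirder f (c *s z) (c *s v))) (at z)"
    using has_derivative_compose[OF bounded_linear_imp_has_derivative[OF bounded_linear_smult(2)]
      holo_on_derivative(1)[OF holo, of "c *s z"]] cz' by simp
  then have "((\<lambda>z. c powi k * f z) has_derivative (\<lambda>v. dirder f (c *s z) (c *s v))) (at z)"
    by (rule has_derivative_transform_within_open[of _ _ _ _ "- {0}"]) (use cz homog in auto)
  moreover have "((\<lambda>z. c powi k * f z) has_derivative (\<lambda>v. c powi k * dirder f z v)) (at z)"
    by (intro has_derivative_mult_right holo_on_derivative(1)[OF holo]) (use cz in simp)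
  ultimately have "(\<lambda>v. dirder f (c *s z) (c *s v)) = (\<lambda>v. c powi k * dirder f z v)"
    by (rule has_derivative_unique)
  then have "dirder f (c *s z) (c *s v) = c powi k * dirder f z v" by meson
  moreover have "dirder f (c *s z) (c *s v) = c * dirder f (c *s z) v"
    using holo_on_derivative(2)[OF holo] cz' by simp
  moreover have "c powi k = c * c powi (k - 1)" using cz by (simp add: power_int_diff)
  ultimately show "dirder f (c *s z) v = c powi (k - 1) * dirder f z v" using cz by simp
qed

text \<open>Both sides are the derivative at 0 of \<open>f\<close> along the radial line, which
  homogeneity makes a power of \<open>1 + \<zeta>\<close>.\<close>

lemma Euler:
  assumes "z \<noteq> 0" "k \<ge> 0"
  shows "dirder f z z = of_int k * f z"
proof -
  have "((\<lambda>\<zeta>. f (z + \<zeta> *s z)) has_field_derivative dirder f (z + 0 *s z) z) (at 0)"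
    by (rule holo_on_line[OF holo]) (use assms in simp)
  then have "((\<lambda>\<zeta>. (1 + \<zeta>) ^ nat k * f z) has_field_derivative dirder f z z) (at 0)"
    unfolding vector_smult_lzero add_0_right
  proof (rule has_field_derivative_transform_within[where d = 1])
    fix \<zeta> :: complex assume "dist \<zeta> 0 < 1"
    then have "\<zeta> \<noteq> - 1" by auto
    then have nz: "1 + \<zeta> \<noteq> 0" by (simp add: add_eq_0_iff)
    have "z + \<zeta> *s z = (1 + \<zeta>) *s z" by (simp add: vec_eq_iff algebra_simps)
    then show "f (z + \<zeta> *s z) = (1 + \<zeta>) ^ nat k * f z"
      using homog[OF nz assms(1)] assms(2) by (simp add: power_int_def)
  qed simp_all
  moreover have "((\<lambda>\<zeta>. (1 + \<zeta>) ^ nat k * f z) has_field_derivative of_nat (nat k) * f z) (at 0)"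
    by (auto intro!: derivative_eq_intros)
  ultimately show ?thesis using DERIV_unique assms(2) by fastforce
qed

end

text \<open>Partial derivatives lower the degree, and Euler's identity recovers the function from
  them. The induction ends in degree 0 with Liouville's theorem.\<close>

theorem homogeneous_holo_hpoly:
  assumes "homogeneous_holo f k" and card: "CARD('i::finite) \<ge> 2"
  shows "\<exists>g :: complex ^ 'i \<Rightarrow> complex. hpoly UNIV k g \<and> (\<forall>z. z \<noteq> 0 \<longrightarrow> f z = g z)"
  using assms(1)
proof (induction "nat k" arbitrary: f k)
  case 0
  then show ?case using homogeneous_holo.hpoly_nonpos_degree[OF 0(2) _ card] by simp
next
  case (Suc m)
  interpret homogeneous_holo f k by (rule Suc.prems)
  have k: "k > 0" using Suc.hyps(2) by simp
  have "\<forall>i. \<exists>g. hpoly UNIV (k - 1) g \<and> (\<forall>z. z \<noteq> 0 \<longrightarrow> dirder f z (axis i 1) = g z)"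
    using Suc.hyps(1)[OF _ dirder_homogeneous] Suc.hyps(2) by simp
  from choice[OF this] obtain g where g: "\<forall>i. hpoly UNIV (k - 1) (g i) \<and> (\<forall>z. z \<noteq> 0 \<longrightarrow> dirder f z (axis i 1) = g i z)" ..
  define h where "h = (\<lambda>z. inverse (of_int k) * (\<Sum>i\<in>UNIV. z $ i * g i z))"
  have "hpoly UNIV k h"
    unfolding h_def using g by (intro hpoly_smult hpoly_sum hpoly_mult'[OF hpoly_coord1]) auto
  moreover have "f z = h z" if z: "z \<noteq> 0" for z
  proof -
    have "of_int k * f z = dirder f z z" using Euler[OF z] k by simp
    also have "\<dots> = (\<Sum>i\<in>UNIV. z $ i * dirder f z (axis i 1))"
      by (rule dirder_expand[OF holo]) (use z in simp)
    also have "\<dots> = (\<Sum>i\<in>UNIV. z $ i * g i z)" using g z by simp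
    finally show ?thesis using k by (simp add: h_def field_simps)
  qed
  ultimately show ?case by blast
qed

section \<open>Tangent vectors of projective space\<close>

lemma rep_proj: "rep_proj p \<noteq> 0" "abs_proj (rep_proj p) = p"
  using Quotient_rep_reflp[OF Quotient_proj] Quotient_abs_rep[OF Quotient_proj] by blast+

lemma abs_proj_eq_iff:
  "z \<noteq> 0 \<Longrightarrow> w \<noteq> 0 \<Longrightarrow> abs_proj z = abs_proj w \<longleftrightarrow> (\<exists>c. w = c *s z)"
proof -
  assume nz: "z \<noteq> 0" "w \<noteq> 0"
  have refl: "x \<noteq> 0 \<and> x \<noteq> 0 \<and> (\<exists>c. x = c *s x)" if "x \<noteq> 0" for x :: "complex ^ 'a"
    using that by (auto intro: exI[of _ 1])
  show ?thesis
    using Quotient_rel[OF Quotient_proj, of z w] refl[OF nz(1)] refl[OF nz(2)] nz by blast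
qed

lemma abs_proj_smult: "c \<noteq> 0 \<Longrightarrow> z \<noteq> 0 \<Longrightarrow> abs_proj (c *s z) = abs_proj z"
  using abs_proj_eq_iff[of z "c *s z"] by auto

lemma abs_proj_smult': "c \<noteq> 0 \<Longrightarrow> abs_proj (c *s z) = abs_proj z"
  using abs_proj_smult[of c z] by (cases "z = 0") auto

lemma rep_abs_proj:
  assumes "z \<noteq> 0"
  obtains c where "c \<noteq> 0" "rep_proj (abs_proj z) = c *s z"
proof -
  have "abs_proj z = abs_proj (rep_proj (abs_proj z))" by (simp add: rep_proj)
  then obtain c where c: "rep_proj (abs_proj z) = c *s z"
    using abs_proj_eq_iff[OF assms rep_proj(1)] by blast
  moreover have "c \<noteq> 0" using c rep_proj(1)[of "abs_proj z"] by auto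
  ultimately show ?thesis by (rule that[rotated])
qed

lemma punctured_cone_iff: "z \<in> punctured_cone U \<longleftrightarrow> z \<noteq> 0 \<and> abs_proj z \<in> U"
  by (simp add: punctured_cone_def)

lemma rep_proj_in_cone: "p \<in> U \<Longrightarrow> rep_proj p \<in> punctured_cone U"
  by (simp add: punctured_cone_iff rep_proj)

lemma punctured_cone_mono: "U \<subseteq> V \<Longrightarrow> punctured_cone U \<subseteq> punctured_cone V"
  by (auto simp: punctured_cone_iff)

lemma structure_sheafD: "f \<in> \<O> U \<Longrightarrow> holo_on (punctured_cone U) (\<lambda>z. f (abs_proj z))"
  by (simp add: structure_sheaf_def)

lemma stalk_OE:
  assumes "f \<in> stalk \<O> p" "g \<in> stalk \<O> p"
  obtains U where "open U" "p \<in> U" "f \<in> \<O> U" "g \<in> \<O> U"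
proof -
  obtain U V where UV: "open U" "p \<in> U" "f \<in> \<O> U" "open V" "p \<in> V" "g \<in> \<O> V"
    using assms unfolding stalk_def by blast
  have "f \<in> \<O> (U \<inter> V)" "g \<in> \<O> (U \<inter> V)"
    using UV(3,6) holo_on_subset[OF _ punctured_cone_mono] unfolding structure_sheaf_def by blast+
  then show ?thesis using that[of "U \<inter> V"] UV by auto
qed

lemma structure_sheaf_ops:
  assumes "f \<in> \<O> U" "g \<in> \<O> U"
  shows "(\<lambda>x. f x + g x) \<in> \<O> U" "(\<lambda>x. f x * g x) \<in> \<O> U" "(\<lambda>x. c * f x) \<in> \<O> U" "(\<lambda>_. c) \<in> \<O> U"
  using assms unfolding structure_sheaf_def
  by (auto intro: holo_on_add holo_on_mult holo_on_const)

lemma stalkI: "open U \<Longrightarrow> p \<in> U \<Longrightarrow> s \<in> S U \<Longrightarrow> s \<in> stalk S p"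
  unfolding stalk_def by blast

lemma stalk_O_ops:
  assumes "f \<in> stalk \<O> p" "g \<in> stalk \<O> p"
  shows "(\<lambda>x. f x + g x) \<in> stalk \<O> p" "(\<lambda>x. f x * g x) \<in> stalk \<O> p" "(\<lambda>x. c * f x) \<in> stalk \<O> p"
proof -
  obtain U where U: "open U" "p \<in> U" "f \<in> \<O> U" "g \<in> \<O> U" using stalk_OE[OF assms] .
  note ops = structure_sheaf_ops[OF U(3,4)]
  show "(\<lambda>x. f x + g x) \<in> stalk \<O> p" by (rule stalkI[where S = \<O>, OF U(1,2) ops(1)])
  show "(\<lambda>x. f x * g x) \<in> stalk \<O> p" by (rule stalkI[where S = \<O>, OF U(1,2) ops(2)])
  show "(\<lambda>x. c * f x) \<in> stalk \<O> p" by (rule stalkI[where S = \<O>, OF U(1,2) ops(3)])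
qed

lemma stalk_O_const: "(\<lambda>_. c) \<in> stalk \<O> p"
  using stalkI[of UNIV p "\<lambda>_. c" \<O>] by (simp add: structure_sheaf_def holo_on_const)

lemma stalk_O_sum:
  "(\<And>i. i \<in> X \<Longrightarrow> f i \<in> stalk \<O> p) \<Longrightarrow> (\<lambda>x. \<Sum>i\<in>X. f i x) \<in> stalk \<O> p"
proof (induction X rule: infinite_finite_induct)
  case (insert i X)
  then show ?case using stalk_O_ops(1)[of "f i" p "\<lambda>x. \<Sum>i\<in>X. f i x"] by simp
qed (simp_all add: stalk_O_const)

text \<open>The image of the vector \<open>v\<close> at \<open>z\<close> under the differential of
  the projection; it is zero off the stalk to agree with the convention of
  \<open>tangent_space\<close>.\<close>

definition tvec :: "complex ^ 'i::finite \<Rightarrow> complex ^ 'i \<Rightarrow> 'i tangent"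
  where "tvec z v = (\<lambda>f. if f \<in> stalk \<O> (abs_proj z) then dirder (\<lambda>w. f (abs_proj w)) z v else 0)"

lemma tvec_in_O:
  assumes "open U" "f \<in> \<O> U" "z \<in> punctured_cone U"
  shows "tvec z v f = dirder (\<lambda>w. f (abs_proj w)) z v"
  using stalkI[where S = \<O>, OF assms(1) _ assms(2)] assms(3) by (simp add: tvec_def punctured_cone_iff)

lemma stalk_O_derivative:
  assumes "z \<noteq> 0" "f \<in> stalk \<O> (abs_proj z)"
  shows "((\<lambda>w. f (abs_proj w)) has_derivative (\<lambda>v. tvec z v f)) (at z)"
    and "tvec z (c *s v) f = c * tvec z v f"
    and "tvec z v f = (\<Sum>i\<in>UNIV. v $ i * tvec z (axis i 1) f)"
proof -
  obtain U where U: "open U" "abs_proj z \<in> U" "f \<in> \<O> U"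
    using assms(2) unfolding stalk_def by blast
  have z: "z \<in> punctured_cone U" using assms(1) U(2) by (simp add: punctured_cone_iff)
  note h = structure_sheafD[OF U(3)]
  have eq: "tvec z v f = dirder (\<lambda>w. f (abs_proj w)) z v" for v by (rule tvec_in_O[OF U(1,3) z])
  show "((\<lambda>w. f (abs_proj w)) has_derivative (\<lambda>v. tvec z v f)) (at z)"
    using holo_on_derivative(1)[OF h z] unfolding eq by simp
  show "tvec z (c *s v) f = c * tvec z v f"
    using holo_on_derivative(2)[OF h z] unfolding eq by simp
  show "tvec z v f = (\<Sum>i\<in>UNIV. v $ i * tvec z (axis i 1) f)"
    unfolding eq by (rule dirder_expand[OF h z])
qed

lemma tvec_expand: "z \<noteq> 0 \<Longrightarrow> tvec z v = (\<lambda>f. \<Sum>i\<in>UNIV. v $ i * tvec z (axis i 1) f)"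
proof
  fix f assume z: "z \<noteq> 0"
  show "tvec z v f = (\<Sum>i\<in>UNIV. v $ i * tvec z (axis i 1) f)"
  proof (cases "f \<in> stalk \<O> (abs_proj z)")
    case True
    then show ?thesis by (rule stalk_O_derivative(3)[OF z])
  qed (simp add: tvec_def)
qed

lemma tvec_smult: "z \<noteq> 0 \<Longrightarrow> tvec z (c *s v) = (\<lambda>f. c * tvec z v f)"
proof
  fix f assume z: "z \<noteq> 0"
  show "tvec z (c *s v) f = c * tvec z v f"
  proof (cases "f \<in> stalk \<O> (abs_proj z)")
    case True
    then show ?thesis by (rule stalk_O_derivative(2)[OF z])
  qed (simp add: tvec_def)
qed

text \<open>The projection is invariant under scaling, so its differential identifies the vectors
  \<open>v\<close> at \<open>z\<close> and \<open>c *s v\<close> at \<open>c *s z\<close>.\<close>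

lemma tvec_rescale:
  assumes "c \<noteq> 0" "z \<noteq> 0"
  shows "tvec (c *s z) (c *s v) = tvec z v"
proof
  fix f
  show "tvec (c *s z) (c *s v) f = tvec z v f"
  proof (cases "f \<in> stalk \<O> (abs_proj z)")
    case True
    have "((\<lambda>w. f (abs_proj (c *s w))) has_derivative (\<lambda>v. tvec (c *s z) (c *s v) f)) (at z)"
      using has_derivative_compose[OF bounded_linear_imp_has_derivative[OF bounded_linear_smult(2)]
        stalk_O_derivative(1)[of "c *s z" f]] assms True by (simp add: abs_proj_smult)
    then have "((\<lambda>w. f (abs_proj w)) has_derivative (\<lambda>v. tvec (c *s z) (c *s v) f)) (at z)"
      using assms(1) by (simp add: abs_proj_smult')
    from has_derivative_unique[OF this stalk_O_derivative(1)[OF assms(2) True]]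
    show ?thesis by meson
  qed (use assms in \<open>simp add: tvec_def abs_proj_smult\<close>)
qed

text \<open>The projection is constant along the line through the origin. This is the source of the
  relation with coefficients \<open>z\<close> between the images of the basis vectors.\<close>

lemma tvec_radial:
  assumes "z \<noteq> 0"
  shows "tvec z z = (\<lambda>_. 0)"
proof
  fix f
  show "tvec z z f = 0"
  proof (cases "f \<in> stalk \<O> (abs_proj z)")
    case True
    have "((\<lambda>\<zeta>::complex. z + \<zeta> *s z) has_derivative (\<lambda>\<zeta>. \<zeta> *s z)) (at 0)"
      by (auto intro!: derivative_eq_intros bounded_linear_imp_has_derivative bounded_linear_smult)
    from has_derivative_compose[OF this, of "\<lambda>w. f (abs_proj w)" "\<lambda>v. tvec z v f"]
    have "((\<lambda>\<zeta>. f (abs_proj (z + \<zeta> *s z))) has_derivative (\<lambda>\<zeta>. tvec z (\<zeta> *s z) f)) (at 0)"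
      using stalk_O_derivative(1)[OF assms True] by simp
    then have "((\<lambda>\<zeta>::complex. f (abs_proj z)) has_derivative (\<lambda>\<zeta>. tvec z (\<zeta> *s z) f)) (at 0)"
    proof (rule has_derivative_transform_within_open[of _ _ _ _ "- {- 1}"])
      fix \<zeta> :: complex assume "\<zeta> \<in> - {- 1}"
      then have nz: "1 + \<zeta> \<noteq> 0" by (simp add: add_eq_0_iff)
      have eq: "z + \<zeta> *s z = (1 + \<zeta>) *s z" by (simp add: vec_eq_iff algebra_simps)
      show "f (abs_proj (z + \<zeta> *s z)) = f (abs_proj z)" unfolding eq abs_proj_smult'[OF nz] ..
    qed auto
    then have "(\<lambda>\<zeta>. tvec z (\<zeta> *s z) f) = (\<lambda>_. 0)"
      by (rule has_derivative_unique[OF _ has_derivative_const])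
    then have "tvec z (1 *s z) f = 0" by meson
    then show ?thesis by simp
  qed (simp add: tvec_def)
qed

lemma tvec_tangent:
  assumes z: "z \<noteq> 0"
  shows "tvec z v \<in> tangent_space (abs_proj z)"
proof -
  let ?p = "abs_proj z"
  note der = stalk_O_derivative(1)[OF z]
  have unique: "tvec z v f = D v"
    if "f \<in> stalk \<O> ?p" "((\<lambda>w. f (abs_proj w)) has_derivative D) (at z)" for f D
    using has_derivative_unique[OF der[OF that(1)] that(2)] by meson
  show ?thesis
    unfolding tangent_space_def mem_Collect_eq
  proof (intro conjI ballI allI impI)
    fix f g assume fg: "f \<in> stalk \<O> ?p" "g \<in> stalk \<O> ?p"
    show "tvec z v (\<lambda>x. f x + g x) = tvec z v f + tvec z v g"
      by (rule unique[OF stalk_O_ops(1)[OF fg] has_derivative_add[OF der[OF fg(1)] der[OF fg(2)]]])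
    show "tvec z v (\<lambda>x. f x * g x) = f ?p * tvec z v g + g ?p * tvec z v f"
      using unique[OF stalk_O_ops(2)[OF fg] has_derivative_mult[OF der[OF fg(1)] der[OF fg(2)]]] by simp
    assume "\<forall>\<^sub>F x in nhds ?p. f x = g x"
    then obtain U where U: "open U" "?p \<in> U" "\<And>x. x \<in> U \<Longrightarrow> f x = g x"
      unfolding eventually_nhds by blast
    have "((\<lambda>w. g (abs_proj w)) has_derivative (\<lambda>v. tvec z v f)) (at z)"
    proof (rule has_derivative_transform_within_open[OF der[OF fg(1)]])
      show "open (punctured_cone U)" using U(1) by (simp add: open_proj_def)
    qed (use U z in \<open>auto simp: punctured_cone_iff\<close>)
    from unique[OF fg(2) this] show "tvec z v f = tvec z v g" by simp
  next
    fix c f assume f: "f \<in> stalk \<O> ?p"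
    show "tvec z v (\<lambda>x. c * f x) = c * tvec z v f"
      by (rule unique[OF stalk_O_ops(3)[OF f f] has_derivative_mult_right[OF der[OF f]]])
  next
    fix f assume "f \<notin> stalk \<O> ?p"
    then show "tvec z v f = 0" by (simp add: tvec_def)
  qed
qed

section \<open>Derivations of the local ring\<close>

lemma tangentD:
  assumes "\<delta> \<in> tangent_space p"
  shows "f \<in> stalk \<O> p \<Longrightarrow> g \<in> stalk \<O> p \<Longrightarrow> \<delta> (\<lambda>x. f x + g x) = \<delta> f + \<delta> g"
    and "f \<in> stalk \<O> p \<Longrightarrow> \<delta> (\<lambda>x. c * f x) = c * \<delta> f"
    and "f \<in> stalk \<O> p \<Longrightarrow> g \<in> stalk \<O> p \<Longrightarrow> \<delta> (\<lambda>x. f x * g x) = f p * \<delta> g + g p * \<delta> f"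
    and "f \<in> stalk \<O> p \<Longrightarrow> g \<in> stalk \<O> p \<Longrightarrow> open U \<Longrightarrow> p \<in> U \<Longrightarrow> (\<And>x. x \<in> U \<Longrightarrow> f x = g x) \<Longrightarrow> \<delta> f = \<delta> g"
    and "f \<notin> stalk \<O> p \<Longrightarrow> \<delta> f = 0"
proof -
  note d = assms[unfolded tangent_space_def mem_Collect_eq]
  note d1 = d[THEN conjunct1] and d' = d[THEN conjunct2]
  note d2 = d'[THEN conjunct1] and d'' = d'[THEN conjunct2]
  note d3 = d''[THEN conjunct1] and d4 = d''[THEN conjunct2, THEN conjunct1]
    and d5 = d''[THEN conjunct2, THEN conjunct2]
  show "\<delta> (\<lambda>x. f x + g x) = \<delta> f + \<delta> g" if "f \<in> stalk \<O> p" "g \<in> stalk \<O> p" using d1 that by simp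
  show "\<delta> (\<lambda>x. c * f x) = c * \<delta> f" if "f \<in> stalk \<O> p" using d2 that by simp
  show "\<delta> (\<lambda>x. f x * g x) = f p * \<delta> g + g p * \<delta> f" if "f \<in> stalk \<O> p" "g \<in> stalk \<O> p"
    using d3 that by simp
  show "\<delta> f = 0" if "f \<notin> stalk \<O> p" using d5 that by simp
  assume fg: "f \<in> stalk \<O> p" "g \<in> stalk \<O> p" and U: "open U" "p \<in> U" "\<And>x. x \<in> U \<Longrightarrow> f x = g x"
  have "\<forall>\<^sub>F x in nhds p. f x = g x"
    unfolding eventually_nhds using U by (intro exI[of _ U]) simp
  then show "\<delta> f = \<delta> g" by (rule d4[rule_format, OF fg])
qed

lemma tangent_const:
  assumes "\<delta> \<in> tangent_space p"
  shows "\<delta> (\<lambda>_. c) = 0"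
proof -
  have "\<delta> (\<lambda>x. 1 * 1) = 1 * \<delta> (\<lambda>_. 1) + 1 * \<delta> (\<lambda>_. 1)"
    by (rule tangentD(3)[OF assms stalk_O_const stalk_O_const])
  then have "\<delta> (\<lambda>_. 1) = 0" by simp
  then show ?thesis using tangentD(2)[OF assms stalk_O_const, of c 1] by simp
qed

lemma tangent_sum:
  assumes \<delta>: "\<delta> \<in> tangent_space p"
  shows "(\<And>i. i \<in> X \<Longrightarrow> f i \<in> stalk \<O> p) \<Longrightarrow> \<delta> (\<lambda>x. \<Sum>i\<in>X. f i x) = (\<Sum>i\<in>X. \<delta> (f i))"
proof (induction X rule: infinite_finite_induct)
  case (insert i X)
  then show ?case
    using tangentD(1)[OF \<delta>, of "f i" "\<lambda>x. \<Sum>i\<in>X. f i x"] stalk_O_sum[of X f p] by simp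
qed (simp_all add: tangent_const[OF \<delta>])

lemma tangent_space_lincomb:
  assumes "u \<in> tangent_space p" "w \<in> tangent_space p"
  shows "(\<lambda>g. a * u g + b * w g) \<in> tangent_space p"
proof -
  note U = assms(1)[unfolded tangent_space_def mem_Collect_eq]
  note W = assms(2)[unfolded tangent_space_def mem_Collect_eq]
  show ?thesis
    unfolding tangent_space_def mem_Collect_eq
  proof (intro conjI ballI allI impI)
    fix f g assume fg: "f \<in> stalk \<O> p" "g \<in> stalk \<O> p"
    show "a * u (\<lambda>x. f x + g x) + b * w (\<lambda>x. f x + g x) = a * u f + b * w f + (a * u g + b * w g)"
      using tangentD(1)[OF assms(1) fg] tangentD(1)[OF assms(2) fg] by (simp add: algebra_simps)
    show "a * u (\<lambda>x. f x * g x) + b * w (\<lambda>x. f x * g x) =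
        f p * (a * u g + b * w g) + g p * (a * u f + b * w f)"
      using tangentD(3)[OF assms(1) fg] tangentD(3)[OF assms(2) fg] by (simp add: algebra_simps)
    assume ev: "\<forall>\<^sub>F x in nhds p. f x = g x"
    have "u f = u g"
      by (rule U[THEN conjunct2, THEN conjunct2, THEN conjunct2, THEN conjunct1, rule_format, OF fg ev])
    moreover have "w f = w g"
      by (rule W[THEN conjunct2, THEN conjunct2, THEN conjunct2, THEN conjunct1, rule_format, OF fg ev])
    ultimately show "a * u f + b * w f = a * u g + b * w g" by simp
  next
    fix c f assume f: "f \<in> stalk \<O> p"
    show "a * u (\<lambda>x. c * f x) + b * w (\<lambda>x. c * f x) = c * (a * u f + b * w f)"
      using tangentD(2)[OF assms(1) f] tangentD(2)[OF assms(2) f] by (simp add: algebra_simps)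
  next
    fix f assume f: "f \<notin> stalk \<O> p"
    show "a * u f + b * w f = 0" using tangentD(5)[OF assms(1) f] tangentD(5)[OF assms(2) f] by simp
  qed
qed

lemma tangent_space_zero: "(\<lambda>_. 0) \<in> tangent_space p"
  unfolding tangent_space_def by simp

lemma tangent_space_sum:
  "(\<And>i. i \<in> X \<Longrightarrow> u i \<in> tangent_space p) \<Longrightarrow> (\<lambda>g. \<Sum>i\<in>X. c i * u i g) \<in> tangent_space p"
proof (induction X rule: infinite_finite_induct)
  case (insert i X)
  then have "(\<lambda>g. c i * u i g + 1 * (\<Sum>i\<in>X. c i * u i g)) \<in> tangent_space p"
    by (intro tangent_space_lincomb) auto
  then show ?case using insert by simp
qed (simp_all add: tangent_space_zero)

section \<open>Functions and vector fields in affine charts\<close>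

lemma holo_on_compose_map:
  assumes g: "holo_on T g" and \<phi>: "\<And>i. holo_on S (\<lambda>z. \<phi> z $ i)" and sub: "\<And>z. z \<in> S \<Longrightarrow> \<phi> z \<in> T"
  shows "holo_on S (\<lambda>z. g (\<phi> z))"
  unfolding holo_on_def
proof
  fix z assume z: "z \<in> S"
  let ?L = "\<lambda>v. \<chi> i. dirder (\<lambda>z. \<phi> z $ i) z v"
  have "((\<lambda>z. \<chi> i. \<phi> z $ i) has_derivative ?L) (at z)"
    by (rule has_derivative_vec_lambda[OF holo_on_derivative(1)[OF \<phi> z]])
  then have "(\<phi> has_derivative ?L) (at z)" by simp
  from has_derivative_compose[OF this holo_on_derivative(1)[OF g sub[OF z]]]
  have "((\<lambda>z. g (\<phi> z)) has_derivative (\<lambda>v. dirder g (\<phi> z) (?L v))) (at z)" .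
  moreover have "?L (c *s v) = c *s ?L v" for c v
    by (simp add: vec_eq_iff holo_on_derivative(2)[OF \<phi> z])
  ultimately show "\<exists>f'. ((\<lambda>z. g (\<phi> z)) has_derivative f') (at z) \<and> (\<forall>c v. f' (c *s v) = c * f' v)"
    using holo_on_derivative(2)[OF g sub[OF z]] by auto
qed

lemma open_punctured_cone: "open U \<Longrightarrow> open (punctured_cone U)"
  by (simp add: open_proj_def)

lemma structure_sheafI:
  assumes "open U" "holo_on (punctured_cone U) h" "\<And>z. z \<in> punctured_cone U \<Longrightarrow> f (abs_proj z) = h z"
  shows "f \<in> \<O> U"
  unfolding structure_sheaf_def mem_Collect_eq
  by (rule holo_on_cong[OF open_punctured_cone[OF assms(1)] assms(2)]) (simp add: assms(3))

definition descend :: "(complex ^ 'i::finite \<Rightarrow> complex) \<Rightarrow> 'i proj \<Rightarrow> complex"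
  where "descend h p = h (rep_proj p)"

lemma descend_abs_proj:
  assumes "z \<noteq> 0" "\<And>c. c \<noteq> 0 \<Longrightarrow> h (c *s z) = h z"
  shows "descend h (abs_proj z) = h z"
  by (rule rep_abs_proj[OF assms(1)]) (simp add: descend_def assms(2))

definition chart :: "'i \<Rightarrow> complex ^ 'i::finite \<Rightarrow> complex ^ 'i"
  where "chart j z = inverse (z $ j) *s z"

lemma chart_smult: "c \<noteq> 0 \<Longrightarrow> chart j (c *s z) = chart j z"
  by (simp add: chart_def vec_eq_iff)

lemma holo_on_chart: "(\<And>z. z \<in> S \<Longrightarrow> z $ j \<noteq> 0) \<Longrightarrow> holo_on S (\<lambda>z. chart j z $ i)"
  unfolding chart_def vector_smult_component
  by (intro holo_on_mult holo_on_inverse holo_on_coord)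

lemma abs_proj_chart: "z $ j \<noteq> 0 \<Longrightarrow> abs_proj (chart j z) = abs_proj z"
  unfolding chart_def by (rule abs_proj_smult') simp

definition chart_dom :: "'i \<Rightarrow> 'i::finite proj set"
  where "chart_dom j = {p. rep_proj p $ j \<noteq> 0}"

lemma chart_dom_iff:
  assumes "z \<noteq> 0" shows "abs_proj z \<in> chart_dom j \<longleftrightarrow> z $ j \<noteq> 0"
  by (rule rep_abs_proj[OF assms]) (simp add: chart_dom_def)

lemma punctured_cone_chart_dom: "punctured_cone (chart_dom j) = {z. z $ j \<noteq> 0}"
proof (rule set_eqI)
  fix z show "z \<in> punctured_cone (chart_dom j) \<longleftrightarrow> z \<in> {z. z $ j \<noteq> 0}"
    by (cases "z = 0") (simp_all add: punctured_cone_iff chart_dom_iff)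
qed

lemma open_chart_dom: "open (chart_dom j)"
proof -
  have "open {z :: complex ^ 'a. z $ j \<noteq> 0}"
    by (intro open_Collect_neq continuous_intros)
  then show ?thesis by (simp add: open_proj_def punctured_cone_chart_dom)
qed

text \<open>In a chart, expand the function by Hadamard's lemma.\<close>

theorem tangent_space_tvec:
  assumes z: "z \<noteq> 0" and \<delta>: "\<delta> \<in> tangent_space (abs_proj z)"
  shows "\<exists>v. \<delta> = tvec z v"
proof -
  let ?p = "abs_proj z"
  obtain j where j: "z $ j \<noteq> 0" using z by (auto simp: vec_eq_iff)
  define s0 where "s0 = chart j z"
  have s0: "s0 \<noteq> 0" "abs_proj s0 = ?p"
    using j z abs_proj_chart[OF j] by (auto simp: s0_def chart_def vec_eq_iff)
  \<comment> \<open>The affine coordinates of the chart, centred at the point; their images under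
    the derivation determine it.\<close>
  define x where "x = (\<lambda>i. descend (\<lambda>w. chart j w $ i - s0 $ i))"
  have x: "x i (abs_proj w) = chart j w $ i - s0 $ i" if "w \<noteq> 0" for i w
    unfolding x_def using that by (intro descend_abs_proj) (simp_all add: chart_smult)
  have "x i \<in> \<O> (chart_dom j)" for i
  proof (rule structure_sheafI[OF open_chart_dom])
    show "holo_on (punctured_cone (chart_dom j)) (\<lambda>w. chart j w $ i + (- s0 $ i))"
      unfolding punctured_cone_chart_dom by (intro holo_on_add holo_on_chart holo_on_const) simp
    fix w assume "w \<in> punctured_cone (chart_dom j)"
    then show "x i (abs_proj w) = chart j w $ i + (- s0 $ i)" by (simp add: punctured_cone_iff x)
  qed
  then have x_stalk: "x i \<in> stalk \<O> ?p" for i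
    using stalkI[where S = \<O>, OF open_chart_dom[of j], of ?p] chart_dom_iff[OF z] j by blast
  define v where "v = (\<chi> i. \<delta> (x i))"
  have "\<delta> f = tvec s0 v f" for f
  proof (cases "f \<in> stalk \<O> ?p")
    case False
    then show ?thesis using tangentD(5)[OF \<delta>] s0(2) by (simp add: tvec_def)
  next
    case True
    then obtain U where U: "open U" "?p \<in> U" "f \<in> \<O> U" unfolding stalk_def by blast
    define F where "F = (\<lambda>w. f (abs_proj w))"
    have hF: "holo_on (punctured_cone U) F" unfolding F_def by (rule structure_sheafD[OF U(3)])
    have s0U: "s0 \<in> punctured_cone U" using s0 U(2) by (simp add: punctured_cone_iff)
    obtain r where r: "r > 0" "ball s0 r \<subseteq> punctured_cone U"
      using open_punctured_cone[OF U(1)] s0U openE by blast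
    obtain g where g: "\<And>i. holo_on (ball s0 r) (g i)" "\<And>i. g i s0 = dirder F s0 (axis i 1)"
      "\<And>s. s \<in> ball s0 r \<Longrightarrow> F s = F s0 + (\<Sum>i\<in>UNIV. (s $ i - s0 $ i) * g i s)"
      using holo_on_Hadamard[OF holo_on_subset[OF hF r(2)] r(1)] by blast
    \<comment> \<open>The neighbourhood on which the Hadamard expansion on the ball can be pulled
      back by the chart.\<close>
    define N where "N = {p \<in> chart_dom j. chart j (rep_proj p) \<in> ball s0 r}"
    have coneN: "punctured_cone N = {w. w $ j \<noteq> 0} \<inter> chart j -` ball s0 r"
    proof -
      have "w \<in> punctured_cone N \<longleftrightarrow> w $ j \<noteq> 0 \<and> chart j w \<in> ball s0 r" for w
      proof (cases "w = 0")
        case False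
        obtain c where "c \<noteq> 0" "rep_proj (abs_proj w) = c *s w" by (rule rep_abs_proj[OF False])
        then have "chart j (rep_proj (abs_proj w)) = chart j w" by (simp add: chart_smult)
        then show ?thesis using False by (simp add: punctured_cone_iff N_def chart_dom_iff)
      qed (simp add: punctured_cone_iff)
      then show ?thesis by blast
    qed
    have "continuous_on {w. w $ j \<noteq> 0} (chart j)"
      unfolding chart_def by (intro continuous_on_smult_vec continuous_intros) auto
    moreover have "open {w :: complex ^ 'a. w $ j \<noteq> 0}" by (intro open_Collect_neq continuous_intros)
    ultimately have "open (punctured_cone N)"
      unfolding coneN by (rule continuous_open_preimage) simp
    then have openN: "open N" by (simp add: open_proj_def)
    have pN: "?p \<in> N"
    proof -
      have "z \<in> punctured_cone N" unfolding coneN using j r(1) s0_def by simp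
      then show ?thesis by (simp add: punctured_cone_iff)
    qed
    define G where "G = (\<lambda>i. descend (\<lambda>w. g i (chart j w)))"
    have G: "G i (abs_proj w) = g i (chart j w)" if "w \<noteq> 0" for i w
      unfolding G_def using that by (intro descend_abs_proj) (simp_all add: chart_smult)
    have "holo_on (punctured_cone N) (\<lambda>w. g i (chart j w))" for i
      by (rule holo_on_compose_map[OF g(1) holo_on_chart]) (auto simp: coneN)
    then have "G i \<in> \<O> N" for i
      by (rule structure_sheafI[OF openN]) (auto simp: G punctured_cone_iff)
    then have G_stalk: "G i \<in> stalk \<O> ?p" for i using stalkI[where S = \<O>, OF openN pN] by blast
    have xG: "(\<lambda>q. x i q * G i q) \<in> stalk \<O> ?p" for i by (rule stalk_O_ops(2)[OF x_stalk G_stalk])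
    have sum: "(\<lambda>q. \<Sum>i\<in>UNIV. x i q * G i q) \<in> stalk \<O> ?p" by (intro stalk_O_sum xG)
    \<comment> \<open>The Hadamard expansion, transported to projective space. As every
      \<open>x i\<close> vanishes at the point, the product rule leaves only the images of the
      \<open>x i\<close> times the values of the \<open>G i\<close>.\<close>
    have "f q = F s0 + (\<Sum>i\<in>UNIV. x i q * G i q)" if "q \<in> N" for q
    proof -
      let ?w = "rep_proj q"
      have w: "?w \<in> punctured_cone N" using that by (rule rep_proj_in_cone)
      have "f q = F (chart j ?w)"
        unfolding F_def using abs_proj_chart[of ?w j] w by (simp add: coneN rep_proj)
      also have "\<dots> = F s0 + (\<Sum>i\<in>UNIV. (chart j ?w $ i - s0 $ i) * g i (chart j ?w))"
        by (rule g(3)) (use w in \<open>simp add: coneN\<close>)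
      also have "\<dots> = F s0 + (\<Sum>i\<in>UNIV. x i q * G i q)"
        using x[OF rep_proj(1), of _ q] G[OF rep_proj(1), of _ q] by (simp add: rep_proj)
      finally show ?thesis .
    qed
    then have "\<delta> f = \<delta> (\<lambda>q. F s0 + (\<Sum>i\<in>UNIV. x i q * G i q))"
      by (rule tangentD(4)[OF \<delta> True stalk_O_ops(1)[OF stalk_O_const sum] openN pN])
    also have "\<dots> = (\<Sum>i\<in>UNIV. \<delta> (\<lambda>q. x i q * G i q))"
      using tangentD(1)[OF \<delta> stalk_O_const sum] tangent_const[OF \<delta>] tangent_sum[OF \<delta>, of UNIV "\<lambda>i q. x i q * G i q"] xG
      by simp
    also have "\<dots> = (\<Sum>i\<in>UNIV. v $ i * dirder F s0 (axis i 1))"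
    proof (rule sum.cong[OF refl])
      fix i
      have "x i ?p = 0" using x[OF z, of i] by (simp add: s0_def)
      moreover have "G i ?p = dirder F s0 (axis i 1)" using G[OF z, of i] g(2) by (simp add: s0_def)
      ultimately show "\<delta> (\<lambda>q. x i q * G i q) = v $ i * dirder F s0 (axis i 1)"
        using tangentD(3)[OF \<delta> x_stalk G_stalk, of i i] by (simp add: v_def)
    qed
    also have "\<dots> = dirder F s0 v" by (rule dirder_expand[OF hF s0U, symmetric])
    also have "\<dots> = tvec s0 v f" using tvec_in_O[OF U(1,3) s0U] by (simp add: F_def)
    finally show ?thesis .
  qed
  then have "\<delta> = tvec s0 v" by blast
  \<comment> \<open>From the normalized representative \<open>s0\<close> back to the given
    \<open>z\<close>.\<close>
  also have "\<dots> = tvec (z $ j *s s0) (z $ j *s v)" by (rule tvec_rescale[OF j s0(1), symmetric])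
  also have "z $ j *s s0 = z" using j by (simp add: s0_def chart_def)
  finally show ?thesis by blast
qed

text \<open>Computed at the chosen representative, hence a genuine descent only for fields
  homogeneous of degree 1; by \<open>tvec_rescale\<close> these have the same image at all
  representatives.\<close>

definition descend_field :: "(complex ^ 'i::finite \<Rightarrow> complex ^ 'i) \<Rightarrow> 'i vfield"
  where "descend_field Y p = tvec (rep_proj p) (Y (rep_proj p))"

lemma descend_field_abs_proj:
  assumes "z \<noteq> 0" "\<And>c. c \<noteq> 0 \<Longrightarrow> Y (c *s z) = c *s Y z"
  shows "descend_field Y (abs_proj z) = tvec z (Y z)"
  by (rule rep_abs_proj[OF assms(1)]) (simp add: descend_field_def assms tvec_rescale)

lemma descend_field_section:
  assumes U: "open U" and holo: "\<And>i. holo_on (punctured_cone U) (\<lambda>z. Y z $ i)"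
    and hom: "\<And>c z. z \<in> punctured_cone U \<Longrightarrow> c \<noteq> 0 \<Longrightarrow> Y (c *s z) = c *s Y z"
  shows "descend_field Y \<in> \<T> U"
  unfolding tangent_sheaf_def mem_Collect_eq
proof (intro conjI ballI allI impI)
  fix p
  show "descend_field Y p \<in> tangent_space p"
    unfolding descend_field_def using tvec_tangent[OF rep_proj(1), of p] by (simp add: rep_proj)
next
  fix V f assume V: "open V" "V \<subseteq> U" and f: "f \<in> \<O> V"
  let ?F = "\<lambda>w. f (abs_proj w)"
  have "holo_on (punctured_cone V) (\<lambda>z. \<Sum>i\<in>UNIV. Y z $ i * dirder ?F z (axis i 1))"
    by (intro holo_on_sum holo_on_mult holo_on_dirder open_punctured_cone V structure_sheafD f
        holo_on_subset[OF holo punctured_cone_mono])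
  then show "(\<lambda>p. descend_field Y p f) \<in> \<O> V"
  proof (rule structure_sheafI[OF V(1)])
    fix z assume z: "z \<in> punctured_cone V"
    then have zU: "z \<in> punctured_cone U" using V punctured_cone_mono by blast
    then have "descend_field Y (abs_proj z) = tvec z (Y z)"
      by (intro descend_field_abs_proj hom) (auto simp: punctured_cone_iff)
    then have "descend_field Y (abs_proj z) f = dirder ?F z (Y z)" using tvec_in_O[OF V(1) f z] by simp
    then show "descend_field Y (abs_proj z) f = (\<Sum>i\<in>UNIV. Y z $ i * dirder ?F z (axis i 1))"
      using dirder_expand[OF structure_sheafD[OF f] z] by metis
  qed
qed

section \<open>Coefficients of twisted forms\<close>

lemma twisted_form_linear:
  assumes \<omega>: "\<omega> \<in> twisted_forms q k UNIV" and z: "z \<noteq> 0"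
    and len: "length xs + Suc (length ys) = q"
    and xs: "set xs \<subseteq> tangent_space (abs_proj z)" and ys: "set ys \<subseteq> tangent_space (abs_proj z)"
    and u: "u \<in> tangent_space (abs_proj z)" and w: "w \<in> tangent_space (abs_proj z)"
  shows "\<omega> z (xs @ (\<lambda>g. a * u g + b * w g) # ys) = a * \<omega> z (xs @ u # ys) + b * \<omega> z (xs @ w # ys)"
proof -
  let ?vs = "xs @ u # ys"
  have z': "z \<in> punctured_cone UNIV" using z by (simp add: punctured_cone_iff)
  have "?vs \<in> tangent_lists q (abs_proj z)" using len xs ys u by (auto simp: tangent_lists_def)
  moreover have "length xs < q" using len by simp
  ultimately have "\<omega> z (?vs[length xs := (\<lambda>g. a * u g + b * w g)]) =
      a * \<omega> z (?vs[length xs := u]) + b * \<omega> z (?vs[length xs := w])"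
    using \<omega> z' u w unfolding twisted_forms_def by blast
  then show ?thesis by simp
qed

lemma twisted_form_smult_slot:
  assumes "\<omega> \<in> twisted_forms q k UNIV" "z \<noteq> 0" "length xs + Suc (length ys) = q"
    "set xs \<subseteq> tangent_space (abs_proj z)" "set ys \<subseteq> tangent_space (abs_proj z)"
    "u \<in> tangent_space (abs_proj z)"
  shows "\<omega> z (xs @ (\<lambda>g. a * u g) # ys) = a * \<omega> z (xs @ u # ys)"
  using twisted_form_linear[OF assms(1-6) assms(6), of a 0] by simp

lemma twisted_form_zero_slot:
  assumes "\<omega> \<in> twisted_forms q k UNIV" "z \<noteq> 0" "length xs + Suc (length ys) = q"
    "set xs \<subseteq> tangent_space (abs_proj z)" "set ys \<subseteq> tangent_space (abs_proj z)"
  shows "\<omega> z (xs @ (\<lambda>g. 0) # ys) = 0"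
  using twisted_form_smult_slot[OF assms tangent_space_zero, of 0] by simp

lemma twisted_form_sum_slot:
  assumes \<omega>: "\<omega> \<in> twisted_forms q k UNIV" "z \<noteq> 0" "length xs + Suc (length ys) = q"
    "set xs \<subseteq> tangent_space (abs_proj z)" "set ys \<subseteq> tangent_space (abs_proj z)"
  shows "(\<And>i. i \<in> X \<Longrightarrow> u i \<in> tangent_space (abs_proj z)) \<Longrightarrow>
    \<omega> z (xs @ (\<lambda>g. \<Sum>i\<in>X. c i * u i g) # ys) = (\<Sum>i\<in>X. c i * \<omega> z (xs @ u i # ys))"
proof (induction X rule: infinite_finite_induct)
  case (insert i X)
  have "\<omega> z (xs @ (\<lambda>g. c i * u i g + 1 * (\<Sum>i\<in>X. c i * u i g)) # ys) =
      c i * \<omega> z (xs @ u i # ys) + 1 * \<omega> z (xs @ (\<lambda>g. \<Sum>i\<in>X. c i * u i g) # ys)"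
    by (rule twisted_form_linear[OF \<omega>]) (simp_all add: insert.prems tangent_space_sum)
  then show ?case using insert by simp
qed (use twisted_form_zero_slot[OF \<omega>] in simp_all)

lemma twisted_form_smult_all:
  assumes \<omega>: "\<omega> \<in> twisted_forms q k UNIV" "z \<noteq> 0"
  shows "length xs + length ys = q \<Longrightarrow> set xs \<subseteq> tangent_space (abs_proj z) \<Longrightarrow>
    set ys \<subseteq> tangent_space (abs_proj z) \<Longrightarrow>
    \<omega> z (xs @ map (\<lambda>u g. c * u g) ys) = c ^ length ys * \<omega> z (xs @ ys)"
proof (induction ys arbitrary: xs)
  case (Cons u ys)
  have cu: "(\<lambda>g. c * w g) \<in> tangent_space (abs_proj z)" if "w \<in> tangent_space (abs_proj z)" for w
    using tangent_space_lincomb[OF that that, of c 0] by simp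
  have "\<omega> z (xs @ map (\<lambda>u g. c * u g) (u # ys)) = c * \<omega> z (xs @ u # map (\<lambda>u g. c * u g) ys)"
    using Cons.prems cu by (simp, intro twisted_form_smult_slot[OF \<omega>]) auto
  also have "\<omega> z (xs @ u # map (\<lambda>u g. c * u g) ys) = c ^ length ys * \<omega> z (xs @ u # ys)"
    using Cons.IH[of "xs @ [u]"] Cons.prems by simp
  finally show ?case by simp
qed simp

text \<open>The arguments are expanded one slot at a time, while \<open>xs\<close> holds the fixed
  ones. A general index set \<open>K\<close> admits spanning families smaller than all basis
  vectors.\<close>

lemma twisted_form_vanishI:
  assumes \<omega>: "\<omega> \<in> twisted_forms q k UNIV" "z \<noteq> 0"
    and b: "\<And>i. i \<in> K \<Longrightarrow> b i \<in> tangent_space (abs_proj z)"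
    and span: "\<And>u. u \<in> tangent_space (abs_proj z) \<Longrightarrow> \<exists>c. u = (\<lambda>g. \<Sum>i\<in>K. c i * b i g)"
  shows "length xs + length us = q \<Longrightarrow> set xs \<subseteq> tangent_space (abs_proj z) \<Longrightarrow>
    set us \<subseteq> tangent_space (abs_proj z) \<Longrightarrow>
    (\<And>is. length is = length us \<Longrightarrow> set is \<subseteq> K \<Longrightarrow> \<omega> z (xs @ map b is) = 0) \<Longrightarrow> \<omega> z (xs @ us) = 0"
proof (induction us arbitrary: xs)
  case Nil
  then show ?case using Nil.prems(4)[of "[]"] by simp
next
  case (Cons u us)
  obtain c where c: "u = (\<lambda>g. \<Sum>i\<in>K. c i * b i g)" using span[of u] Cons.prems(3) by auto
  have "\<omega> z (xs @ u # us) = (\<Sum>i\<in>K. c i * \<omega> z (xs @ b i # us))"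
    unfolding c by (rule twisted_form_sum_slot[OF \<omega>]) (use Cons.prems b in auto)
  also have "\<omega> z (xs @ b i # us) = 0" if "i \<in> K" for i
    using Cons.IH[of "xs @ [b i]"] Cons.prems(1-3) Cons.prems(4)[of "i # js" for js] b[OF that] that by auto
  then have "(\<Sum>i\<in>K. c i * \<omega> z (xs @ b i # us)) = 0" by simp
  finally show ?case by simp
qed

abbreviation basis_tvec :: "complex ^ 'i::finite \<Rightarrow> 'i \<Rightarrow> 'i tangent"
  where "basis_tvec z i \<equiv> tvec z (axis i 1)"

text \<open>The coefficients of the pullback of \<open>\<omega>\<close> to the cone with respect to
  the coordinate differentials.\<close>

definition coefficient :: "'i::finite form \<Rightarrow> 'i list \<Rightarrow> complex ^ 'i \<Rightarrow> complex"
  where "coefficient \<omega> is z = \<omega> z (map (basis_tvec z) is)"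

text \<open>Rescaling the point by \<open>c\<close> divides the image of each basis vector by
  \<open>c\<close>, so the \<open>q\<close> slots lower the twist \<open>k\<close> by
  \<open>q\<close>.\<close>

lemma coefficient_homogeneous:
  fixes \<omega> :: "'i::finite form"
  assumes \<omega>: "\<omega> \<in> twisted_forms q k UNIV" and len: "length is = q"
  shows "homogeneous_holo (coefficient \<omega> is) (k - int q)"
proof
  fix c :: complex and z :: "complex ^ 'i" assume cz: "c \<noteq> 0" "z \<noteq> 0"
  have tl: "map (basis_tvec z) is \<in> tangent_lists q (abs_proj z)"
    using tvec_tangent[OF cz(2)] len by (auto simp: tangent_lists_def)
  have "basis_tvec (c *s z) = (\<lambda>i g. inverse c * basis_tvec z i g)"
  proof
    fix i :: 'i
    have "(axis i 1 :: complex ^ 'i) = c *s (inverse c *s axis i 1)" using cz(1) by (simp add: vec_eq_iff)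
    then have "basis_tvec (c *s z) i = tvec (c *s z) (c *s (inverse c *s axis i 1))" by simp
    also have "\<dots> = tvec z (inverse c *s axis i 1)" by (rule tvec_rescale[OF cz])
    finally show "basis_tvec (c *s z) i = (\<lambda>g. inverse c * basis_tvec z i g)"
      using tvec_smult[OF cz(2)] by simp
  qed
  then have map_eq: "map (basis_tvec (c *s z)) is = map (\<lambda>u g. inverse c * u g) (map (basis_tvec z) is)"
    by simp
  have tl': "map (basis_tvec (c *s z)) is \<in> tangent_lists q (abs_proj z)"
    using tvec_tangent[of "c *s z"] cz len by (auto simp: tangent_lists_def abs_proj_smult)
  have "coefficient \<omega> is (c *s z) = c powi k * \<omega> z (map (basis_tvec (c *s z)) is)"
    using \<omega> tl' cz unfolding coefficient_def twisted_forms_def punctured_cone_def by blast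
  also have "\<omega> z (map (basis_tvec (c *s z)) is) = inverse c ^ q * coefficient \<omega> is z"
    unfolding map_eq coefficient_def
    using twisted_form_smult_all[OF \<omega> cz(2), of "[]" "map (basis_tvec z) is" "inverse c"] tl len
    by (simp add: tangent_lists_def)
  finally show "coefficient \<omega> is (c *s z) = c powi (k - int q) * coefficient \<omega> is z"
    using cz by (simp add: power_int_diff power_inverse field_simps)
next
  show "holo_on (- {0}) (coefficient \<omega> is)"
  proof (rule holo_on_cong_local)
    fix z0 :: "complex ^ 'i" assume "z0 \<in> - {0}"
    then obtain j where j: "z0 $ j \<noteq> 0" by (auto simp: vec_eq_iff)
    \<comment> \<open>A constant field on the cone does not descend, but its product with a
      coordinate does; the \<open>q\<close> surplus factors are divided out where that coordinate is
      nonzero.\<close>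
    let ?Y = "\<lambda>i z. z $ j *s axis i 1 :: complex ^ 'i"
    define Xs where "Xs = map (\<lambda>i. descend_field (?Y i)) is"
    have "descend_field (?Y i) \<in> \<T> UNIV" for i
    proof (rule descend_field_section)
      show "holo_on (punctured_cone UNIV) (\<lambda>z. ?Y i z $ l)" for l
        unfolding vector_smult_component by (intro holo_on_mult holo_on_coord holo_on_const)
    qed (auto simp: vec_eq_iff)
    then have Xs: "set Xs \<subseteq> \<T> UNIV" by (auto simp: Xs_def)
    have "length Xs = q" using len by (simp add: Xs_def)
    then have "holo_on (punctured_cone UNIV) (\<lambda>z. \<omega> z (map (\<lambda>X. X (abs_proj z)) Xs))"
      using \<omega>[unfolded twisted_forms_def mem_Collect_eq, THEN conjunct2, rule_format, of UNIV Xs] Xs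
      by simp
    then have 1: "holo_on {z. z $ j \<noteq> 0} (\<lambda>z. \<omega> z (map (\<lambda>X. X (abs_proj z)) Xs))"
      by (rule holo_on_subset) (auto simp: punctured_cone_iff)
    have 2: "holo_on {z. z $ j \<noteq> 0} (\<lambda>z. inverse (z $ j) ^ q * \<omega> z (map (\<lambda>X. X (abs_proj z)) Xs))"
      by (intro holo_on_mult holo_on_power holo_on_inverse holo_on_coord 1) auto
    have 3: "inverse (z $ j) ^ q * \<omega> z (map (\<lambda>X. X (abs_proj z)) Xs) = coefficient \<omega> is z"
      if "z $ j \<noteq> 0" for z
    proof -
      have z: "z \<noteq> 0" using that by auto
      have "map (\<lambda>X. X (abs_proj z)) Xs = map (\<lambda>u g. z $ j * u g) (map (basis_tvec z) is)"
        unfolding Xs_def by (simp add: descend_field_abs_proj[OF z] tvec_smult[OF z] vector_smult_assoc)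
      then have "\<omega> z (map (\<lambda>X. X (abs_proj z)) Xs) = (z $ j) ^ q * coefficient \<omega> is z"
        using twisted_form_smult_all[OF \<omega> z, of "[]" "map (basis_tvec z) is" "z $ j"] len
          tvec_tangent[OF z] by (auto simp: coefficient_def)
      then show ?thesis using that by (simp add: field_simps)
    qed
    have "open {z :: complex ^ 'i. z $ j \<noteq> 0}" by (intro open_Collect_neq continuous_intros)
    then show "\<exists>T g. open T \<and> z0 \<in> T \<and> holo_on T g \<and> (\<forall>w\<in>T. g w = coefficient \<omega> is w)"
      using j 2 3 by (intro exI[of _ "{z. z $ j \<noteq> 0}"] exI[of _
        "\<lambda>z. inverse (z $ j) ^ q * \<omega> z (map (\<lambda>X. X (abs_proj z)) Xs)"] conjI) auto
  qed
qed

section \<open>The bivector of a form of codimension two\<close>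

definition enum_list :: "'i::finite list"
  where "enum_list = (SOME xs. distinct xs \<and> set xs = UNIV)"

lemma enum_list: "distinct (enum_list :: 'i::finite list)" "set (enum_list :: 'i list) = UNIV"
proof -
  have "\<exists>xs :: 'i list. distinct xs \<and> set xs = UNIV"
    using finite_distinct_list[OF finite_class.finite_UNIV] by blast
  from someI_ex[OF this] show "distinct (enum_list :: 'i list)" "set (enum_list :: 'i list) = UNIV"
    unfolding enum_list_def by blast+
qed

lemma length_enum_list: "length (enum_list :: 'i::finite list) = CARD('i)"
proof -
  have "card (set (enum_list :: 'i list)) = length (enum_list :: 'i list)"
    by (rule distinct_card[OF enum_list(1)])
  then show ?thesis by (simp add: enum_list(2))
qed

lemma permutation_of_list:
  assumes "distinct xs" "set xs = (UNIV :: 'i::finite set)"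
  shows "\<exists>\<pi>. \<pi> permutes UNIV \<and> map \<pi> (enum_list :: 'i list) = xs"
proof -
  have len: "length xs = length (enum_list :: 'i list)"
    using distinct_card[OF assms(1)] by (simp add: assms(2) length_enum_list)
  define \<pi> where "\<pi> = (\<lambda>x. the (map_of (zip (enum_list :: 'i list) xs) x))"
  have map: "map \<pi> enum_list = xs"
    by (rule nth_equalityI)
      (simp_all add: len \<pi>_def map_of_zip_nth[OF len[symmetric] enum_list(1)])
  have "set (map \<pi> enum_list) = UNIV" using map assms(2) by simp
  then have "surj \<pi>" by (simp add: enum_list(2))
  then have "bij \<pi>" using finite_UNIV_surj_inj[of \<pi>] by (simp add: bij_def)
  then have "\<pi> permutes UNIV" by (rule bij_imp_permutes) simp
  then show ?thesis using map by blast
qed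

text \<open>An arbitrary choice among the permutations with the prescribed first two values;
  \<open>bivector_eq\<close> shows that for alternating forms the choice is immaterial.\<close>

definition arrangement :: "'i \<Rightarrow> 'i \<Rightarrow> 'i::finite \<Rightarrow> 'i"
  where "arrangement j k = (SOME \<pi>. \<pi> permutes UNIV \<and> \<pi> (enum_list ! 0) = j \<and> \<pi> (enum_list ! 1) = k)"

text \<open>\<open>E L\<close> is the value of an alternating form on the basis vectors listed in \<open>L\<close>. The entry \<open>(j, k)\<close> of
  its Hodge dual is its value on the other basis vectors, with the sign of their arrangement after \<open>j, k\<close>.\<close>

definition bivector :: "('i::finite list \<Rightarrow> complex) \<Rightarrow> 'i \<Rightarrow> 'i \<Rightarrow> complex"
  where "bivector E j k = (if j = k then 0
    else of_int (sign (arrangement j k)) * E (map (arrangement j k) (drop 2 enum_list)))"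

lemma sign_permutes_comp:
  "p permutes (UNIV :: 'i::finite set) \<Longrightarrow> q permutes UNIV \<Longrightarrow> sign (p \<circ> q) = sign p * sign q"
  by (intro sign_compose permutes_imp_permutation[OF finite_class.finite_UNIV])

text \<open>Only lists of length \<open>q\<close> matter. They omit exactly two indices when they
  have no repetition, which is why the Hodge dual is a bivector.\<close>

locale alternating =
  fixes E :: "'i::finite list \<Rightarrow> complex" and q :: nat
  assumes card: "CARD('i) = q + 2"
    and repeated: "\<And>L. length L = q \<Longrightarrow> \<not> distinct L \<Longrightarrow> E L = 0"
    and transposed: "\<And>L a b. length L = q \<Longrightarrow> distinct L \<Longrightarrow> a \<in> set L \<Longrightarrow> b \<in> set L \<Longrightarrow> a \<noteq> b \<Longrightarrow>
      E (map (Transposition.transpose a b) L) = - E L"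
begin

lemma E_permuted:
  assumes "\<rho> permutes set L" "distinct L" "length L = q"
  shows "E (map \<rho> L) = of_int (sign \<rho>) * E L"
  using assms(1) finite_set
proof (induction rule: permutes_induct)
  case (swap a b p)
  have "inj p" using swap.hyps by (simp add: permutes_inj)
  then have "distinct (map p L)" using assms(2) by (simp add: distinct_map inj_on_def)
  moreover have "set (map p L) = set L" using swap.hyps permutes_image by simp
  ultimately have "E (map (Transposition.transpose a b) (map p L)) = - E (map p L)"
    using swap.hyps assms(3) by (intro transposed) auto
  moreover have "sign (Transposition.transpose a b \<circ> p) = - sign p"
  proof -
    have "permutation p" using permutes_imp_permutation[OF finite_set] swap.hyps by blast
    from sign_compose[OF permutation_swap_id this] show ?thesis using swap.hyps by (simp add: sign_swap_id)
  qed
  ultimately show ?case using swap.IH by (simp add: comp_def)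
qed simp

lemma enum_split: "enum_list = enum_list ! 0 # enum_list ! 1 # (drop 2 enum_list :: 'i list)"
proof -
  have len: "length (enum_list :: 'i list) = q + 2" by (simp add: length_enum_list card)
  then show ?thesis
    using Cons_nth_drop_Suc[of 0 "enum_list :: 'i list"] Cons_nth_drop_Suc[of 1 "enum_list :: 'i list"]
    by (simp add: numeral_2_eq_2)
qed

text \<open>Two arrangements that begin with \<open>j, k\<close> differ by a permutation of the
  remaining indices, whose sign enters both through the arrangement and through \<open>E\<close> and
  so cancels.\<close>

lemma bivector_eq:
  assumes \<pi>: "\<pi> permutes UNIV" and eq: "map \<pi> enum_list = j # k # L"
  shows "bivector E j k = of_int (sign \<pi>) * E L"
proof -
  let ?b = "drop 2 enum_list :: 'i list"
  have inj: "inj \<pi>" using \<pi> by (rule permutes_inj)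
  have dist: "distinct (j # k # L)" using eq[symmetric] enum_list(1) inj by (simp add: distinct_map inj_on_def)
  have full: "set (j # k # L) = UNIV"
    using eq[symmetric] enum_list(2) permutes_image[OF \<pi>] by (metis list.set_map)
  have len: "length L = q"
    using arg_cong[OF eq, of length] by (simp add: length_enum_list card)
  have \<pi>jk: "\<pi> (enum_list ! 0) = j" "\<pi> (enum_list ! 1) = k" "map \<pi> ?b = L"
    using eq by (subst (asm) enum_split, simp)+
  let ?\<sigma> = "arrangement j k"
  have "\<exists>\<pi>. \<pi> permutes UNIV \<and> \<pi> (enum_list ! 0) = j \<and> \<pi> (enum_list ! 1) = k" using \<pi> \<pi>jk by blast
  from someI_ex[OF this] have \<sigma>: "?\<sigma> permutes UNIV" "?\<sigma> (enum_list ! 0) = j" "?\<sigma> (enum_list ! 1) = k"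
    unfolding arrangement_def by blast+
  define \<rho> where "\<rho> = ?\<sigma> \<circ> inv \<pi>"
  have \<rho>: "\<rho> permutes UNIV" unfolding \<rho>_def by (intro permutes_compose permutes_inv \<pi> \<sigma>)
  have \<rho>\<pi>: "\<rho> (\<pi> x) = ?\<sigma> x" for x unfolding \<rho>_def using inj by simp
  then have \<rho>\<sigma>: "?\<sigma> = \<rho> \<circ> \<pi>" by (simp add: fun_eq_iff)
  have "\<rho> x = x" if "x \<notin> set L" for x
  proof -
    have "x = j \<or> x = k" using full that by auto
    then show ?thesis using \<rho>\<pi>[of "enum_list ! 0"] \<rho>\<pi>[of "enum_list ! 1"] \<pi>jk \<sigma> by auto
  qed
  then have \<rho>L: "\<rho> permutes set L" using \<rho> unfolding permutes_def by simp
  have "map ?\<sigma> ?b = map \<rho> L" unfolding \<rho>\<sigma> \<pi>jk(3)[symmetric] by simp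
  moreover have "E (map \<rho> L) = of_int (sign \<rho>) * E L" by (rule E_permuted[OF \<rho>L]) (use dist len in auto)
  moreover have "sign ?\<sigma> = sign \<rho> * sign \<pi>"
    unfolding \<rho>\<sigma> by (rule sign_permutes_comp[OF \<rho> \<pi>])
  moreover have "of_int (sign \<rho>) * of_int (sign \<rho>) = (1 :: complex)"
    by (simp flip: of_int_mult)
  moreover have "j \<noteq> k" using dist by auto
  ultimately show ?thesis by (simp add: bivector_def mult_ac)
qed

lemma bivector_transposed:
  assumes \<pi>: "\<pi> permutes UNIV" and eq: "map \<pi> enum_list = xs" and "a \<noteq> b"
    and eq': "map (Transposition.transpose a b) xs = j # k # L"
  shows "bivector E j k = - of_int (sign \<pi>) * E L"
proof -
  have t: "Transposition.transpose a b permutes UNIV" by (intro permutes_swap_id) auto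
  have "bivector E j k = of_int (sign (Transposition.transpose a b \<circ> \<pi>)) * E L"
    by (rule bivector_eq[OF permutes_compose[OF \<pi> t]]) (simp only: map_map[symmetric] eq eq')
  then show ?thesis using sign_permutes_comp[OF t \<pi>] \<open>a \<noteq> b\<close> by (simp add: sign_swap_id)
qed

lemma complement_list:
  fixes j k :: 'i
  assumes "j \<noteq> k"
  obtains L \<pi> where "\<pi> permutes UNIV" "map \<pi> enum_list = j # k # L" "length L = q" "distinct L"
    "set L = UNIV - {j, k}"
proof -
  obtain L where L: "distinct L" "set L = UNIV - {j, k}"
    using finite_distinct_list[of "UNIV - {j, k}"] by auto
  then have "distinct (j # k # L)" "set (j # k # L) = UNIV" using assms by auto
  from permutation_of_list[OF this] obtain \<pi> where \<pi>: "\<pi> permutes UNIV" "map \<pi> enum_list = j # k # L"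
    by (elim exE conjE)
  have "length L = q" using distinct_card[OF L(1)] L(2) assms card by (simp add: card_Diff_subset)
  with \<pi> show ?thesis using L by (rule that)
qed

lemma bivector_skew: "bivector E j k = - bivector E k j"
proof (cases "j = k")
  case False
  then obtain L \<pi> where L: "\<pi> permutes UNIV" "map \<pi> enum_list = j # k # L" "set L = UNIV - {j, k}"
    by (rule complement_list)
  have "map (Transposition.transpose j k) L = L"
    by (rule map_idI) (use L(3) in \<open>auto simp: Transposition.transpose_def\<close>)
  then have "bivector E k j = - of_int (sign \<pi>) * E L"
    by (intro bivector_transposed[OF L(1,2) False]) simp
  then show ?thesis using bivector_eq[OF L(1,2)] by simp
qed (simp add: bivector_def)

text \<open>Hodge duality loses nothing: a list without repetition is complementary to a pair, and
  its value is an entry of the bivector up to sign.\<close>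

lemma E_of_bivector:
  assumes zero: "\<And>j k. bivector E j k = 0" and L: "length L = q"
  shows "E L = 0"
proof (cases "distinct L")
  case True
  have "card (UNIV - set L) = 2" using distinct_card[OF True] L card by (simp add: card_Diff_subset)
  then obtain j k where jk: "UNIV - set L = {j, k}" "j \<noteq> k" by (auto simp: card_2_iff)
  then have "distinct (j # k # L)" "set (j # k # L) = UNIV" using True by auto
  from permutation_of_list[OF this] obtain \<pi> where "\<pi> permutes UNIV" "map \<pi> enum_list = j # k # L"
    by (elim exE conjE)
  from bivector_eq[OF this] show ?thesis using zero[of j k] by (simp add: sign_def split: if_splits)
qed (use repeated L in blast)

text \<open>The dual of the statement that contraction of \<open>E\<close> with \<open>z\<close>
  vanishes. With the indices other than \<open>i, j, k\<close> in the remaining slots only three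
  terms survive, and the three entries carry the same sign because the pairs are taken
  cyclically.\<close>

lemma bivector_radial:
  assumes z: "\<And>R. Suc (length R) = q \<Longrightarrow> (\<Sum>x\<in>UNIV. z x * E (x # R)) = 0"
    and ijk: "i \<noteq> j" "j \<noteq> k" "k \<noteq> i"
  shows "z i * bivector E j k + z j * bivector E k i + z k * bivector E i j = 0"
proof -
  obtain R where R: "distinct R" "set R = UNIV - {i, j, k}"
    using finite_distinct_list[of "UNIV - {i, j, k}"] by auto
  then have d: "distinct (i # j # k # R)" "set (i # j # k # R) = UNIV" using ijk by auto
  from permutation_of_list[OF this] obtain \<pi> where \<pi>: "\<pi> permutes UNIV" "map \<pi> enum_list = i # j # k # R"
    by (elim exE conjE)
  have len: "Suc (length R) = q"
    using arg_cong[OF \<pi>(2), of length] by (simp add: length_enum_list card)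
  have R_id: "map (Transposition.transpose a b) R = R" if "a \<in> {i, j, k}" "b \<in> {i, j, k}" for a b
  proof (rule map_idI)
    fix x assume "x \<in> set R"
    then have "x \<noteq> a" "x \<noteq> b" using that R(2) by blast+
    then show "Transposition.transpose a b x = x" by (rule transpose_apply_other)
  qed
  define s where "s = (of_int (sign \<pi>) :: complex)"
  have kij: "bivector E i j = s * E (k # R)" unfolding s_def by (rule bivector_eq[OF \<pi>])
  have t: "Transposition.transpose j k \<circ> \<pi> permutes UNIV" "Transposition.transpose i j \<circ> \<pi> permutes UNIV"
    by (intro permutes_compose[OF \<pi>(1)] permutes_swap_id; simp)+
  have s: "sign (Transposition.transpose j k \<circ> \<pi>) = - sign \<pi>" "sign (Transposition.transpose i j \<circ> \<pi>) = - sign \<pi>"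
    using sign_permutes_comp[OF permutes_swap_id \<pi>(1)] ijk by (simp_all add: sign_swap_id)
  have m1: "map (Transposition.transpose j k \<circ> \<pi>) enum_list = i # k # j # R"
    unfolding map_map[symmetric] \<pi>(2) using ijk R_id by (auto simp: Transposition.transpose_def)
  have m2: "map (Transposition.transpose i j \<circ> \<pi>) enum_list = j # i # k # R"
    unfolding map_map[symmetric] \<pi>(2) using ijk R_id by (auto simp: Transposition.transpose_def)
  have "bivector E j k = - of_int (sign (Transposition.transpose j k \<circ> \<pi>)) * E (i # R)"
    by (rule bivector_transposed[OF t(1) m1, of i j]) (use ijk R_id in \<open>auto simp: Transposition.transpose_def\<close>)
  then have jki: "bivector E j k = s * E (i # R)" by (simp add: s s_def)
  have "bivector E k i = - of_int (sign (Transposition.transpose i j \<circ> \<pi>)) * E (j # R)"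
    by (rule bivector_transposed[OF t(2) m2, of j k]) (use ijk R_id in \<open>auto simp: Transposition.transpose_def\<close>)
  then have kij': "bivector E k i = s * E (j # R)" by (simp add: s s_def)
  have "(\<Sum>x\<in>UNIV. z x * E (x # R)) = (\<Sum>x\<in>{i, j, k}. z x * E (x # R))"
  proof (rule sum.mono_neutral_right)
    show "\<forall>x\<in>UNIV - {i, j, k}. z x * E (x # R) = 0"
      using R(2) len repeated[of "x # R" for x] by auto
  qed auto
  also have "\<dots> = z i * E (i # R) + z j * E (j # R) + z k * E (k # R)" using ijk by simp
  finally have "z i * E (i # R) + z j * E (j # R) + z k * E (k # R) = 0" using z[OF len] by simp
  then have "s * (z i * E (i # R) + z j * E (j # R) + z k * E (k # R)) = 0" by simp
  then show ?thesis unfolding kij jki kij' by (simp add: algebra_simps)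
qed

text \<open>Row \<open>j\<close> of the bivector, as a vector, is annihilated by the form. For
  \<open>j\<close> outside \<open>K\<close> only the two indices in neither contribute, with
  products that cancel; with \<open>j\<close> in \<open>K\<close> there would be three, without such
  a cancellation.\<close>

lemma bivector_contraction:
  assumes K: "Suc (length K) = q" "j \<notin> set K"
  shows "(\<Sum>k\<in>UNIV. bivector E j k * E (k # K)) = 0"
proof (cases "distinct K")
  case False
  then have "E (k # K) = 0" for k using K(1) by (intro repeated) auto
  then show ?thesis by simp
next
  case True
  have "card (UNIV - set (j # K)) = 2"
    using distinct_card[of "j # K"] True K card by (simp add: card_Diff_subset)
  then obtain b c where bc: "UNIV - set (j # K) = {b, c}" "b \<noteq> c" by (auto simp: card_2_iff)
  then have nin: "b \<noteq> j" "c \<noteq> j" "b \<notin> set K" "c \<notin> set K" by auto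
  then have "distinct (j # b # c # K)" "set (j # b # c # K) = UNIV" using True bc K(2) by auto
  from permutation_of_list[OF this] obtain \<pi> where \<pi>: "\<pi> permutes UNIV" "map \<pi> enum_list = j # b # c # K"
    by (elim exE conjE)
  have "map (Transposition.transpose b c) K = K"
    by (rule map_idI) (use nin in \<open>auto simp: Transposition.transpose_def\<close>)
  then have c: "bivector E j c = - of_int (sign \<pi>) * E (b # K)"
    using nin bc(2) by (intro bivector_transposed[OF \<pi> bc(2)]) (auto simp: Transposition.transpose_def)
  have "(\<Sum>k\<in>UNIV. bivector E j k * E (k # K)) = (\<Sum>k\<in>{b, c}. bivector E j k * E (k # K))"
  proof (rule sum.mono_neutral_right)
    show "\<forall>k\<in>UNIV - {b, c}. bivector E j k * E (k # K) = 0"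
    proof
      fix k assume "k \<in> UNIV - {b, c}"
      then have "k = j \<or> k \<in> set K" using bc(1) by auto
      then show "bivector E j k * E (k # K) = 0" using K(1) repeated[of "k # K"] by (auto simp: bivector_def)
    qed
  qed auto
  also have "\<dots> = 0" using bc(2) c bivector_eq[OF \<pi>] by simp
  finally show ?thesis .
qed

end

text \<open>\<open>twisted_forms\<close> only demands zero on equal arguments; polarization gives
  the change of sign under transpositions.\<close>

lemma twisted_form_alternating:
  fixes \<omega> :: "'i::finite form"
  assumes \<omega>: "\<omega> \<in> twisted_forms q k UNIV" and z: "z \<noteq> 0" and card: "CARD('i) = q + 2"
  shows "alternating (\<lambda>is. coefficient \<omega> is z) q"
proof
  show "CARD('i) = q + 2" by (rule card)
  have eq0: "\<omega> z vs = 0"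
    if vs: "length vs = q" "set vs \<subseteq> tangent_space (abs_proj z)" and ij: "i < j" "j < q" "vs ! i = vs ! j" for vs i j
  proof -
    have "z \<in> punctured_cone UNIV" using z by (simp add: punctured_cone_iff)
    moreover have "vs \<in> tangent_lists q (abs_proj z)" using vs by (simp add: tangent_lists_def)
    ultimately show ?thesis
      using \<omega>[unfolded twisted_forms_def mem_Collect_eq, THEN conjunct1, rule_format, THEN conjunct2, THEN conjunct1]
        ij by blast
  qed
  have tan: "set (map (basis_tvec z) is) \<subseteq> tangent_space (abs_proj z)" for "is"
    using tvec_tangent[OF z] by auto
  fix L :: "'i list" assume len: "length L = q"
  show "coefficient \<omega> L z = 0" if nd: "\<not> distinct L"
  proof -
    obtain i j where "i < length L" "j < length L" "i \<noteq> j" "L ! i = L ! j"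
      using nd unfolding distinct_conv_nth by blast
    then obtain i j where "i < j" "j < length L" "L ! i = L ! j" by (metis linorder_neqE_nat)
    then show ?thesis unfolding coefficient_def using eq0[OF _ tan, of L i j] len by simp
  qed
  fix a b assume L: "distinct L" and ab: "a \<in> set L" "b \<in> set L" "a \<noteq> b"
  have antisym: "\<omega> z (xs @ u # ys @ w # zs) = - \<omega> z (xs @ w # ys @ u # zs)"
    if lq: "length xs + length ys + length zs + 2 = q"
      and T: "set xs \<subseteq> tangent_space (abs_proj z)" "set ys \<subseteq> tangent_space (abs_proj z)"
        "set zs \<subseteq> tangent_space (abs_proj z)" "u \<in> tangent_space (abs_proj z)" "w \<in> tangent_space (abs_proj z)"
    for xs ys zs u w
  proof -
    have same: "\<omega> z (xs @ v # ys @ v # zs) = 0" if "v \<in> tangent_space (abs_proj z)" for v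
      by (rule eq0[of _ "length xs" "length xs + length ys + 1"])
        (use lq T that in \<open>auto simp: nth_append\<close>)
    \<comment> \<open>The form is expanded with the sum of the two vectors in both slots; the mixed
      terms must add up to zero.\<close>
    let ?uw = "\<lambda>g. 1 * u g + 1 * w g"
    have uw: "?uw \<in> tangent_space (abs_proj z)" by (rule tangent_space_lincomb[OF T(4,5)])
    have 1: "\<omega> z (xs @ ?uw # ys @ v # zs) = 1 * \<omega> z (xs @ u # ys @ v # zs) + 1 * \<omega> z (xs @ w # ys @ v # zs)"
      if "v \<in> tangent_space (abs_proj z)" for v
      by (rule twisted_form_linear[OF \<omega> z]) (use lq T that in auto)
    have 2: "\<omega> z ((xs @ v # ys) @ ?uw # zs) = 1 * \<omega> z ((xs @ v # ys) @ u # zs) + 1 * \<omega> z ((xs @ v # ys) @ w # zs)"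
      if "v \<in> tangent_space (abs_proj z)" for v
      by (rule twisted_form_linear[OF \<omega> z]) (use lq T that in auto)
    have "0 = \<omega> z (xs @ ?uw # ys @ ?uw # zs)" using same[OF uw] by simp
    also have "\<dots> = \<omega> z (xs @ u # ys @ ?uw # zs) + \<omega> z (xs @ w # ys @ ?uw # zs)"
      using 1[OF uw] by simp
    also have "\<dots> = \<omega> z (xs @ u # ys @ w # zs) + \<omega> z (xs @ w # ys @ u # zs)"
      using 2[OF T(4)] 2[OF T(5)] same[OF T(4)] same[OF T(5)] by simp
    finally show ?thesis unfolding eq_neg_iff_add_eq_0 by (rule sym)
  qed
  have swap: "coefficient \<omega> (map (Transposition.transpose x y) L) z = - coefficient \<omega> L z"
    if dec: "L = xs @ x # ys @ y # zs" for x y xs ys zs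
  proof -
    have "map (Transposition.transpose x y) xs = xs" "map (Transposition.transpose x y) ys = ys"
      "map (Transposition.transpose x y) zs = zs"
      by (rule map_idI; use L dec in \<open>auto simp: Transposition.transpose_def\<close>)+
    then have map_eq: "map (Transposition.transpose x y) L = xs @ y # ys @ x # zs" unfolding dec by simp
    show ?thesis
      unfolding coefficient_def map_eq unfolding dec map_append list.map
      by (rule antisym) (use tan len dec tvec_tangent[OF z] in auto)
  qed
  show "coefficient \<omega> (map (Transposition.transpose a b) L) z = - coefficient \<omega> L z"
  proof -
    obtain xs ys where L1: "L = xs @ a # ys" using ab(1) by (meson split_list)
    show ?thesis
    proof (cases "b \<in> set ys")
      case True
      then obtain ys' zs where "ys = ys' @ b # zs" by (meson split_list)
      then show ?thesis using swap[of xs a ys' b zs] L1 by simp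
    next
      case False
      then have "b \<in> set xs" using ab L1 by auto
      then obtain xs' ys' where "xs = xs' @ b # ys'" by (meson split_list)
      then show ?thesis using swap[of xs' b ys' a ys] L1 by (simp add: transpose_commute)
    qed
  qed
qed

section \<open>Flags of distributions\<close>

lemma tangent_space_span:
  assumes z: "z \<noteq> 0" and u: "u \<in> tangent_space (abs_proj z)"
  shows "\<exists>c. u = (\<lambda>g. \<Sum>i\<in>UNIV. c i * basis_tvec z i g)"
proof -
  obtain v where "u = tvec z v" using tangent_space_tvec[OF z u] by blast
  then have "u = (\<lambda>g. \<Sum>i\<in>UNIV. v $ i * basis_tvec z i g)" using tvec_expand[OF z, of v] by simp
  then show ?thesis by blast
qed

text \<open>The radial relation between the images of the basis vectors has the coefficient
  \<open>z $ j\<close> at index \<open>j\<close>, so that one image can be eliminated.\<close>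

lemma tangent_space_span_chart:
  assumes j: "z $ j \<noteq> 0" and u: "u \<in> tangent_space (abs_proj z)"
  shows "\<exists>c. u = (\<lambda>g. \<Sum>i\<in>UNIV - {j}. c i * basis_tvec z i g)"
proof -
  have z: "z \<noteq> 0" using j by auto
  obtain v where v: "u = (\<lambda>g. \<Sum>i\<in>UNIV. v i * basis_tvec z i g)" using tangent_space_span[OF z u] by blast
  have rad: "(\<Sum>i\<in>UNIV. z $ i * basis_tvec z i g) = 0" for g
    using fun_cong[OF tvec_expand[OF z, of z], of g] tvec_radial[OF z] by simp
  have "u g = (\<Sum>i\<in>UNIV - {j}. (v i - v j / z $ j * z $ i) * basis_tvec z i g)" for g
  proof -
    have "u g = (\<Sum>i\<in>UNIV. v i * basis_tvec z i g) - v j / z $ j * (\<Sum>i\<in>UNIV. z $ i * basis_tvec z i g)"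
      using v rad by simp
    also have "\<dots> = (\<Sum>i\<in>UNIV. (v i - v j / z $ j * z $ i) * basis_tvec z i g)"
      unfolding sum_distrib_left sum_subtractf[symmetric] by (intro sum.cong refl) (simp add: algebra_simps)
    also have "\<dots> = (\<Sum>i\<in>UNIV - {j}. (v i - v j / z $ j * z $ i) * basis_tvec z i g)"
      using j by (intro sum.mono_neutral_right) auto
    finally show ?thesis .
  qed
  then show ?thesis by (intro exI[of _ "\<lambda>i. v i - v j / z $ j * z $ i"]) (rule ext)
qed

lemma has_rank_unique: "has_rank D r \<Longrightarrow> has_rank D s \<Longrightarrow> r = s"
  unfolding has_rank_def by (meson le_antisym)

text \<open>Identities between coefficients of forms are available only at nonzero points; this
  extends them to the origin.\<close>

lemma hpoly_eq_off_hyperplane: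
  assumes "hpoly J d f" "\<And>z. z $ j \<noteq> 0 \<Longrightarrow> f z = 0"
  shows "f z = 0"
  by (rule hpoly_eq_0_of_coord[OF assms(1), of j]) (use assms(2) in auto)

lemma coefficient_hpoly:
  fixes \<omega> :: "'i::finite form"
  assumes "\<omega> \<in> twisted_forms q k UNIV" "length is = q" "CARD('i) \<ge> 2"
  shows "\<exists>g. hpoly UNIV (k - int q) g \<and> (\<forall>z. z \<noteq> 0 \<longrightarrow> coefficient \<omega> is z = g z)"
  by (rule homogeneous_holo_hpoly[OF coefficient_homogeneous[OF assms(1,2)] assms(3)])

text \<open>By the Lindelof property of the cone over \<open>S\<close>.\<close>

lemma discrete_proj_countable_lines:
  fixes S :: "'i::finite proj set"
  assumes "discrete S"
  shows "\<exists>W. countable W \<and> 0 \<notin> W \<and> (\<forall>z. z \<noteq> 0 \<longrightarrow> abs_proj z \<in> S \<longrightarrow> (\<exists>c. \<exists>w\<in>W. z = c *s w))"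
proof -
  have "\<forall>p\<in>S. \<exists>T. open T \<and> T \<inter> S = {p}"
    using assms unfolding discrete_def isolated_in_def by blast
  from bchoice[OF this] obtain T where T: "\<forall>p\<in>S. open (T p) \<and> T p \<inter> S = {p}" ..
  let ?F = "(\<lambda>p. punctured_cone (T p)) ` S"
  obtain F' where F': "F' \<subseteq> ?F" "countable F'" "\<Union>F' = \<Union>?F"
  proof (rule Lindelof)
    show "open C" if "C \<in> ?F" for C using that T open_punctured_cone by blast
  qed
  obtain S' where S': "countable S'" "S' \<subseteq> S" "F' = (\<lambda>p. punctured_cone (T p)) ` S'"
    using F'(1,2) by (meson countable_subset_image)
  have "\<exists>c. \<exists>w\<in>rep_proj ` S'. z = c *s w" if z: "z \<noteq> 0" "abs_proj z \<in> S" for z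
  proof -
    have "abs_proj z \<in> T (abs_proj z)" using T z(2) by blast
    then have "z \<in> punctured_cone (T (abs_proj z))" using z(1) by (simp add: punctured_cone_iff)
    then have "z \<in> \<Union>F'" using F'(3) z(2) by blast
    then obtain p where p: "p \<in> S'" "z \<in> punctured_cone (T p)" using S'(3) by blast
    then have "abs_proj z \<in> T p \<inter> S" using z(2) by (simp add: punctured_cone_iff)
    then have "abs_proj z = p" using T p(1) S'(2) by blast
    then have "abs_proj (rep_proj p) = abs_proj z" by (simp add: rep_proj)
    then have "\<exists>c. z = c *s rep_proj p" using abs_proj_eq_iff[OF rep_proj(1) z(1)] by blast
    then show ?thesis using p(1) by blast
  qed
  moreover have "countable (rep_proj ` S')" using S'(1) by simp
  moreover have "0 \<notin> rep_proj ` S'" using rep_proj(1) by (metis imageE)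
  ultimately show ?thesis by (intro exI[of _ "rep_proj ` S'"]) blast
qed

text \<open>Homogeneity carries the vanishing from one representative to all others of the same
  point.\<close>

lemma vanishes_at_of_coefficients:
  fixes \<omega> :: "'i::finite form"
  assumes \<omega>: "\<omega> \<in> twisted_forms 1 k UNIV" and z: "z \<noteq> 0" and zero: "\<And>i. coefficient \<omega> [i] z = 0"
  shows "vanishes_at 1 \<omega> (abs_proj z)"
  unfolding vanishes_at_def
proof (intro ballI)
  fix z' vs assume z': "z' \<in> punctured_cone {abs_proj z}" and vs: "vs \<in> tangent_lists 1 (abs_proj z)"
  have nz: "z' \<noteq> 0" and eq: "abs_proj z = abs_proj z'" using z' by (auto simp: punctured_cone_iff)
  then obtain c where c: "z' = c *s z" using abs_proj_eq_iff[OF z nz] by blast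
  with nz have "c \<noteq> 0" by auto
  have zero': "coefficient \<omega> [i] z' = 0" for i
    using homogeneous_holo.homog[OF coefficient_homogeneous[OF \<omega>, of "[i]"] \<open>c \<noteq> 0\<close> z] zero c by simp
  have "\<omega> z' ([] @ vs) = 0"
  proof (rule twisted_form_vanishI[OF \<omega> nz, of UNIV "basis_tvec z'"])
    show "basis_tvec z' i \<in> tangent_space (abs_proj z')" for i by (rule tvec_tangent[OF nz])
    show "\<exists>c. u = (\<lambda>g. \<Sum>i\<in>UNIV. c i * basis_tvec z' i g)" if "u \<in> tangent_space (abs_proj z')" for u
      by (rule tangent_space_span[OF nz that])
    show "length [] + length vs = 1" "set vs \<subseteq> tangent_space (abs_proj z')"
      using vs eq by (auto simp: tangent_lists_def)
    fix "is" :: "'i list" assume "length is = length vs"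
    then obtain i where "is = [i]" using vs by (auto simp: tangent_lists_def length_Suc_conv)
    then show "\<omega> z' ([] @ map (basis_tvec z') is) = 0" using zero'[of i] by (simp add: coefficient_def)
  qed simp
  then show "\<omega> z' vs = 0" by simp
qed

text \<open>Two coordinate fields of an affine chart are linearly independent, since the matrix of
  their values on the corresponding affine coordinates is the identity.\<close>

lemma tangent_sheaf_not_rank_1:
  fixes D :: "'i::finite proj set \<Rightarrow> 'i vfield set"
  assumes card: "CARD('i) \<ge> 3" and D: "D UNIV = \<T> UNIV"
  shows "\<not> has_rank D 1"
proof
  assume rank: "has_rank D 1"
  obtain j :: 'i where True by simp
  have "card {j} < CARD('i)" using card by simp
  then obtain k where k: "k \<noteq> j" by (metis UNIV_eq_I insertCI less_irrefl singletonD)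
  have "card {j, k} < CARD('i)" using card k by simp
  then obtain l where l: "l \<noteq> j" "l \<noteq> k" by (metis UNIV_eq_I insertCI insertE less_irrefl singletonD)
  define m where "m = (\<lambda>n::nat. if n = 0 then k else l)"
  have mj: "m n \<noteq> j" for n using k l by (simp add: m_def)
  let ?Y = "\<lambda>n z. z $ j *s axis (m n) 1 :: complex ^ 'i"
  define s where "s = (\<lambda>n. descend_field (?Y n))"
  let ?p = "abs_proj (axis j 1 :: complex ^ 'i)"
  have s: "s n \<in> \<T> UNIV" for n
    unfolding s_def
  proof (rule descend_field_section)
    show "holo_on (punctured_cone UNIV) (\<lambda>z. ?Y n z $ i)" for i
      unfolding vector_smult_component by (intro holo_on_mult holo_on_coord holo_on_const)
  qed (auto simp: vec_eq_iff)
  define x where "x = (\<lambda>n. descend (\<lambda>w. chart j w $ m n))"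
  have x: "x n (abs_proj w) = chart j w $ m n" if "w \<noteq> 0" for n w
    unfolding x_def using that by (intro descend_abs_proj) (simp_all add: chart_smult)
  have xO: "x n \<in> \<O> (chart_dom j)" for n
  proof (rule structure_sheafI[OF open_chart_dom])
    show "holo_on (punctured_cone (chart_dom j)) (\<lambda>w. chart j w $ m n)"
      unfolding punctured_cone_chart_dom by (rule holo_on_chart) simp
  qed (simp add: punctured_cone_iff x)
  \<comment> \<open>The field differentiates one homogeneous coordinate, and its factor
    \<open>z $ j\<close> cancels the denominator of the affine coordinate.\<close>
  have sx: "s n q (x n') = of_bool (m n = m n')" if q: "q \<in> chart_dom j" for n n' q
  proof -
    let ?z = "rep_proj q"
    have z: "?z \<noteq> 0" "?z $ j \<noteq> 0" using q rep_proj(1) by (auto simp: chart_dom_def)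
    have zc: "?z \<in> punctured_cone (chart_dom j)" using q by (rule rep_proj_in_cone)
    have "s n q (x n') = tvec ?z (?z $ j *s axis (m n) 1) (x n')"
      by (simp add: s_def descend_field_def)
    also have "\<dots> = ?z $ j * tvec ?z (axis (m n) 1) (x n')"
      using tvec_smult[OF z(1)] by simp
    also have "tvec ?z (axis (m n) 1) (x n') = dirder (\<lambda>w. x n' (abs_proj w)) ?z (axis (m n) 1)"
      by (rule tvec_in_O[OF open_chart_dom xO zc])
    also have "\<dots> = inverse (?z $ j) * of_bool (m n = m n')"
    proof -
      let ?v = "axis (m n) 1 :: complex ^ 'i"
      have "((\<lambda>\<zeta>. x n' (abs_proj (?z + \<zeta> *s ?v))) has_field_derivative
          dirder (\<lambda>w. x n' (abs_proj w)) (?z + 0 *s ?v) ?v) (at 0)"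
        by (rule holo_on_line[OF structure_sheafD[OF xO]]) (use zc in simp)
      moreover have "((\<lambda>\<zeta>. x n' (abs_proj (?z + \<zeta> *s ?v))) has_field_derivative
          inverse (?z $ j) * of_bool (m n = m n')) (at 0)"
      proof -
        have "x n' (abs_proj (?z + \<zeta> *s ?v)) = inverse (?z $ j) * (?z $ m n' + \<zeta> * of_bool (m n = m n'))" for \<zeta>
        proof -
          have vj: "?v $ j = 0" using mj[of n] by (simp add: axis_def)
          then have "(?z + \<zeta> *s ?v) $ j \<noteq> 0" using z(2) by simp
          then have "?z + \<zeta> *s ?v \<noteq> 0" by (metis zero_index)
          from x[OF this] show ?thesis using vj by (auto simp: chart_def axis_def distrib_left)
        qed
        then show ?thesis by (auto intro!: derivative_eq_intros)
      qed
      ultimately show ?thesis using DERIV_unique by fastforce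
    qed
    finally show ?thesis using z(2) by simp
  qed
  have mm: "m 0 \<noteq> m 1" using l by (simp add: m_def)
  have "(axis j 1 :: complex ^ 'i) \<noteq> 0" by (simp add: axis_eq_0_iff)
  then have p: "?p \<in> chart_dom j" by (subst chart_dom_iff) (simp_all add: axis_def)
  have "germs_independent ?p 2 s"
    unfolding germs_independent_def
  proof (intro allI impI)
    fix a n assume a: "(\<forall>i<2. a i \<in> stalk \<O> ?p) \<and> (\<forall>\<^sub>F x in nhds ?p. comb 2 a s x = (\<lambda>_. 0))" and n: "n < (2::nat)"
    have "\<forall>\<^sub>F q in nhds ?p. q \<in> chart_dom j" by (rule eventually_nhds_in_open[OF open_chart_dom p])
    with a[THEN conjunct2] show "\<forall>\<^sub>F q in nhds ?p. a n q = 0"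
    proof eventually_elim
      case (elim q)
      have "comb 2 a s q (x n) = 0" using elim(1) by simp
      then have "(\<Sum>i<2. a i q * of_bool (m i = m n)) = 0" by (simp add: comb_def sx[OF elim(2)])
      moreover have "n = 0 \<or> n = 1" using n by auto
      ultimately show ?case using mm by (auto simp: numeral_2_eq_2)
    qed
  qed
  moreover have "\<forall>i<2. s i \<in> stalk D ?p"
    using s D stalkI[of UNIV ?p _ D] by simp
  ultimately have "2 \<le> (1::nat)" using rank unfolding has_rank_def by blast
  then show False by simp
qed

theorem theorem1p1:
  fixes F G :: "'i::finite proj set \<Rightarrow> 'i vfield set"
    and n :: nat and dF dG :: int
  assumes dim: "CARD('i) = n + 1" "n \<ge> 3"
    and flag: "flag [F, G]"
    and reduced: "reduced_distribution F" "reduced_distribution G"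
    and F: "distribution F 1"
    and G: "distribution G (n - 1)"
    and degrees: "has_degree F dF" "has_degree G dG"
    and "dG \<ge> 2"
    and i: "even n \<Longrightarrow> dF \<noteq> int (n div 2) * dG"
    and ii: "odd n \<Longrightarrow> dF \<noteq> int ((n - 1) div 2) * dG - 1"
    and iii: "discrete (Sing G)"
  shows "dG \<le> dF - 1"
proof (rule ccontr)
  assume "\<not> ?thesis"
  then have deg_le: "dF \<le> dG" by simp
  have card: "CARD('i) \<ge> 2" "CARD('i) \<ge> 4" "CARD('i) \<ge> 3" using dim by auto
  obtain rG qG \<omega> where \<omega>: "has_rank G rG" "rG + qG = CARD('i) - 1"
    "\<omega> \<in> twisted_forms qG (dG + int qG + 1) UNIV" "\<And>U. open U \<Longrightarrow> G U = annihilator qG \<omega> U"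
    "\<And>p. p \<notin> Sing G \<Longrightarrow> \<not> vanishes_at qG \<omega> p"
    using degrees(2) unfolding has_degree_def by blast
  obtain rF q \<eta> where \<eta>: "has_rank F rF" "1 \<le> q" "rF + q = CARD('i) - 1"
    "\<eta> \<in> twisted_forms q (dF + int q + 1) UNIV" "\<And>U. open U \<Longrightarrow> F U = annihilator q \<eta> U"
    using degrees(1) unfolding has_degree_def by blast
  have rankF: "has_rank F 1" using F by (simp add: distribution_def)
  have "has_rank G (n - 1)" using G by (simp add: distribution_def)
  \<comment> \<open>The codimension that comes with the degree is tied to the given dimension by the
    uniqueness of the rank.\<close>
  then have "qG = 1" using has_rank_unique[OF \<omega>(1)] \<omega>(2) dim by fastforce
  note \<omega> = \<omega>[unfolded this]
  have "rF = 1" by (rule has_rank_unique[OF \<eta>(1) rankF])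
  then have q: "CARD('i) = q + 2" using \<eta>(3) dim by simp
  have sub: "F U \<subseteq> G U" if "open U" for U
  proof -
    from flag[unfolded flag_def] show ?thesis
    proof (elim exE conjE)
      fix r :: "nat \<Rightarrow> nat"
      assume "\<forall>i. Suc i < length [F, G] \<longrightarrow> r i < r (Suc i) \<and>
        (\<forall>U. open U \<longrightarrow> ([F, G] ! i) U \<subseteq> ([F, G] ! Suc i) U)"
      from this[rule_format, of 0] show ?thesis using that by simp
    qed
  qed

  \<comment> \<open>The twist is \<open>dG + 2\<close>, and the single slot lowers it by
    one.\<close>
  have "\<exists>g. hpoly UNIV (dG + 1) g \<and> (\<forall>z. z \<noteq> 0 \<longrightarrow> coefficient \<omega> [i] z = g z)" for i
    using coefficient_hpoly[OF \<omega>(3), of "[i]"] card(1) by (simp add: add.commute)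
  then obtain A where A: "\<And>i. hpoly UNIV (dG + 1) (A i)" and \<omega>A: "\<And>i z. z \<noteq> 0 \<Longrightarrow> coefficient \<omega> [i] z = A i z"
    by metis
  obtain W where W: "countable W" "0 \<notin> W"
    "\<And>z. z \<noteq> 0 \<Longrightarrow> abs_proj z \<in> Sing G \<Longrightarrow> \<exists>c. \<exists>w\<in>W. z = c *s w"
    using discrete_proj_countable_lines[OF iii] by blast
  \<comment> \<open>By the last condition of \<open>has_degree\<close>, the form vanishes only over
    \<open>Sing G\<close>, and discreteness leaves countably many lines there.\<close>
  interpret isolated_zeros A "dG + 1" W
  proof
    show "0 < dG + 1" using \<open>dG \<ge> 2\<close> by simp
    fix z assume zero: "\<And>i. A i z = 0"
    show "\<exists>c. \<exists>w\<in>insert 0 W. z = c *s w"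
    proof (cases "z = 0")
      case False
      then have "vanishes_at 1 \<omega> (abs_proj z)"
        using vanishes_at_of_coefficients[OF \<omega>(3) False] \<omega>A zero by simp
      then have "abs_proj z \<in> Sing G" using \<omega>(5) by blast
      then show ?thesis using W(3)[OF False] by blast
    qed simp
  qed (use A W in auto)

  have sum_form: "\<omega> z [tvec z v] = (\<Sum>i\<in>UNIV. v $ i * A i z)" if z: "z \<noteq> 0" for z v
    unfolding tvec_expand[OF z, of v]
    using twisted_form_sum_slot[OF \<omega>(3) z, of "[]" "[]" UNIV "basis_tvec z" "\<lambda>i. v $ i"] tvec_tangent[OF z]
      \<omega>A[OF z] by (simp add: coefficient_def)
  have zA: "(\<Sum>i\<in>UNIV. z $ i * A i z) = 0" for z
  proof -
    have "hpoly UNIV (dG + 2) (\<lambda>z. \<Sum>i\<in>UNIV. z $ i * A i z)"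
      by (intro hpoly_sum hpoly_mult'[OF hpoly_coord1 A]) auto
    then show ?thesis
    proof (rule hpoly_eq_off_hyperplane)
      fix z :: "complex ^ 'i" assume "z $ undefined \<noteq> 0"
      then have z: "z \<noteq> 0" by auto
      then show "(\<Sum>i\<in>UNIV. z $ i * A i z) = 0"
        using sum_form[OF z, of z] twisted_form_zero_slot[OF \<omega>(3) z, of "[]" "[]"] tvec_radial[OF z] by simp
    qed
  qed

  \<comment> \<open>The dual bivector at each nonzero point. Its entries are coefficients of
    \<open>\<eta>\<close> up to sign, of degree \<open>dF + q + 1 - q\<close>; the matrix
    \<open>P\<close> below is the polynomial extension to the origin.\<close>
  define B where "B = (\<lambda>j k z. bivector (\<lambda>is. coefficient \<eta> is z) j k)"
  have alt: "alternating (\<lambda>is. coefficient \<eta> is z) q" if "z \<noteq> 0" for z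
    by (rule twisted_form_alternating[OF \<eta>(4) that q])
  have "\<exists>g. hpoly UNIV (dF + 1) g \<and> (\<forall>z. z \<noteq> 0 \<longrightarrow> B j k z = g z)" for j k
  proof (cases "j = k")
    case True
    then show ?thesis by (intro exI[of _ "\<lambda>_. 0"]) (simp add: B_def bivector_def hpoly_zero)
  next
    case False
    have "length (map (arrangement j k) (drop 2 (enum_list :: 'i list))) = q"
      by (simp add: length_enum_list q)
    from coefficient_hpoly[OF \<eta>(4) this card(1)] obtain g where
      "hpoly UNIV (dF + 1) g" "\<And>z. z \<noteq> 0 \<Longrightarrow> coefficient \<eta> (map (arrangement j k) (drop 2 enum_list)) z = g z"
      by (auto simp: add.commute)
    then show ?thesis using False
      by (intro exI[of _ "\<lambda>z. of_int (sign (arrangement j k)) * g z"]) (simp add: B_def bivector_def hpoly_smult)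
  qed
  then obtain P where P: "\<And>j k. hpoly UNIV (dF + 1) (P j k)" and BP: "\<And>j k z. z \<noteq> 0 \<Longrightarrow> B j k z = P j k z"
    by metis

  have skew: "P j k z = - P k j z" for j k z
  proof -
    have "hpoly UNIV (dF + 1) (\<lambda>z. P j k z + P k j z)" by (intro hpoly_add P)
    then have "P j k z + P k j z = 0"
    proof (rule hpoly_eq_off_hyperplane)
      fix z :: "complex ^ 'i" assume "z $ undefined \<noteq> 0"
      then have z: "z \<noteq> 0" by auto
      show "P j k z + P k j z = 0"
        using alternating.bivector_skew[OF alt[OF z], of j k] BP[OF z] by (simp add: B_def)
    qed
    then show ?thesis by (simp add: eq_neg_iff_add_eq_0)
  qed

  have radial: "z $ i * P j k z + z $ j * P k i z + z $ k * P i j z = 0"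
    if ijk: "i \<noteq> j" "j \<noteq> k" "k \<noteq> i" for i j k z
  proof -
    have "hpoly UNIV (dF + 2) (\<lambda>z. z $ i * P j k z + z $ j * P k i z + z $ k * P i j z)"
      by (intro hpoly_add hpoly_mult'[OF hpoly_coord1 P]) auto
    then show ?thesis
    proof (rule hpoly_eq_off_hyperplane)
      fix z :: "complex ^ 'i" assume "z $ undefined \<noteq> 0"
      then have z: "z \<noteq> 0" by auto
      \<comment> \<open>This is the form with the image of the radial vector in the first slot,
        which is zero.\<close>
      have "(\<Sum>x\<in>UNIV. z $ x * coefficient \<eta> (x # R) z) = 0" if R: "Suc (length R) = q" for R
      proof -
        have "\<eta> z ([] @ (\<lambda>g. \<Sum>x\<in>UNIV. z $ x * basis_tvec z x g) # map (basis_tvec z) R) =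
          (\<Sum>x\<in>UNIV. z $ x * \<eta> z ([] @ basis_tvec z x # map (basis_tvec z) R))"
          by (rule twisted_form_sum_slot[OF \<eta>(4) z]) (use R tvec_tangent[OF z] in auto)
        moreover have "\<eta> z ([] @ (\<lambda>g. 0) # map (basis_tvec z) R) = 0"
          by (rule twisted_form_zero_slot[OF \<eta>(4) z]) (use R tvec_tangent[OF z] in auto)
        moreover have "(\<lambda>g. \<Sum>x\<in>UNIV. z $ x * basis_tvec z x g) = (\<lambda>g. 0)"
          using tvec_expand[OF z, of z] tvec_radial[OF z] by simp
        ultimately show ?thesis by (simp add: coefficient_def)
      qed
      from alternating.bivector_radial[OF alt[OF z] this ijk]
      show "z $ i * P j k z + z $ j * P k i z + z $ k * P i j z = 0"
        using BP[OF z] by (simp add: B_def)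
    qed
  qed

  have rel: "(\<Sum>k\<in>UNIV. P j k z * A k z) = 0" for j z
  proof -
    have "hpoly UNIV (dF + 1 + (dG + 1)) (\<lambda>z. \<Sum>k\<in>UNIV. P j k z * A k z)"
      by (intro hpoly_sum hpoly_mult P A)
    then show ?thesis
    proof (rule hpoly_eq_off_hyperplane)
      fix z0 :: "complex ^ 'i" assume z0: "z0 $ j \<noteq> 0"
      \<comment> \<open>Row \<open>j\<close> of \<open>P\<close> has degree \<open>dF + 1\<close>;
        the power of the coordinate \<open>j\<close> makes it homogeneous of degree 1, so that it
        descends to a vector field on the chart.\<close>
      define Y where "Y = (\<lambda>z. (z $ j) powi (- dF) *s (\<chi> k. P j k z))"
      have Yhom: "Y (c *s z) = c *s Y z" if c: "c \<noteq> 0" for c z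
      proof -
        have "P j k (c *s z) = c powi (dF + 1) * P j k z" for k
        proof (cases "dF + 1 \<ge> 0")
          case True
          then show ?thesis using hpoly_scale[OF P True] by (simp add: power_int_def)
        next
          case False
          then show ?thesis using hpoly_neg[OF P] by simp
        qed
        moreover have "c powi (- dF) * c powi (dF + 1) = c"
          using c by (simp flip: power_int_add)
        ultimately have "Y (c *s z) $ k = (c *s Y z) $ k" for k
          unfolding Y_def by (simp add: power_int_mult_distrib mult.assoc mult.left_commute[of "c powi (dF + 1)"])
        then show ?thesis by (simp add: vec_eq_iff)
      qed
      have sec: "descend_field Y \<in> \<T> (chart_dom j)"
      proof (rule descend_field_section[OF open_chart_dom])
        show "holo_on (punctured_cone (chart_dom j)) (\<lambda>z. Y z $ k)" for k
          unfolding Y_def vector_smult_component vec_lambda_beta punctured_cone_chart_dom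
          by (intro holo_on_mult holo_on_power_int holo_on_coord holo_on_hpoly[OF P]) simp
      qed (rule Yhom)
      have Y_eq: "descend_field Y (abs_proj z) = tvec z (Y z)" if "z $ j \<noteq> 0" for z
        using that by (intro descend_field_abs_proj Yhom) auto
      have "descend_field Y \<in> annihilator q \<eta> (chart_dom j)"
        unfolding annihilator_def mem_Collect_eq
      proof (intro conjI sec ballI)
        fix z us assume z: "z \<in> punctured_cone (chart_dom j)"
          and us: "us \<in> tangent_lists (q - 1) (abs_proj z)"
        have zj: "z $ j \<noteq> 0" using z by (simp add: punctured_cone_chart_dom)
        then have nz: "z \<noteq> 0" by auto
        have tan: "tvec z (Y z) \<in> tangent_space (abs_proj z)" by (rule tvec_tangent[OF nz])
        \<comment> \<open>On the chart the remaining arguments may be taken among the basis vectors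
          other than \<open>j\<close>, which is the case covered by
          \<open>bivector_contraction\<close>.\<close>
        have "\<eta> z ([tvec z (Y z)] @ us) = 0"
        proof (rule twisted_form_vanishI[OF \<eta>(4) nz, of "UNIV - {j}" "basis_tvec z"])
          show "basis_tvec z i \<in> tangent_space (abs_proj z)" for i by (rule tvec_tangent[OF nz])
          show "\<exists>c. u = (\<lambda>g. \<Sum>i\<in>UNIV - {j}. c i * basis_tvec z i g)" if "u \<in> tangent_space (abs_proj z)" for u
            by (rule tangent_space_span_chart[OF zj that])
          show "length [tvec z (Y z)] + length us = q" "set [tvec z (Y z)] \<subseteq> tangent_space (abs_proj z)"
            "set us \<subseteq> tangent_space (abs_proj z)"
            using us \<eta>(2) tan by (auto simp: tangent_lists_def)
          fix K :: "'i list" assume K: "length K = length us" "set K \<subseteq> UNIV - {j}"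
          then have lenK: "Suc (length K) = q" using us \<eta>(2) by (auto simp: tangent_lists_def)
          have "\<eta> z ([] @ (\<lambda>g. \<Sum>k\<in>UNIV. Y z $ k * basis_tvec z k g) # map (basis_tvec z) K) =
              (\<Sum>k\<in>UNIV. Y z $ k * \<eta> z ([] @ basis_tvec z k # map (basis_tvec z) K))"
            by (rule twisted_form_sum_slot[OF \<eta>(4) nz]) (use lenK tvec_tangent[OF nz] in auto)
          also have "\<dots> = (z $ j) powi (- dF) * (\<Sum>k\<in>UNIV. P j k z * coefficient \<eta> (k # K) z)"
            by (simp add: Y_def coefficient_def sum_distrib_left mult.assoc)
          also have "(\<Sum>k\<in>UNIV. P j k z * coefficient \<eta> (k # K) z) = 0"
            using alternating.bivector_contraction[OF alt[OF nz] lenK, of j] K(2) BP[OF nz, of j]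
            by (auto simp: B_def)
          finally show "\<eta> z ([tvec z (Y z)] @ map (basis_tvec z) K) = 0"
            using tvec_expand[OF nz, of "Y z"] by simp
        qed
        then show "\<eta> z (descend_field Y (abs_proj z) # us) = 0" using Y_eq[OF zj] by simp
      qed
      then have "descend_field Y \<in> F (chart_dom j)" using \<eta>(5)[OF open_chart_dom] by simp
      \<comment> \<open>Here the inclusion of the flag enters: the row of \<open>P\<close>, a
        section of \<open>F\<close>, is annihilated by the form of \<open>G\<close>.\<close>
      then have "descend_field Y \<in> G (chart_dom j)" using sub[OF open_chart_dom] by blast
      then have ann: "descend_field Y \<in> annihilator 1 \<omega> (chart_dom j)" using \<omega>(4)[OF open_chart_dom] by simp
      have "z0 \<in> punctured_cone (chart_dom j)" using z0 by (simp add: punctured_cone_chart_dom)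
      from ann[unfolded annihilator_def mem_Collect_eq, THEN conjunct2, rule_format, OF this, of "[]"]
      have "\<omega> z0 [descend_field Y (abs_proj z0)] = 0" by (simp add: tangent_lists_def)
      then have "(\<Sum>k\<in>UNIV. Y z0 $ k * A k z0) = 0"
      proof -
        have "z0 \<noteq> 0" using z0 by auto
        then show ?thesis
          using \<open>\<omega> z0 [descend_field Y (abs_proj z0)] = 0\<close> Y_eq[OF z0] sum_form[of z0 "Y z0"] by simp
      qed
      then have "(z0 $ j) powi (- dF) * (\<Sum>k\<in>UNIV. P j k z0 * A k z0) = 0"
        by (simp add: Y_def sum_distrib_left mult.assoc)
      then show "(\<Sum>k\<in>UNIV. P j k z0 * A k z0) = 0" using z0 by simp
    qed
  qed

  \<comment> \<open>Here \<open>a = dG + 1\<close> is at least 3 and \<open>b = dF + 1\<close> is at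
    most \<open>a\<close>.\<close>
  have "P j k z = 0" for j k z
    by (rule bivector_eq_0[OF _ card(2) zA P _ skew rel radial]) (use \<open>dG \<ge> 2\<close> deg_le in auto)
  then have E0: "coefficient \<eta> is z = 0" if "z \<noteq> 0" "length is = q" for z "is"
    using alternating.E_of_bivector[OF alt[OF that(1)] _ that(2)] BP[OF that(1)] by (simp add: B_def)
  \<comment> \<open>All coefficients of \<open>\<eta>\<close> vanish, hence \<open>\<eta>\<close>
    itself, and a zero form is annihilated by every vector field.\<close>
  have "annihilator q \<eta> UNIV = \<T> UNIV"
    unfolding annihilator_def
  proof (safe)
    fix v :: "'i vfield" and z us assume v: "v \<in> \<T> UNIV" and z: "z \<in> punctured_cone (UNIV :: 'i proj set)"
      and us: "us \<in> tangent_lists (q - 1) (abs_proj z)"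
    have nz: "z \<noteq> 0" using z by (simp add: punctured_cone_iff)
    have vt: "v (abs_proj z) \<in> tangent_space (abs_proj z)" using v by (simp add: tangent_sheaf_def)
    have len: "Suc (length us) = q" and ust: "set us \<subseteq> tangent_space (abs_proj z)"
      using us \<eta>(2) by (auto simp: tangent_lists_def)
    have "\<eta> z ([] @ (v (abs_proj z) # us)) = 0"
    proof (rule twisted_form_vanishI[OF \<eta>(4) nz, of UNIV "basis_tvec z"])
      show "basis_tvec z i \<in> tangent_space (abs_proj z)" for i by (rule tvec_tangent[OF nz])
      show "\<exists>c. u = (\<lambda>g. \<Sum>i\<in>UNIV. c i * basis_tvec z i g)" if "u \<in> tangent_space (abs_proj z)" for u
        by (rule tangent_space_span[OF nz that])
      show "length [] + length (v (abs_proj z) # us) = q" "set [] \<subseteq> tangent_space (abs_proj z)"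
        "set (v (abs_proj z) # us) \<subseteq> tangent_space (abs_proj z)"
        using len ust vt by simp_all
      fix "is" :: "'i list" assume "length is = length (v (abs_proj z) # us)"
      then have "length is = q" using len by simp
      from E0[OF nz this] show "\<eta> z ([] @ map (basis_tvec z) is) = 0" by (simp add: coefficient_def)
    qed
    then show "\<eta> z (v (abs_proj z) # us) = 0" by simp
  qed
  then have "F UNIV = \<T> UNIV" using \<eta>(5)[of UNIV] by simp
  then show False using tangent_sheaf_not_rank_1[OF card(3)] rankF by blast
qed

end
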